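(* There is a morphism of monoid functors (on commutative $\mathbb{F}_2$-algebras) $\mathcal{O}(\mathcal{M}^+)\to\mathcal{M}^+_\infty$, induced by considering a polynomial as a formal power series. The adjoint morphism of graded monoid functors $\mathcal{M}^+\to\gamma\mathcal{M}^+_\infty$ is induced by the morphism of graded bialgebras $\gamma\mathcal{A}^*\to\mathcal{B}^+$ which has components $$\theta_n:\mathbb{F}_2[\xi_i\mid i\ge0,\ \xi_0=1]\to\mathcal{B}_n^+\cong\mathbb{F}_2[\alpha_1,\ldots,\alpha_n],$$ $\xi_i\mapsto\alpha_i$ for $1\le i\le n$ and $\xi_i\mapsto0$ for $i>n$.
   Context: A graded monoid consists of sets $(M_n)_{n\in\mathbb{N}}$ with associative products $M_i\times M_j\to M_{i+j}$ and a unit in $M_0$; a (graded) monoid functor is a functor from commutative $\mathbb{F}_2$-algebras to (graded) monoids. The functor $\mathcal{O}$ from graded monoids to monoids sends $(M_n)$ to $\coprod_nM_n$; its right adjoint $\gamma$ sends a monoid $N$ to the graded monoid with $(\gamma N)_n=N$ for all $n$, with structure maps induced by the product of $N$. For a commutative $\mathbb{F}_2$-algebra $A$: $\mathcal{M}_n^+(A)=\{\sum_{i=0}^n\alpha_ix^{2^i}\mid\alpha_i\in A,\ \alpha_0=1\}$, with product $(f,g)\mapsto f\circ g$ and unit $x$ in degree $0$; $\mathcal{M}_\infty^+(A)=\{\sum_{i=0}^\infty\alpha_ix^{2^i}\mid\alpha_i\in A,\ \alpha_0=1\}$ with product the composition of formal power series. $\mathcal{M}^+$ is represented by the $\mathbb{N}$-graded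 bialgebra $\mathcal{B}^+$ over $\mathbb{F}_2$ with $\mathcal{B}^+_n=\mathbb{F}_2[\alpha_1,\ldots,\alpha_n]$ ($\alpha_0=1$), universal element $\sum_{i=0}^n\alpha_ix^{2^i}$ and coproducts the algebra morphisms $\Delta_{i,j}:\mathcal{B}_{i+j}^+\to\mathcal{B}_i^+\otimes\mathcal{B}_j^+$, $\alpha_k\mapsto\sum_{s+t=k,\,0\le s\le i,\,0\le t\le j}\alpha_s^{2^t}\otimes\alpha_t$ (the first tensor factor is the inner polynomial of the composition). $\mathcal{M}^+_\infty$ is represented by the dual Steenrod algebra $\mathcal{A}^*=\mathbb{F}_2[\xi_i\mid i\ge0,\ \xi_0=1]$, with universal element $\sum_i\xi_ix^{2^i}$ and coproduct $\xi_k\mapsto\sum_{s+t=k}\xi_s^{2^t}\otimes\xi_t$. $\gamma\mathcal{A}^*$ denotes the graded bialgebra with $(\gamma\mathcal{A}^* )_n=\mathcal{A}^*$ for all $n$ and all components $\Delta_{i,j}$ of the coproduct equal to the coproduct of $\mathcal{A}^*$ (counit that of $\mathcal{A}^*$ in degree $0$); it represents $\gamma\mathcal{M}_\infty^+$. Here an $\mathbb{N}$-graded bialgebra is a family $(B_n)$ of commutative $\mathbb{F}_2$-algebras with coassociative, counital algebra morphisms $\Delta_{i,j}:B_{i+j}\to B_i\otimes B_j$ and $B_0\to\mathbb{F}_2$. *)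

theory Defs
  imports "HOL-Algebra.UnivPoly" "HOL-Algebra.QuotRing" "HOL-Library.Poly_Mapping" "HOL-Library.Z2"
begin

section \<open>Commutative algebras over the field with two elements\<close>

definition F2 :: "bit ring" where
  "F2 = \<lparr>carrier = UNIV, mult = (*), one = 1, zero = 0, add = (+)\<rparr>"

text \<open>A commutative ring carries at most one structure of algebra over \<^const>\<open>F2\<close>, and it carries one
  exactly when \<open>1 + 1 = 0\<close> (see \<open>f2_algebra_iff\<close> below). The zero ring is allowed.\<close>

locale f2_algebra = cring A for A (structure) +
  assumes char_two: "\<one> \<oplus> \<one> = \<zero>"

definition f2_unit :: "('a, 'm) ring_scheme \<Rightarrow> bit \<Rightarrow> 'a" where
  "f2_unit A b = (if b = 0 then \<zero>\<^bsub>A\<^esub> else \<one>\<^bsub>A\<^esub>)"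

lemma f2_algebra_iff:
  fixes A (structure)
  shows "f2_algebra A \<longleftrightarrow> cring A \<and> (\<exists>h. h \<in> ring_hom F2 A)"
proof
  assume "f2_algebra A"
  then interpret f2_algebra A .
  have "f2_unit A \<in> ring_hom F2 A"
  proof (rule ring_hom_memI)
    fix x y :: bit
    show "f2_unit A x \<in> carrier A" by (simp add: f2_unit_def)
    show "f2_unit A (x \<otimes>\<^bsub>F2\<^esub> y) = f2_unit A x \<otimes> f2_unit A y"
      by (cases x; cases y) (simp_all add: f2_unit_def F2_def)
    show "f2_unit A (x \<oplus>\<^bsub>F2\<^esub> y) = f2_unit A x \<oplus> f2_unit A y"
      by (cases x; cases y) (simp_all add: f2_unit_def F2_def char_two)
  qed (simp add: f2_unit_def F2_def)
  then show "cring A \<and> (\<exists>h. h \<in> ring_hom F2 A)" using is_cring by blast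
next
  assume *: "cring A \<and> (\<exists>h. h \<in> ring_hom F2 A)"
  then interpret cring A by simp
  obtain h where h: "h \<in> ring_hom F2 A" using * by blast
  have 1: "h 1 = \<one>" using ring_hom_one[OF h] by (simp add: F2_def)
  have add: "h (x + y) = h x \<oplus> h y" for x y
    using ring_hom_add[OF h, of x y] by (simp add: F2_def)
  have "h 0 \<in> carrier A" using ring_hom_closed[OF h, of 0] by (simp add: F2_def)
  then have "h 0 = \<zero>" using add[of 0 0] by (simp add: add.r_cancel_one')
  then have "\<one> \<oplus> \<one> = \<zero>" using add[of 1 1] 1 by simp
  then show "f2_algebra A" by unfold_locales
qed

text \<open>Morphisms are extensional functions, so that equal morphisms are equal as HOL functions.\<close>

definition alg_hom :: "('a, 'm) ring_scheme \<Rightarrow> ('b, 'n) ring_scheme \<Rightarrow> ('a \<Rightarrow> 'b) set" where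
  "alg_hom A B = ring_hom A B \<inter> extensional (carrier A)"


subsection \<open>Tensor products\<close>

text \<open>The algebra over \<^const>\<open>F2\<close> with basis the multiplicative monoid \<open>carrier A \<times> carrier B\<close>.\<close>

definition pair_algebra ::
  "('a, 'm) ring_scheme \<Rightarrow> ('b, 'n) ring_scheme \<Rightarrow> (('a \<times> 'b) \<Rightarrow>\<^sub>0 bit) ring" where
  "pair_algebra A B =
    \<lparr>carrier = {p. Poly_Mapping.keys p \<subseteq> carrier A \<times> carrier B},
     mult = (\<lambda>p q. \<Sum>s\<in>Poly_Mapping.keys p. \<Sum>t\<in>Poly_Mapping.keys q.
       Poly_Mapping.single (fst s \<otimes>\<^bsub>A\<^esub> fst t, snd s \<otimes>\<^bsub>B\<^esub> snd t)
         (Poly_Mapping.lookup p s * Poly_Mapping.lookup q t)),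
     one = Poly_Mapping.single (\<one>\<^bsub>A\<^esub>, \<one>\<^bsub>B\<^esub>) 1,
     zero = 0,
     add = (+)\<rparr>"

text \<open>Additivity in each variable implies bilinearity over \<^const>\<open>F2\<close>.\<close>

definition tensor_relations ::
  "('a, 'm) ring_scheme \<Rightarrow> ('b, 'n) ring_scheme \<Rightarrow> (('a \<times> 'b) \<Rightarrow>\<^sub>0 bit) set" where
  "tensor_relations A B =
     {Poly_Mapping.single (a \<oplus>\<^bsub>A\<^esub> a', b) 1
        - (Poly_Mapping.single (a, b) 1 + Poly_Mapping.single (a', b) 1) | a a' b.
        a \<in> carrier A \<and> a' \<in> carrier A \<and> b \<in> carrier B} \<union>
     {Poly_Mapping.single (a, b \<oplus>\<^bsub>B\<^esub> b') 1
        - (Poly_Mapping.single (a, b) 1 + Poly_Mapping.single (a, b') 1) | a b b'.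
        a \<in> carrier A \<and> b \<in> carrier B \<and> b' \<in> carrier B}"

definition tensor_ideal ::
  "('a, 'm) ring_scheme \<Rightarrow> ('b, 'n) ring_scheme \<Rightarrow> (('a \<times> 'b) \<Rightarrow>\<^sub>0 bit) set" where
  "tensor_ideal A B = Idl\<^bsub>pair_algebra A B\<^esub> (tensor_relations A B)"

definition tensor ::
  "('a, 'm) ring_scheme \<Rightarrow> ('b, 'n) ring_scheme \<Rightarrow> (('a \<times> 'b) \<Rightarrow>\<^sub>0 bit) set ring" where
  "tensor A B = pair_algebra A B Quot tensor_ideal A B"

definition pure_tensor ::
  "('a, 'm) ring_scheme \<Rightarrow> ('b, 'n) ring_scheme \<Rightarrow> 'a \<Rightarrow> 'b \<Rightarrow> (('a \<times> 'b) \<Rightarrow>\<^sub>0 bit) set" where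
  "pure_tensor A B a b = tensor_ideal A B +>\<^bsub>pair_algebra A B\<^esub> Poly_Mapping.single (a, b) 1"

text \<open>The morphism \<open>a \<otimes> b \<mapsto> f a \<cdot> g b\<close> out of the tensor product. The sum below takes the
  same value on all representatives of a class when \<open>f\<close>, \<open>g\<close> are morphisms of algebras.\<close>

definition tensor_lift ::
  "('a, 'm) ring_scheme \<Rightarrow> ('b, 'n) ring_scheme \<Rightarrow> ('c, 'k) ring_scheme \<Rightarrow>
    ('a \<Rightarrow> 'c) \<Rightarrow> ('b \<Rightarrow> 'c) \<Rightarrow> (('a \<times> 'b) \<Rightarrow>\<^sub>0 bit) set \<Rightarrow> 'c" where
  "tensor_lift A B C f g = (\<lambda>X \<in> carrier (tensor A B).
     the_elem ((\<lambda>p. \<Oplus>\<^bsub>C\<^esub>s\<in>Poly_Mapping.keys p. f (fst s) \<otimes>\<^bsub>C\<^esub> g (snd s)) ` X))"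

definition tensor_map ::
  "('a, 'm) ring_scheme \<Rightarrow> ('b, 'n) ring_scheme \<Rightarrow> ('c, 'k) ring_scheme \<Rightarrow> ('d, 'l) ring_scheme \<Rightarrow>
    ('a \<Rightarrow> 'c) \<Rightarrow> ('b \<Rightarrow> 'd) \<Rightarrow> (('a \<times> 'b) \<Rightarrow>\<^sub>0 bit) set \<Rightarrow> (('c \<times> 'd) \<Rightarrow>\<^sub>0 bit) set" where
  "tensor_map A B C D f g = tensor_lift A B (tensor C D)
     (\<lambda>a. pure_tensor C D (f a) \<one>\<^bsub>D\<^esub>) (\<lambda>b. pure_tensor C D \<one>\<^bsub>C\<^esub> (g b))"

text \<open>\<open>(a \<otimes> b) \<otimes> c \<mapsto> a \<otimes> (b \<otimes> c)\<close>\<close>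

definition tensor_assoc ::
  "('a, 'm) ring_scheme \<Rightarrow> ('b, 'n) ring_scheme \<Rightarrow> ('c, 'k) ring_scheme \<Rightarrow>
    (((('a \<times> 'b) \<Rightarrow>\<^sub>0 bit) set \<times> 'c) \<Rightarrow>\<^sub>0 bit) set \<Rightarrow> (('a \<times> (('b \<times> 'c) \<Rightarrow>\<^sub>0 bit) set) \<Rightarrow>\<^sub>0 bit) set"
  where
  "tensor_assoc A B C =
    tensor_lift (tensor A B) C (tensor A (tensor B C))
     (tensor_lift A B (tensor A (tensor B C))
       (\<lambda>a. pure_tensor A (tensor B C) a \<one>\<^bsub>tensor B C\<^esub>)
       (\<lambda>b. pure_tensor A (tensor B C) \<one>\<^bsub>A\<^esub> (pure_tensor B C b \<one>\<^bsub>C\<^esub>)))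
     (\<lambda>c. pure_tensor A (tensor B C) \<one>\<^bsub>A\<^esub> (pure_tensor B C \<one>\<^bsub>B\<^esub> c))"


section \<open>Monoid functors and graded monoid functors\<close>

subsection \<open>Graded monoids\<close>

record 'x graded_monoid =
  gcarrier :: "nat \<Rightarrow> 'x set"
  gmult :: "nat \<Rightarrow> nat \<Rightarrow> 'x \<Rightarrow> 'x \<Rightarrow> 'x"
  gone :: 'x

locale graded_monoid =
  fixes M :: "'x graded_monoid"
  assumes gone_closed: "gone M \<in> gcarrier M 0"
    and gmult_closed: "\<lbrakk>x \<in> gcarrier M i; y \<in> gcarrier M j\<rbrakk> \<Longrightarrow> gmult M i j x y \<in> gcarrier M (i + j)"
    and gmult_assoc: "\<lbrakk>x \<in> gcarrier M i; y \<in> gcarrier M j; z \<in> gcarrier M k\<rbrakk> \<Longrightarrow>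
      gmult M (i + j) k (gmult M i j x y) z = gmult M i (j + k) x (gmult M j k y z)"
    and gone_left: "x \<in> gcarrier M i \<Longrightarrow> gmult M 0 i (gone M) x = x"
    and gone_right: "x \<in> gcarrier M i \<Longrightarrow> gmult M i 0 x (gone M) = x"

definition unital_hom :: "('x, 'm) monoid_scheme \<Rightarrow> ('y, 'n) monoid_scheme \<Rightarrow> ('x \<Rightarrow> 'y) set" where
  "unital_hom M N = {f \<in> hom M N. f \<one>\<^bsub>M\<^esub> = \<one>\<^bsub>N\<^esub>}"

definition graded_hom :: "'x graded_monoid \<Rightarrow> 'y graded_monoid \<Rightarrow> (nat \<Rightarrow> 'x \<Rightarrow> 'y) set" where
  "graded_hom M N = {f.
     (\<forall>n. \<forall>x \<in> gcarrier M n. f n x \<in> gcarrier N n) \<and>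
     (\<forall>i j. \<forall>x \<in> gcarrier M i. \<forall>y \<in> gcarrier M j.
        f (i + j) (gmult M i j x y) = gmult N i j (f i x) (f j y)) \<and>
     f 0 (gone M) = gone N}"

definition O_monoid :: "'x graded_monoid \<Rightarrow> (nat \<times> 'x) monoid" where
  "O_monoid M =
    \<lparr>carrier = (SIGMA n:UNIV. gcarrier M n),
     mult = (\<lambda>(i, x) (j, y). (i + j, gmult M i j x y)),
     one = (0, gone M)\<rparr>"

definition gamma_monoid :: "'x monoid \<Rightarrow> 'x graded_monoid" where
  "gamma_monoid N =
    \<lparr>gcarrier = (\<lambda>n. carrier N), gmult = (\<lambda>i j. mult N), gone = \<one>\<^bsub>N\<^esub>\<rparr>"

text \<open>The adjunction bijection between morphisms \<open>O_monoid M \<rightarrow> N\<close> and \<open>M \<rightarrow> gamma_monoid N\<close> is currying.\<close>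

lemma O_gamma_adjunction:
  "curry f \<in> graded_hom M (gamma_monoid N) \<longleftrightarrow> f \<in> unital_hom (O_monoid M) N"
  by (auto simp: graded_hom_def unital_hom_def hom_def O_monoid_def gamma_monoid_def curry_def Pi_iff)


subsection \<open>Functors on commutative F2-algebras\<close>

text \<open>Functors are considered on the algebras whose carrier is a subset of a type \<open>'a\<close>; this type is
  arbitrary and plays the role of a universe. \<open>mmap F A B h\<close> is the action of \<open>F\<close> on a morphism
  \<open>h : A \<rightarrow> B\<close>.\<close>

record ('a, 'x) monoid_functor =
  mobj :: "'a ring \<Rightarrow> 'x monoid"
  mmap :: "'a ring \<Rightarrow> 'a ring \<Rightarrow> ('a \<Rightarrow> 'a) \<Rightarrow> 'x \<Rightarrow> 'x"

locale monoid_functor =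
  fixes F :: "('a, 'x) monoid_functor"
  assumes obj: "f2_algebra A \<Longrightarrow> monoid (mobj F A)"
    and map: "\<lbrakk>f2_algebra A; f2_algebra B; h \<in> alg_hom A B\<rbrakk> \<Longrightarrow>
      mmap F A B h \<in> unital_hom (mobj F A) (mobj F B)"
    and map_id: "\<lbrakk>f2_algebra A; x \<in> carrier (mobj F A)\<rbrakk> \<Longrightarrow> mmap F A A (\<lambda>a \<in> carrier A. a) x = x"
    and map_comp: "\<lbrakk>f2_algebra A; f2_algebra B; f2_algebra C; h \<in> alg_hom A B; k \<in> alg_hom B C;
        x \<in> carrier (mobj F A)\<rbrakk> \<Longrightarrow>
      mmap F A C (compose (carrier A) k h) x = mmap F B C k (mmap F A B h x)"

record ('a, 'x) graded_monoid_functor =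
  gobj :: "'a ring \<Rightarrow> 'x graded_monoid"
  gmap :: "'a ring \<Rightarrow> 'a ring \<Rightarrow> ('a \<Rightarrow> 'a) \<Rightarrow> nat \<Rightarrow> 'x \<Rightarrow> 'x"

locale graded_monoid_functor =
  fixes F :: "('a, 'x) graded_monoid_functor"
  assumes obj: "f2_algebra A \<Longrightarrow> graded_monoid (gobj F A)"
    and map: "\<lbrakk>f2_algebra A; f2_algebra B; h \<in> alg_hom A B\<rbrakk> \<Longrightarrow>
      gmap F A B h \<in> graded_hom (gobj F A) (gobj F B)"
    and map_id: "\<lbrakk>f2_algebra A; x \<in> gcarrier (gobj F A) n\<rbrakk> \<Longrightarrow>
      gmap F A A (\<lambda>a \<in> carrier A. a) n x = x"
    and map_comp: "\<lbrakk>f2_algebra A; f2_algebra B; f2_algebra C; h \<in> alg_hom A B; k \<in> alg_hom B C;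
        x \<in> gcarrier (gobj F A) n\<rbrakk> \<Longrightarrow>
      gmap F A C (compose (carrier A) k h) n x = gmap F B C k n (gmap F A B h n x)"

definition monoid_functor_morphism ::
  "('a, 'x) monoid_functor \<Rightarrow> ('a, 'y) monoid_functor \<Rightarrow> ('a ring \<Rightarrow> 'x \<Rightarrow> 'y) \<Rightarrow> bool" where
  "monoid_functor_morphism F G \<tau> \<longleftrightarrow> monoid_functor F \<and> monoid_functor G \<and>
     (\<forall>A. f2_algebra A \<longrightarrow> \<tau> A \<in> unital_hom (mobj F A) (mobj G A)) \<and>
     (\<forall>A B h. f2_algebra A \<longrightarrow> f2_algebra B \<longrightarrow> h \<in> alg_hom A B \<longrightarrow>
        (\<forall>x \<in> carrier (mobj F A). \<tau> B (mmap F A B h x) = mmap G A B h (\<tau> A x)))"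

definition graded_monoid_functor_morphism ::
  "('a, 'x) graded_monoid_functor \<Rightarrow> ('a, 'y) graded_monoid_functor \<Rightarrow>
    ('a ring \<Rightarrow> nat \<Rightarrow> 'x \<Rightarrow> 'y) \<Rightarrow> bool" where
  "graded_monoid_functor_morphism F G \<tau> \<longleftrightarrow> graded_monoid_functor F \<and> graded_monoid_functor G \<and>
     (\<forall>A. f2_algebra A \<longrightarrow> \<tau> A \<in> graded_hom (gobj F A) (gobj G A)) \<and>
     (\<forall>A B h. f2_algebra A \<longrightarrow> f2_algebra B \<longrightarrow> h \<in> alg_hom A B \<longrightarrow>
        (\<forall>n. \<forall>x \<in> gcarrier (gobj F A) n. \<tau> B n (gmap F A B h n x) = gmap G A B h n (\<tau> A n x)))"

definition graded_monoid_functor_iso ::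
  "('a, 'x) graded_monoid_functor \<Rightarrow> ('a, 'y) graded_monoid_functor \<Rightarrow>
    ('a ring \<Rightarrow> nat \<Rightarrow> 'x \<Rightarrow> 'y) \<Rightarrow> bool" where
  "graded_monoid_functor_iso F G \<tau> \<longleftrightarrow> graded_monoid_functor_morphism F G \<tau> \<and>
     (\<forall>A n. f2_algebra A \<longrightarrow> bij_betw (\<tau> A n) (gcarrier (gobj F A) n) (gcarrier (gobj G A) n))"

definition O_functor ::
  "('a, 'x) graded_monoid_functor \<Rightarrow> ('a, nat \<times> 'x) monoid_functor" where
  "O_functor F =
    \<lparr>mobj = (\<lambda>A. O_monoid (gobj F A)), mmap = (\<lambda>A B h (n, x). (n, gmap F A B h n x))\<rparr>"

definition gamma_functor ::
  "('a, 'x) monoid_functor \<Rightarrow> ('a, 'x) graded_monoid_functor" where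
  "gamma_functor G =
    \<lparr>gobj = (\<lambda>A. gamma_monoid (mobj G A)), gmap = (\<lambda>A B h n. mmap G A B h)\<rparr>"

text \<open>The morphism \<open>F \<rightarrow> gamma_functor G\<close> adjoint to \<open>\<tau> : O_functor F \<rightarrow> G\<close>; see \<open>O_gamma_adjunction\<close>.\<close>

definition adjoint_morphism ::
  "('a ring \<Rightarrow> nat \<times> 'x \<Rightarrow> 'y) \<Rightarrow> 'a ring \<Rightarrow> nat \<Rightarrow> 'x \<Rightarrow> 'y" where
  "adjoint_morphism \<tau> A = curry (\<tau> A)"


section \<open>Additive polynomials and additive power series\<close>

definition additive_poly :: "'a ring \<Rightarrow> nat \<Rightarrow> (nat \<Rightarrow> 'a) \<Rightarrow> nat \<Rightarrow> 'a" where
  "additive_poly A n a = (\<Oplus>\<^bsub>UP A\<^esub>i\<in>{0..n}. monom (UP A) (a i) (2 ^ i))"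

text \<open>\<open>poly_comp A f g\<close> is \<open>f \<circ> g\<close>, that is, \<open>f\<close> evaluated at \<open>g\<close> in the polynomial ring.\<close>

definition poly_comp :: "'a ring \<Rightarrow> (nat \<Rightarrow> 'a) \<Rightarrow> (nat \<Rightarrow> 'a) \<Rightarrow> nat \<Rightarrow> 'a" where
  "poly_comp A f g = eval A (UP A) (\<lambda>c. monom (UP A) c 0) g f"

definition Mplus :: "('a, nat \<Rightarrow> 'a) graded_monoid_functor" where
  "Mplus =
    \<lparr>gobj = (\<lambda>A.
       \<lparr>gcarrier = (\<lambda>n. {additive_poly A n a | a. a \<in> {0..n} \<rightarrow> carrier A \<and> a 0 = \<one>\<^bsub>A\<^esub>}),
        gmult = (\<lambda>i j. poly_comp A),
        gone = monom (UP A) \<one>\<^bsub>A\<^esub> 1\<rparr>),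
     gmap = (\<lambda>A B h n f m. h (coeff (UP A) f m))\<rparr>"

text \<open>A formal power series is the function giving its coefficients.\<close>

definition fps_ring :: "'a ring \<Rightarrow> (nat \<Rightarrow> 'a) ring" where
  "fps_ring A =
    \<lparr>carrier = UNIV \<rightarrow> carrier A,
     mult = (\<lambda>f g n. \<Oplus>\<^bsub>A\<^esub>i\<in>{..n}. f i \<otimes>\<^bsub>A\<^esub> g (n - i)),
     one = (\<lambda>n. if n = 0 then \<one>\<^bsub>A\<^esub> else \<zero>\<^bsub>A\<^esub>),
     zero = (\<lambda>n. \<zero>\<^bsub>A\<^esub>),
     add = (\<lambda>f g n. f n \<oplus>\<^bsub>A\<^esub> g n)\<rparr>"

text \<open>Composition \<open>f \<circ> g\<close>, for \<open>g\<close> with zero constant term: \<open>g\<^sup>i\<close> does not contribute to the coefficient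
  of \<open>x\<^sup>m\<close> when \<open>i > m\<close>.\<close>

definition series_comp :: "'a ring \<Rightarrow> (nat \<Rightarrow> 'a) \<Rightarrow> (nat \<Rightarrow> 'a) \<Rightarrow> nat \<Rightarrow> 'a" where
  "series_comp A f g m = (\<Oplus>\<^bsub>A\<^esub>i\<in>{0..m}. f i \<otimes>\<^bsub>A\<^esub> (g [^]\<^bsub>fps_ring A\<^esub> i) m)"

text \<open>The series \<open>\<Sum>i. a i x^(2^i)\<close>; the index set below has at most one element.\<close>

definition additive_series :: "'a ring \<Rightarrow> (nat \<Rightarrow> 'a) \<Rightarrow> nat \<Rightarrow> 'a" where
  "additive_series A a m = (\<Oplus>\<^bsub>A\<^esub>i\<in>{i. 2 ^ i = m}. a i)"

definition Minf :: "('a, nat \<Rightarrow> 'a) monoid_functor" where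
  "Minf =
    \<lparr>mobj = (\<lambda>A.
       \<lparr>carrier = {additive_series A a | a. a \<in> UNIV \<rightarrow> carrier A \<and> a 0 = \<one>\<^bsub>A\<^esub>},
        mult = series_comp A,
        one = (\<lambda>m. if m = 1 then \<one>\<^bsub>A\<^esub> else \<zero>\<^bsub>A\<^esub>)\<rparr>),
     mmap = (\<lambda>A B h f m. h (f m))\<rparr>"

text \<open>A polynomial considered as a formal power series.\<close>

definition poly_to_series :: "'a ring \<Rightarrow> nat \<times> (nat \<Rightarrow> 'a) \<Rightarrow> nat \<Rightarrow> 'a" where
  "poly_to_series A = (\<lambda>(n, f). coeff (UP A) f)"


section \<open>Graded bialgebras\<close>

record 'b bialgebra =
  alg :: "'b ring"
  comult :: "'b \<Rightarrow> (('b \<times> 'b) \<Rightarrow>\<^sub>0 bit) set"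
  counit :: "'b \<Rightarrow> bit"

record 'b graded_bialgebra =
  galg :: "nat \<Rightarrow> 'b ring"
  gcomult :: "nat \<Rightarrow> nat \<Rightarrow> 'b \<Rightarrow> (('b \<times> 'b) \<Rightarrow>\<^sub>0 bit) set"
  gcounit :: "'b \<Rightarrow> bit"

locale graded_bialgebra =
  fixes B :: "'b graded_bialgebra"
  assumes algebra: "f2_algebra (galg B n)"
    and comult_hom: "gcomult B i j \<in> alg_hom (galg B (i + j)) (tensor (galg B i) (galg B j))"
    and counit_hom: "gcounit B \<in> alg_hom (galg B 0) F2"
    and coassoc: "x \<in> carrier (galg B (i + j + k)) \<Longrightarrow>
      tensor_assoc (galg B i) (galg B j) (galg B k)
        (tensor_map (galg B (i + j)) (galg B k) (tensor (galg B i) (galg B j)) (galg B k)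
          (gcomult B i j) (\<lambda>y. y) (gcomult B (i + j) k x)) =
      tensor_map (galg B i) (galg B (j + k)) (galg B i) (tensor (galg B j) (galg B k))
        (\<lambda>y. y) (gcomult B j k) (gcomult B i (j + k) x)"
    \<comment> \<open>In the counit laws, \<^const>\<open>tensor_lift\<close> is the canonical isomorphism with \<open>galg B n\<close>.\<close>
    and counit_left: "x \<in> carrier (galg B n) \<Longrightarrow>
      tensor_lift F2 (galg B n) (galg B n) (f2_unit (galg B n)) (\<lambda>y. y)
        (tensor_map (galg B 0) (galg B n) F2 (galg B n) (gcounit B) (\<lambda>y. y) (gcomult B 0 n x)) = x"
    and counit_right: "x \<in> carrier (galg B n) \<Longrightarrow>
      tensor_lift (galg B n) F2 (galg B n) (\<lambda>y. y) (f2_unit (galg B n))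
        (tensor_map (galg B n) (galg B 0) (galg B n) F2 (\<lambda>y. y) (gcounit B) (gcomult B n 0 x)) = x"

definition graded_bialgebra_morphism ::
  "'b graded_bialgebra \<Rightarrow> 'c graded_bialgebra \<Rightarrow> (nat \<Rightarrow> 'b \<Rightarrow> 'c) \<Rightarrow> bool" where
  "graded_bialgebra_morphism B C \<theta> \<longleftrightarrow> graded_bialgebra B \<and> graded_bialgebra C \<and>
     (\<forall>n. \<theta> n \<in> alg_hom (galg B n) (galg C n)) \<and>
     (\<forall>i j. \<forall>x \<in> carrier (galg B (i + j)).
        gcomult C i j (\<theta> (i + j) x) =
        tensor_map (galg B i) (galg B j) (galg C i) (galg C j) (\<theta> i) (\<theta> j) (gcomult B i j x)) \<and>
     (\<forall>x \<in> carrier (galg B 0). gcounit C (\<theta> 0 x) = gcounit B x)"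

definition gamma_bialgebra :: "'b bialgebra \<Rightarrow> 'b graded_bialgebra" where
  "gamma_bialgebra H =
    \<lparr>galg = (\<lambda>n. alg H), gcomult = (\<lambda>i j. comult H), gcounit = counit H\<rparr>"

text \<open>The graded monoid functor represented by a graded bialgebra. The first tensor factor of the
  coproduct corresponds to the right-hand factor of a product (the inner polynomial of a composition),
  so the product of \<open>\<phi>\<close> in degree \<open>i\<close> and \<open>\<psi>\<close> in degree \<open>j\<close> is
  \<open>B_(j+i) \<rightarrow> B_j \<otimes> B_i \<rightarrow> A\<close>, with second map \<open>b \<otimes> b' \<mapsto> \<psi> b \<cdot> \<phi> b'\<close>.\<close>

definition Hom_functor :: "'b graded_bialgebra \<Rightarrow> ('a, 'b \<Rightarrow> 'a) graded_monoid_functor" where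
  "Hom_functor B =
    \<lparr>gobj = (\<lambda>A.
       \<lparr>gcarrier = (\<lambda>n. alg_hom (galg B n) A),
        gmult = (\<lambda>i j \<phi> \<psi>. compose (carrier (galg B (j + i)))
          (tensor_lift (galg B j) (galg B i) A \<psi> \<phi>) (gcomult B j i)),
        gone = compose (carrier (galg B 0)) (f2_unit A) (gcounit B)\<rparr>),
     gmap = (\<lambda>A A' h n \<phi>. compose (carrier (galg B n)) h \<phi>)\<rparr>"

text \<open>\<open>\<tau> : F \<rightarrow> G\<close> is induced by \<open>\<theta> : C \<rightarrow> B\<close>, where \<open>\<rho>\<close> and \<open>\<sigma>\<close> exhibit \<open>F\<close> and \<open>G\<close> as represented by
  \<open>B\<close> and \<open>C\<close>: under \<open>\<rho>\<close> and \<open>\<sigma>\<close>, \<open>\<tau>\<close> is precomposition with \<open>\<theta>\<close>.\<close>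

definition induced_by ::
  "'b graded_bialgebra \<Rightarrow> 'c graded_bialgebra \<Rightarrow>
    ('a, 'x) graded_monoid_functor \<Rightarrow> ('a, 'y) graded_monoid_functor \<Rightarrow>
    ('a ring \<Rightarrow> nat \<Rightarrow> ('b \<Rightarrow> 'a) \<Rightarrow> 'x) \<Rightarrow> ('a ring \<Rightarrow> nat \<Rightarrow> ('c \<Rightarrow> 'a) \<Rightarrow> 'y) \<Rightarrow>
    ('a ring \<Rightarrow> nat \<Rightarrow> 'x \<Rightarrow> 'y) \<Rightarrow> (nat \<Rightarrow> 'c \<Rightarrow> 'b) \<Rightarrow> bool" where
  "induced_by B C F G \<rho> \<sigma> \<tau> \<theta> \<longleftrightarrow>
     graded_monoid_functor_iso (Hom_functor B) F \<rho> \<and>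
     graded_monoid_functor_iso (Hom_functor C) G \<sigma> \<and>
     graded_bialgebra_morphism C B \<theta> \<and>
     (\<forall>A n \<phi>. f2_algebra A \<longrightarrow> \<phi> \<in> alg_hom (galg B n) A \<longrightarrow>
        \<tau> A n (\<rho> A n \<phi>) = \<sigma> A n (compose (carrier (galg C n)) \<phi> (\<theta> n)))"


subsection \<open>The bialgebras representing additive polynomials and series\<close>

type_synonym f2_mpoly = "(nat \<Rightarrow>\<^sub>0 nat) \<Rightarrow>\<^sub>0 bit"

definition f2_poly_ring :: "nat set \<Rightarrow> f2_mpoly ring" where
  "f2_poly_ring I =
    \<lparr>carrier = {p. \<forall>m \<in> Poly_Mapping.keys p. Poly_Mapping.keys m \<subseteq> I},
     mult = (*), one = 1, zero = 0, add = (+)\<rparr>"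

text \<open>Both families of generators \<open>\<alpha>_i\<close> and \<open>\<xi>_i\<close> are written \<open>gen i\<close>; only \<open>i \<ge> 1\<close> is a variable.\<close>

definition gen :: "nat \<Rightarrow> f2_mpoly" where
  "gen i = (if i = 0 then 1 else Poly_Mapping.single (Poly_Mapping.single i 1) 1)"

text \<open>The algebra morphism sending the variable \<open>i\<close> to \<open>v i\<close>: the value of a polynomial is the sum of
  the values of the monomials occurring in it, since these have coefficient \<open>1\<close>.\<close>

definition f2_poly_hom :: "nat set \<Rightarrow> ('a, 'm) ring_scheme \<Rightarrow> (nat \<Rightarrow> 'a) \<Rightarrow> f2_mpoly \<Rightarrow> 'a" where
  "f2_poly_hom I R v = (\<lambda>p \<in> carrier (f2_poly_ring I).
     \<Oplus>\<^bsub>R\<^esub>m\<in>Poly_Mapping.keys p.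
       \<Otimes>\<^bsub>R\<^esub>i\<in>Poly_Mapping.keys m. v i [^]\<^bsub>R\<^esub> Poly_Mapping.lookup m i)"

definition Bplus_alg :: "nat \<Rightarrow> f2_mpoly ring" where
  "Bplus_alg n = f2_poly_ring {1..n}"

definition Bplus :: "f2_mpoly graded_bialgebra" where
  "Bplus =
    \<lparr>galg = Bplus_alg,
     gcomult = (\<lambda>i j. f2_poly_hom {1..i + j} (tensor (Bplus_alg i) (Bplus_alg j))
       (\<lambda>k. finsum (tensor (Bplus_alg i) (Bplus_alg j))
         (\<lambda>(s, t). pure_tensor (Bplus_alg i) (Bplus_alg j) (gen s ^ (2 ^ t)) (gen t))
         {(s, t). s + t = k \<and> s \<le> i \<and> t \<le> j})),
     gcounit = f2_poly_hom {} F2 (\<lambda>_. 0)\<rparr>"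

definition Steenrod_alg :: "f2_mpoly ring" where
  "Steenrod_alg = f2_poly_ring {1..}"

definition dual_Steenrod :: "f2_mpoly bialgebra" where
  "dual_Steenrod =
    \<lparr>alg = Steenrod_alg,
     comult = f2_poly_hom {1..} (tensor Steenrod_alg Steenrod_alg)
       (\<lambda>k. finsum (tensor Steenrod_alg Steenrod_alg)
         (\<lambda>(s, t). pure_tensor Steenrod_alg Steenrod_alg (gen s ^ (2 ^ t)) (gen t))
         {(s, t). s + t = k}),
     counit = f2_poly_hom {1..} F2 (\<lambda>_. 0)\<rparr>"

text \<open>A morphism \<open>\<phi>\<close> to \<open>A\<close> is sent to the image under \<open>\<phi>\<close> of the universal polynomial or series.\<close>

definition Bplus_universal :: "'a ring \<Rightarrow> nat \<Rightarrow> (f2_mpoly \<Rightarrow> 'a) \<Rightarrow> nat \<Rightarrow> 'a" where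
  "Bplus_universal A n \<phi> = (\<lambda>m. \<phi> (coeff (UP (Bplus_alg n)) (additive_poly (Bplus_alg n) n gen) m))"

definition Steenrod_universal :: "'a ring \<Rightarrow> nat \<Rightarrow> (f2_mpoly \<Rightarrow> 'a) \<Rightarrow> nat \<Rightarrow> 'a" where
  "Steenrod_universal A n \<phi> = (\<lambda>m. \<phi> (additive_series Steenrod_alg gen m))"

definition theta :: "nat \<Rightarrow> f2_mpoly \<Rightarrow> f2_mpoly" where
  "theta n = f2_poly_hom {1..} (Bplus_alg n) (\<lambda>i. if i \<le> n then gen i else 0)"

end

theory Submission
  imports Defs "HOL-Library.Extended_Nat"
begin

text \<open>
  Over a commutative algebra of characteristic two, composing the additive series with coefficients \<open>a\<close> (outer)
  and \<open>b\<close> (inner) gives the additive series with coefficients \<open>k \<mapsto> \<Sum>_(s+t=k) b_s^(2^t) a_t\<close>, by the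
  Frobenius identity. This operation on sequences is natural, and it is associative and unital in every such algebra.
  The coproduct of a generator is this operation applied, in the tensor product, to the generators of the two factors,
  so coassociativity and the counit laws are associativity and unitality evaluated in a tensor product, and a morphism
  out of a polynomial algebra is the same thing as a sequence of coefficients. Additive polynomials of degree at most \<open>2^n\<close>
  and additive power series are treated at once, as sequences vanishing beyond a bound in \<open>{0, 1, \<dots>, \<infinity>}\<close>.
\<close>

subsection \<open>Twisted convolution of sequences in characteristic two\<close>

text \<open>Coefficients out of range are set to zero instead of being excluded from the index set:
  every convolution then runs over all pairs \<open>(s, t)\<close> with \<open>s + t = k\<close>,
  and the restrictions \<open>s \<le> i\<close>, \<open>t \<le> j\<close> in the coproduct of
  \<open>Bplus\<close> appear only when it is compared with its definition. Extended naturals serve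
  as bounds because \<open>e + f\<close> bounds a composite in every case;
  \<open>\<infinity> + \<infinity> = \<infinity>\<close> accounts for the constant degrees of
  \<open>gamma_bialgebra dual_Steenrod\<close>. The generators of a truncated polynomial algebra
  form its generic sequence. Equations between morphisms are checked on that sequence, where each
  side becomes an expression in \<open>frob_conv\<close>. For the represented functors the direction
  is reversed: evaluation on generators is injective into the functor of series, and the laws are
  pulled back along it. An element of \<open>UP A\<close> is a coefficient function, as is a formal
  power series here, so a polynomial and its series are literally the same function; comparing
  \<open>Mplus\<close> with \<open>Minf\<close> amounts to showing that the two compositions
  agree.\<close>

text \<open>The sequence \<open>b\<close> is that of the inner series, as the first tensor factor in the coproducts.\<close>

definition frob_conv :: "('a, 'm) ring_scheme \<Rightarrow> (nat \<Rightarrow> 'a) \<Rightarrow> (nat \<Rightarrow> 'a) \<Rightarrow> nat \<Rightarrow> 'a" where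
  "frob_conv A b a k = (\<Oplus>\<^bsub>A\<^esub>z\<in>{(s, t). s + t = k}. case z of (s, t) \<Rightarrow> b s [^]\<^bsub>A\<^esub> (2 ^ t :: nat) \<otimes>\<^bsub>A\<^esub> a t)"

text \<open>The coefficients of the series \<open>x\<close>, the neutral element for
  composition.\<close>

definition unit_seq :: "('a, 'm) ring_scheme \<Rightarrow> nat \<Rightarrow> 'a" where
  "unit_seq A k = (if k = 0 then \<one>\<^bsub>A\<^esub> else \<zero>\<^bsub>A\<^esub>)"

lemma finite_antidiagonal [simp]: "finite {(s, t). s + t = (k :: nat)}"
  "finite {z. fst z + snd z = (k :: nat)}"
  by (rule finite_subset[of _ "{..k} \<times> {..k}"]; auto)+

lemma (in abelian_monoid) finsum_Sigma:
  assumes "finite I" "\<And>i. i \<in> I \<Longrightarrow> finite (J i)"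
    and "\<And>i j. i \<in> I \<Longrightarrow> j \<in> J i \<Longrightarrow> f i j \<in> carrier G"
  shows "(\<Oplus>i\<in>I. \<Oplus>j\<in>J i. f i j) = (\<Oplus>z\<in>Sigma I J. case z of (i, j) \<Rightarrow> f i j)"
  using assms
proof (induction I rule: finite_induct)
  case (insert x F)
  have "Sigma (insert x F) J = Pair x ` J x \<union> Sigma F J" by auto
  moreover have "(\<Oplus>z\<in>Pair x ` J x \<union> Sigma F J. case z of (i, j) \<Rightarrow> f i j) =
      (\<Oplus>z\<in>Pair x ` J x. case z of (i, j) \<Rightarrow> f i j) \<oplus> (\<Oplus>z\<in>Sigma F J. case z of (i, j) \<Rightarrow> f i j)"
    by (rule finsum_Un_disjoint) (use insert in auto)
  moreover have "(\<Oplus>z\<in>Pair x ` J x. case z of (i, j) \<Rightarrow> f i j) = (\<Oplus>j\<in>J x. f x j)"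
    by (subst finsum_reindex) (use insert in \<open>auto simp: inj_on_def\<close>)
  moreover have "(\<Oplus>i\<in>insert x F. \<Oplus>j\<in>J i. f i j) = (\<Oplus>j\<in>J x. f x j) \<oplus> (\<Oplus>i\<in>F. \<Oplus>j\<in>J i. f i j)"
    by (rule finsum_insert) (use insert in \<open>auto intro!: finsum_closed\<close>)
  ultimately show ?case using insert by simp
qed simp

text \<open>Both sides sum over the triples with \<open>p + q + t = k\<close>, grouped by
  \<open>p + q\<close> on the left and by \<open>q + t\<close> on the right.\<close>

lemma (in abelian_monoid) finsum_antidiagonal_assoc:
  fixes k :: nat
  assumes "\<And>p q t. f p q t \<in> carrier G"
  shows "(\<Oplus>z\<in>{(u, t). u + t = k}. case z of (u, t) \<Rightarrow> \<Oplus>z\<in>{(p, q). p + q = u}. case z of (p, q) \<Rightarrow> f p q t) =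
    (\<Oplus>z\<in>{(p, v). p + v = k}. case z of (p, v) \<Rightarrow> \<Oplus>z\<in>{(q, t). q + t = v}. case z of (q, t) \<Rightarrow> f p q t)"
    (is "?l = ?r")
proof -
  let ?D = "\<lambda>k. {(s, t). s + t = (k :: nat)}"
  \<comment> \<open>\<open>?h\<close> turns the grouping \<open>(p, q + t)\<close> into
    \<open>(p + q, t)\<close>, so the reindexing runs from the right-hand side to the left-hand
    one.\<close>
  let ?h = "\<lambda>((p :: nat, v :: nat), (q :: nat, t :: nat)). ((p + q, t), (p, q))"
  have "?l = (\<Oplus>x\<in>?D k. \<Oplus>y\<in>?D (fst x). f (fst y) (snd y) (snd x))"
    by (intro finsum_cong') (auto simp: split_def intro!: finsum_closed assms)
  also have "\<dots> = (\<Oplus>z\<in>Sigma (?D k) (\<lambda>x. ?D (fst x)). case z of (x, y) \<Rightarrow> f (fst y) (snd y) (snd x))"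
    by (rule finsum_Sigma) (auto simp: assms)
  also have "Sigma (?D k) (\<lambda>x. ?D (fst x)) = ?h ` Sigma (?D k) (\<lambda>x. ?D (snd x))"
    by (force simp: image_iff)
  also have "(\<Oplus>z\<in>\<dots>. case z of (x, y) \<Rightarrow> f (fst y) (snd y) (snd x)) =
      (\<Oplus>z\<in>Sigma (?D k) (\<lambda>x. ?D (snd x)). case z of (x, y) \<Rightarrow> f (fst x) (fst y) (snd y))"
    by (subst finsum_reindex) (auto simp: assms inj_on_def split_def intro!: finsum_cong')
  also have "\<dots> = (\<Oplus>x\<in>?D k. \<Oplus>y\<in>?D (snd x). f (fst x) (fst y) (snd y))"
    by (rule finsum_Sigma[symmetric]) (auto simp: assms)
  also have "\<dots> = ?r"
    by (intro finsum_cong') (auto simp: split_def intro!: finsum_closed assms)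
  finally show ?thesis .
qed

context f2_algebra
begin

lemma add_self: "x \<in> carrier A \<Longrightarrow> x \<oplus> x = \<zero>"
  using l_distr[of \<one> \<one> x] char_two by simp

lemma f2_unit_hom: "f2_unit A \<in> ring_hom F2 A"
proof (rule ring_hom_memI)
  fix x y :: bit
  show "f2_unit A x \<in> carrier A" by (simp add: f2_unit_def)
  show "f2_unit A (x \<otimes>\<^bsub>F2\<^esub> y) = f2_unit A x \<otimes> f2_unit A y"
    by (cases x; cases y) (simp_all add: f2_unit_def F2_def)
  show "f2_unit A (x \<oplus>\<^bsub>F2\<^esub> y) = f2_unit A x \<oplus> f2_unit A y"
    by (cases x; cases y) (simp_all add: f2_unit_def F2_def char_two)
qed (simp add: f2_unit_def F2_def)

text \<open>Squaring is additive because the two cross terms cancel, and the power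
  \<open>2 ^ t\<close> is \<open>t\<close>-fold squaring.\<close>

lemma frobenius_add:
  assumes "x \<in> carrier A" "y \<in> carrier A"
  shows "(x \<oplus> y) [^] (2 ^ t :: nat) = x [^] (2 ^ t :: nat) \<oplus> y [^] (2 ^ t :: nat)"
proof (induction t)
  case (Suc t)
  let ?u = "x [^] (2 ^ t :: nat)" and ?v = "y [^] (2 ^ t :: nat)"
  have uv: "?u \<in> carrier A" "?v \<in> carrier A" using assms by auto
  have sq: "z [^] (2 * 2 ^ t :: nat) = z [^] (2 ^ t :: nat) \<otimes> z [^] (2 ^ t :: nat)"
    if "z \<in> carrier A" for z
    using that by (simp only: nat_pow_mult mult_2)
  have "(?u \<oplus> ?v) \<otimes> (?u \<oplus> ?v) = ?u \<otimes> ?u \<oplus> (?u \<otimes> ?v \<oplus> ?u \<otimes> ?v) \<oplus> ?v \<otimes> ?v"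
    using uv by algebra
  then show ?case using assms uv Suc by (simp add: sq add_self)
qed (use assms in simp)

lemma frobenius_zero: "\<zero> [^] (2 ^ t :: nat) = \<zero>"
  by (rule nat_pow_zero) simp

lemma frobenius_finsum:
  "finite I \<Longrightarrow> f \<in> I \<rightarrow> carrier A \<Longrightarrow>
    (\<Oplus>i\<in>I. f i) [^] (2 ^ t :: nat) = (\<Oplus>i\<in>I. f i [^] (2 ^ t :: nat))"
proof (induction I rule: finite_induct)
  case (insert x F)
  have "(\<Oplus>i\<in>insert x F. f i) = f x \<oplus> (\<Oplus>i\<in>F. f i)"
    using insert by (subst finsum_insert) auto
  moreover have "(\<Oplus>i\<in>insert x F. f i [^] (2 ^ t :: nat)) =
      f x [^] (2 ^ t :: nat) \<oplus> (\<Oplus>i\<in>F. f i [^] (2 ^ t :: nat))"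
    using insert by (subst finsum_insert) auto
  ultimately show ?case using insert by (simp add: frobenius_add Pi_iff)
qed (simp add: frobenius_zero)

lemma frob_conv_closed:
  assumes "\<And>i. b i \<in> carrier A" "\<And>i. a i \<in> carrier A"
  shows "frob_conv A b a k \<in> carrier A"
  using assms by (auto simp: frob_conv_def split_def intro!: finsum_closed)

text \<open>The common value is the sum of \<open>c p ^ 2 ^ (q + t) * b q ^ 2 ^ t * a t\<close> over
  \<open>p + q + t = k\<close>. On the left the Frobenius identity spreads the power
  \<open>2 ^ t\<close> over the inner sum; on the right distributivity suffices.\<close>

lemma frob_conv_assoc:
  assumes c: "\<And>i. c i \<in> carrier A" and b: "\<And>i. b i \<in> carrier A" and a: "\<And>i. a i \<in> carrier A"
  shows "frob_conv A (frob_conv A c b) a = frob_conv A c (frob_conv A b a)"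
proof
  fix k
  have C: "c i \<in> carrier A" "b i \<in> carrier A" "a i \<in> carrier A" for i using assms by auto
  let ?D = "\<lambda>k. {(s, t). s + t = (k :: nat)}"
  let ?f = "\<lambda>p q t. c p [^] (2 ^ (q + t) :: nat) \<otimes> (b q [^] (2 ^ t :: nat) \<otimes> a t)"
  have f: "?f p q t \<in> carrier A" for p q t using C by simp
  have "frob_conv A (frob_conv A c b) a k = (\<Oplus>z\<in>?D k. case z of (u, t) \<Rightarrow> \<Oplus>z\<in>?D u. case z of (p, q) \<Rightarrow> ?f p q t)"
    unfolding frob_conv_def[of A _ a k]
  proof (rule finsum_cong'[OF refl], safe)
    fix u t
    show "(\<Oplus>z\<in>?D u. case z of (p, q) \<Rightarrow> ?f p q t) \<in> carrier A" using f by (auto intro!: finsum_closed)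
    have "frob_conv A c b u [^] (2 ^ t :: nat) \<otimes> a t =
        (\<Oplus>x\<in>?D u. (c (fst x) [^] (2 ^ snd x :: nat) \<otimes> b (snd x)) [^] (2 ^ t :: nat)) \<otimes> a t"
      unfolding frob_conv_def split_def by (subst frobenius_finsum) (use C in auto)
    also have "\<dots> = (\<Oplus>x\<in>?D u. (c (fst x) [^] (2 ^ snd x :: nat) \<otimes> b (snd x)) [^] (2 ^ t :: nat) \<otimes> a t)"
      by (rule finsum_ldistr) (use C in auto)
    also have "\<dots> = (\<Oplus>x\<in>?D u. ?f (fst x) (snd x) t)"
      using C by (intro finsum_cong') (auto simp: pow_mult_distrib m_comm nat_pow_pow power_add m_assoc)
    finally show "frob_conv A c b u [^] (2 ^ t :: nat) \<otimes> a t = (\<Oplus>z\<in>?D u. case z of (p, q) \<Rightarrow> ?f p q t)"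
      by (simp add: split_def)
  qed
  also have "\<dots> = (\<Oplus>z\<in>?D k. case z of (p, v) \<Rightarrow> \<Oplus>z\<in>?D v. case z of (q, t) \<Rightarrow> ?f p q t)"
    by (rule finsum_antidiagonal_assoc) (rule f)
  also have "\<dots> = frob_conv A c (frob_conv A b a) k"
    unfolding frob_conv_def[of A c _ k]
  proof (rule finsum_cong'[OF refl], safe)
    fix p v
    show "c p [^] (2 ^ v :: nat) \<otimes> frob_conv A b a v \<in> carrier A"
      using C frob_conv_closed[OF b a] by simp
    have "c p [^] (2 ^ v :: nat) \<otimes> frob_conv A b a v =
        (\<Oplus>x\<in>?D v. c p [^] (2 ^ v :: nat) \<otimes> (b (fst x) [^] (2 ^ snd x :: nat) \<otimes> a (snd x)))"
      unfolding frob_conv_def split_def by (rule finsum_rdistr) (use C in auto)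
    also have "\<dots> = (\<Oplus>x\<in>?D v. ?f p (fst x) (snd x))"
      using C by (intro finsum_cong') auto
    finally show "(\<Oplus>z\<in>?D v. case z of (q, t) \<Rightarrow> ?f p q t) = c p [^] (2 ^ v :: nat) \<otimes> frob_conv A b a v"
      by (simp add: split_def)
  qed
  finally show "frob_conv A (frob_conv A c b) a k = frob_conv A c (frob_conv A b a) k" .
qed

text \<open>All other terms vanish, a zero in the left factor surviving the power because
  \<open>2 ^ t\<close> is positive. This evaluates the unit laws and the coefficient with index
  zero.\<close>

lemma frob_conv_single:
  assumes "\<And>i. b i \<in> carrier A" "\<And>i. a i \<in> carrier A" "s0 + t0 = k"
    and "\<And>s t. s + t = k \<Longrightarrow> (s, t) \<noteq> (s0, t0) \<Longrightarrow> b s = \<zero> \<or> a t = \<zero>"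
  shows "frob_conv A b a k = b s0 [^] (2 ^ t0 :: nat) \<otimes> a t0"
proof -
  have C: "b i \<in> carrier A" "a i \<in> carrier A" for i using assms(1,2) by auto
  have "frob_conv A b a k = (\<Oplus>z\<in>{(s0, t0)}. case z of (s, t) \<Rightarrow> b s [^] (2 ^ t :: nat) \<otimes> a t)"
    unfolding frob_conv_def
    by (rule add.finprod_mono_neutral_cong_right) (use assms(3,4) C frobenius_zero in fastforce)+
  then show ?thesis using C by simp
qed

lemma frob_conv_zero:
  assumes "\<And>i. b i \<in> carrier A" "\<And>i. a i \<in> carrier A"
    and "\<And>s t. s + t = k \<Longrightarrow> b s = \<zero> \<or> a t = \<zero>"
  shows "frob_conv A b a k = \<zero>"
proof -
  have C: "b i \<in> carrier A" "a i \<in> carrier A" for i using assms(1,2) by auto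
  \<comment> \<open>The pair \<open>(0, k)\<close> can serve as the distinguished pair, its own term
    being zero as well.\<close>
  have "b 0 [^] (2 ^ k :: nat) \<otimes> a k = \<zero>" using assms(3)[of 0 k] C frobenius_zero by auto
  then show ?thesis using frob_conv_single[OF assms(1,2), of 0 k k] assms(3) by simp
qed

lemma unit_seq_closed: "unit_seq A k \<in> carrier A"
  by (auto simp: unit_seq_def)

lemma frob_conv_unit_left:
  assumes "\<And>i. a i \<in> carrier A"
  shows "frob_conv A (unit_seq A) a = a"
proof
  fix k
  have "frob_conv A (unit_seq A) a k = unit_seq A 0 [^] (2 ^ k :: nat) \<otimes> a k"
    by (rule frob_conv_single) (use assms unit_seq_closed in \<open>auto simp: unit_seq_def\<close>)
  then show "frob_conv A (unit_seq A) a k = a k" using assms by (auto simp: unit_seq_def)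
qed

lemma frob_conv_unit_right:
  assumes "\<And>i. a i \<in> carrier A"
  shows "frob_conv A a (unit_seq A) = a"
proof
  fix k
  have "frob_conv A a (unit_seq A) k = a k [^] (2 ^ 0 :: nat) \<otimes> unit_seq A 0"
    by (rule frob_conv_single) (use assms unit_seq_closed in \<open>auto simp: unit_seq_def\<close>)
  moreover have "a k \<in> carrier A" using assms by auto
  ultimately show "frob_conv A a (unit_seq A) k = a k" by (simp add: unit_seq_def)
qed

end

lemma hom_frob_conv:
  assumes "f2_algebra R" "f2_algebra S" "h \<in> ring_hom R S"
    and ba: "\<And>i. b i \<in> carrier R" "\<And>i. a i \<in> carrier R"
  shows "h (frob_conv R b a k) = frob_conv S (h \<circ> b) (h \<circ> a) k"
proof -
  interpret R: f2_algebra R by fact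
  interpret S: f2_algebra S by fact
  interpret h: ring_hom_cring R S h by (unfold_locales) fact
  have C: "b i \<in> carrier R" "a i \<in> carrier R" for i using ba by auto
  show ?thesis unfolding frob_conv_def split_def
    by (subst h.hom_finsum) (use C in \<open>auto intro!: S.finsum_cong'\<close>)
qed


subsection \<open>Sums over supports\<close>

lemma poly_mapping_bit_add_self: "p + p = 0" for p :: "'k \<Rightarrow>\<^sub>0 bit"
proof (rule poly_mapping_eqI)
  fix s
  show "Poly_Mapping.lookup (p + p) s = Poly_Mapping.lookup 0 s"
    by (cases "Poly_Mapping.lookup p s") (simp_all add: lookup_add)
qed

lemma lookup_bit_keys: "s \<in> Poly_Mapping.keys p \<Longrightarrow> Poly_Mapping.lookup p s = (1 :: bit)"
  by (simp add: in_keys_iff)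

lemma keys_add_bit:
  "Poly_Mapping.keys (p + q) = (Poly_Mapping.keys p - Poly_Mapping.keys q) \<union> (Poly_Mapping.keys q - Poly_Mapping.keys p)"
  for p q :: "'k \<Rightarrow>\<^sub>0 bit"
proof (rule Set.set_eqI)
  fix s
  show "s \<in> Poly_Mapping.keys (p + q) \<longleftrightarrow>
      s \<in> (Poly_Mapping.keys p - Poly_Mapping.keys q) \<union> (Poly_Mapping.keys q - Poly_Mapping.keys p)"
    by (cases "Poly_Mapping.lookup p s"; cases "Poly_Mapping.lookup q s") (simp_all add: in_keys_iff lookup_add)
qed

lemma sum_single_keys: "(\<Sum>s\<in>Poly_Mapping.keys p. Poly_Mapping.single s 1) = p" for p :: "'k \<Rightarrow>\<^sub>0 bit"
proof (rule poly_mapping_eqI)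
  fix s
  have "(\<Sum>t\<in>Poly_Mapping.keys p. if s = t then 1 else 0 :: bit) = Poly_Mapping.lookup p s"
    by (subst sum.delta') (auto simp: in_keys_iff)
  then show "Poly_Mapping.lookup (\<Sum>s\<in>Poly_Mapping.keys p. Poly_Mapping.single s 1) s = Poly_Mapping.lookup p s"
    by (simp add: lookup_sum lookup_single when_def eq_commute)
qed

text \<open>Keys common to \<open>p\<close> and \<open>q\<close> cancel in \<open>p + q\<close>,
  while on the right they are counted twice, which gives zero by assumption. This version takes
  values in a type with addition; \<open>finsum_keys_add\<close> is its counterpart for values in a
  ring with a carrier.\<close>

lemma sum_keys_add:
  fixes p q :: "'k \<Rightarrow>\<^sub>0 bit" and w :: "'k \<Rightarrow> 'v :: comm_monoid_add"
  assumes "\<And>s. w s + w s = 0"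
  shows "sum w (Poly_Mapping.keys (p + q)) = sum w (Poly_Mapping.keys p) + sum w (Poly_Mapping.keys q)"
proof -
  let ?P = "Poly_Mapping.keys p" and ?Q = "Poly_Mapping.keys q"
  have "sum w ?P = sum w (?P - ?Q) + sum w (?P \<inter> ?Q)"
    by (subst sum.union_disjoint[symmetric]) (auto intro!: sum.cong)
  moreover have "sum w ?Q = sum w (?P \<inter> ?Q) + sum w (?Q - ?P)"
    by (subst sum.union_disjoint[symmetric]) (auto intro!: sum.cong)
  moreover have "sum w (?P \<inter> ?Q) + sum w (?P \<inter> ?Q) = 0"
    using assms by (simp flip: sum.distrib)
  then have "sum w (?P \<inter> ?Q) + (sum w (?P \<inter> ?Q) + sum w (?Q - ?P)) = sum w (?Q - ?P)"
    by (simp flip: add.assoc)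
  moreover have "sum w (Poly_Mapping.keys (p + q)) = sum w (?P - ?Q) + sum w (?Q - ?P)"
    unfolding keys_add_bit by (rule sum.union_disjoint) auto
  ultimately show ?thesis by (simp add: add.assoc)
qed

lemma sum_keys_sum:
  fixes f :: "'i \<Rightarrow> 'k \<Rightarrow>\<^sub>0 bit" and w :: "'k \<Rightarrow> 'v :: comm_monoid_add"
  assumes "\<And>s. w s + w s = 0"
  shows "sum w (Poly_Mapping.keys (\<Sum>i\<in>I. f i)) = (\<Sum>i\<in>I. sum w (Poly_Mapping.keys (f i)))"
  by (induction I rule: infinite_finite_induct) (simp_all add: sum_keys_add[OF assms])

context f2_algebra
begin

lemma finsum_keys_add:
  assumes "\<And>s. s \<in> Poly_Mapping.keys p \<union> Poly_Mapping.keys q \<Longrightarrow> w s \<in> carrier A"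
  shows "finsum A w (Poly_Mapping.keys (p + q)) =
    finsum A w (Poly_Mapping.keys p) \<oplus> finsum A w (Poly_Mapping.keys (q :: 'k \<Rightarrow>\<^sub>0 bit))"
proof -
  let ?P = "Poly_Mapping.keys p" and ?Q = "Poly_Mapping.keys q"
  have cl: "finsum A w (?P - ?Q) \<in> carrier A" "finsum A w (?Q - ?P) \<in> carrier A"
    "finsum A w (?P \<inter> ?Q) \<in> carrier A"
    using assms by (auto intro!: finsum_closed)
  have "finsum A w ((?P - ?Q) \<union> (?P \<inter> ?Q)) = finsum A w (?P - ?Q) \<oplus> finsum A w (?P \<inter> ?Q)"
    by (rule finsum_Un_disjoint) (use assms in auto)
  moreover have "finsum A w ((?P \<inter> ?Q) \<union> (?Q - ?P)) = finsum A w (?P \<inter> ?Q) \<oplus> finsum A w (?Q - ?P)"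
    by (rule finsum_Un_disjoint) (use assms in auto)
  moreover have "(?P - ?Q) \<union> (?P \<inter> ?Q) = ?P" "(?P \<inter> ?Q) \<union> (?Q - ?P) = ?Q" by auto
  moreover have "finsum A w (Poly_Mapping.keys (p + q)) = finsum A w (?P - ?Q) \<oplus> finsum A w (?Q - ?P)"
    unfolding keys_add_bit by (rule finsum_Un_disjoint) (use assms in auto)
  moreover have "finsum A w (?P \<inter> ?Q) \<oplus> (finsum A w (?P \<inter> ?Q) \<oplus> finsum A w (?Q - ?P)) = finsum A w (?Q - ?P)"
    using cl by (simp add: add_self flip: a_assoc)
  ultimately show ?thesis using cl by (simp add: a_assoc)
qed

lemma finsum_keys_sum:
  assumes "finite I" "\<And>i s. i \<in> I \<Longrightarrow> s \<in> Poly_Mapping.keys (f i) \<Longrightarrow> w s \<in> carrier A"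
  shows "finsum A w (Poly_Mapping.keys (\<Sum>i\<in>I. f i)) =
    (\<Oplus>i\<in>I. finsum A w (Poly_Mapping.keys (f i :: 'k \<Rightarrow>\<^sub>0 bit)))"
  using assms
proof (induction I rule: finite_induct)
  case (insert x F)
  have "finsum A w (Poly_Mapping.keys (f x + sum f F)) =
      finsum A w (Poly_Mapping.keys (f x)) \<oplus> finsum A w (Poly_Mapping.keys (sum f F))"
    by (rule finsum_keys_add) (use insert.prems keys_sum[of f F] in blast)
  moreover have "(\<Oplus>i\<in>insert x F. finsum A w (Poly_Mapping.keys (f i))) =
      finsum A w (Poly_Mapping.keys (f x)) \<oplus> (\<Oplus>i\<in>F. finsum A w (Poly_Mapping.keys (f i)))"
    by (rule finsum_insert) (use insert in \<open>auto intro!: finsum_closed\<close>)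
  moreover have "finsum A w (Poly_Mapping.keys (sum f F)) = (\<Oplus>i\<in>F. finsum A w (Poly_Mapping.keys (f i)))"
    by (rule insert.IH) (use insert.prems in auto)
  ultimately show ?case using insert.hyps by simp
qed simp

text \<open>Multiplicativity of evaluation on a monoid algebra over the field with two elements,
  \<open>m\<close> being the product of basis elements. Distinct pairs may have the same product;
  such collisions cancel in the support exactly as they do in the sum. It is used for pairs in
  \<open>pair_algebra\<close> and for exponents in \<open>f2_mpoly\<close>.\<close>

lemma finsum_keys_product:
  fixes p :: "'k \<Rightarrow>\<^sub>0 bit" and q :: "'l \<Rightarrow>\<^sub>0 bit"
  assumes u: "\<And>s. s \<in> Poly_Mapping.keys p \<Longrightarrow> u s \<in> carrier A"
    and v: "\<And>t. t \<in> Poly_Mapping.keys q \<Longrightarrow> v t \<in> carrier A"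
    and w: "\<And>s t. s \<in> Poly_Mapping.keys p \<Longrightarrow> t \<in> Poly_Mapping.keys q \<Longrightarrow> w (m s t) = u s \<otimes> v t"
  shows "finsum A w (Poly_Mapping.keys
      (\<Sum>s\<in>Poly_Mapping.keys p. \<Sum>t\<in>Poly_Mapping.keys q. Poly_Mapping.single (m s t) 1 :: 'j \<Rightarrow>\<^sub>0 bit)) =
    finsum A u (Poly_Mapping.keys p) \<otimes> finsum A v (Poly_Mapping.keys q)"
proof -
  let ?P = "Poly_Mapping.keys p" and ?Q = "Poly_Mapping.keys q"
  let ?q = "\<lambda>s t. Poly_Mapping.single (m s t) 1 :: 'j \<Rightarrow>\<^sub>0 bit"
  have w_keys: "w x \<in> carrier A" if "s \<in> ?P" "x \<in> Poly_Mapping.keys (\<Sum>t\<in>?Q. ?q s t)" for s x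
    using subsetD[OF keys_sum that(2)] that(1) by (auto simp: u v w)
  have "finsum A w (Poly_Mapping.keys (\<Sum>s\<in>?P. \<Sum>t\<in>?Q. ?q s t)) =
      (\<Oplus>s\<in>?P. finsum A w (Poly_Mapping.keys (\<Sum>t\<in>?Q. ?q s t)))"
    by (rule finsum_keys_sum) (simp_all only: finite_keys w_keys)
  also have "\<dots> = (\<Oplus>s\<in>?P. u s \<otimes> finsum A v ?Q)"
  proof (rule finsum_cong'[OF refl])
    fix s assume s: "s \<in> ?P"
    have "finsum A w (Poly_Mapping.keys (\<Sum>t\<in>?Q. ?q s t)) = (\<Oplus>t\<in>?Q. finsum A w (Poly_Mapping.keys (?q s t)))"
      by (rule finsum_keys_sum) (auto simp: s u v w)
    also have "\<dots> = (\<Oplus>t\<in>?Q. u s \<otimes> v t)"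
      by (rule finsum_cong') (auto simp: s u v w)
    also have "\<dots> = u s \<otimes> finsum A v ?Q"
      by (rule finsum_rdistr[symmetric]) (auto simp: s u v)
    finally show "finsum A w (Poly_Mapping.keys (\<Sum>t\<in>?Q. ?q s t)) = u s \<otimes> finsum A v ?Q" .
  qed (auto simp: u v intro!: finsum_closed)
  also have "\<dots> = finsum A u ?P \<otimes> finsum A v ?Q"
    by (rule finsum_ldistr[symmetric]) (auto simp: u v intro!: finsum_closed)
  finally show ?thesis .
qed

end


subsection \<open>Tensor products\<close>

lemma pair_algebra_simps:
  "carrier (pair_algebra A B) = {p. Poly_Mapping.keys p \<subseteq> carrier A \<times> carrier B}"
  "\<one>\<^bsub>pair_algebra A B\<^esub> = Poly_Mapping.single (\<one>\<^bsub>A\<^esub>, \<one>\<^bsub>B\<^esub>) 1"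
  "\<zero>\<^bsub>pair_algebra A B\<^esub> = 0"
  "p \<oplus>\<^bsub>pair_algebra A B\<^esub> q = p + q"
  by (simp_all add: pair_algebra_def)

text \<open>Coefficients on the support equal one; without them the product has the shape required
  by \<open>finsum_keys_product\<close>.\<close>

lemma pair_algebra_mult:
  "p \<otimes>\<^bsub>pair_algebra A B\<^esub> q = (\<Sum>s\<in>Poly_Mapping.keys p. \<Sum>t\<in>Poly_Mapping.keys q.
     Poly_Mapping.single (fst s \<otimes>\<^bsub>A\<^esub> fst t, snd s \<otimes>\<^bsub>B\<^esub> snd t) 1)"
  by (auto simp: pair_algebra_def lookup_bit_keys intro!: sum.cong)

lemma pair_algebra_single_mult:
  "Poly_Mapping.single (a, b) 1 \<otimes>\<^bsub>pair_algebra A B\<^esub> Poly_Mapping.single (a', b') 1 =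
    Poly_Mapping.single (a \<otimes>\<^bsub>A\<^esub> a', b \<otimes>\<^bsub>B\<^esub> b') 1"
  by (simp add: pair_algebra_mult)

lemma keys_sum_subset:
  assumes "\<And>i. i \<in> I \<Longrightarrow> Poly_Mapping.keys (f i) \<subseteq> K"
  shows "Poly_Mapping.keys (\<Sum>i\<in>I. f i) \<subseteq> K"
  using keys_sum[of f I] assms by blast

locale f2_algebra_pair = A: f2_algebra A + B: f2_algebra B
  for A :: "('a, 'm) ring_scheme" and B :: "('b, 'n) ring_scheme"
begin

text \<open>Products are sums over pairs of keys, so associativity and commutativity reduce to the
  laws of \<open>A\<close> and \<open>B\<close> on the components of keys. Distributivity is
  \<open>sum_keys_add\<close>.\<close>

lemma pair_algebra_f2_algebra: "f2_algebra (pair_algebra A B)"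
proof -
  let ?P = "pair_algebra A B"
  let ?m = "\<lambda>s t. (fst s \<otimes>\<^bsub>A\<^esub> fst t, snd s \<otimes>\<^bsub>B\<^esub> snd t)"
  have in_carrier: "fst s \<in> carrier A" "snd s \<in> carrier B"
    if "p \<in> carrier ?P" "s \<in> Poly_Mapping.keys p" for p s
    using that by (auto simp: pair_algebra_simps)
  have mult_closed: "p \<otimes>\<^bsub>?P\<^esub> q \<in> carrier ?P" if "p \<in> carrier ?P" "q \<in> carrier ?P" for p q
    unfolding pair_algebra_mult pair_algebra_simps
    using in_carrier[OF that(1)] in_carrier[OF that(2)] by (intro CollectI keys_sum_subset) auto
  have add: "abelian_group ?P"
  proof (rule abelian_groupI)
    fix p assume "p \<in> carrier ?P"
    then show "\<exists>q\<in>carrier ?P. q \<oplus>\<^bsub>?P\<^esub> p = \<zero>\<^bsub>?P\<^esub>"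
      by (auto simp: pair_algebra_simps poly_mapping_bit_add_self intro!: bexI[of _ p])
  next
    fix p q assume "p \<in> carrier ?P" "q \<in> carrier ?P"
    then show "p \<oplus>\<^bsub>?P\<^esub> q \<in> carrier ?P"
      using keys_add[of p q] by (auto simp: pair_algebra_simps)
  qed (auto simp: pair_algebra_simps algebra_simps)
  have mult: "comm_monoid ?P"
  proof (rule comm_monoidI)
    fix p q r assume pqr: "p \<in> carrier ?P" "q \<in> carrier ?P" "r \<in> carrier ?P"
    \<comment> \<open>The outer product runs over the keys of an inner product, some of which may
      have cancelled; \<open>sum_keys_sum\<close> permits running over all pairs instead.\<close>
    have "(p \<otimes>\<^bsub>?P\<^esub> q) \<otimes>\<^bsub>?P\<^esub> r = (\<Sum>s\<in>Poly_Mapping.keys p. \<Sum>t\<in>Poly_Mapping.keys q.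
        \<Sum>u\<in>Poly_Mapping.keys r. Poly_Mapping.single (?m (?m s t) u) 1)"
      unfolding pair_algebra_mult[of _ _ _ r] unfolding pair_algebra_mult
      by (simp add: sum_keys_sum poly_mapping_bit_add_self)
    also have "\<dots> = (\<Sum>s\<in>Poly_Mapping.keys p. \<Sum>t\<in>Poly_Mapping.keys q.
        \<Sum>u\<in>Poly_Mapping.keys r. Poly_Mapping.single (?m s (?m t u)) 1)"
      using pqr by (intro sum.cong refl) (simp add: in_carrier A.m_assoc B.m_assoc)
    also have "\<dots> = p \<otimes>\<^bsub>?P\<^esub> (q \<otimes>\<^bsub>?P\<^esub> r)"
      unfolding pair_algebra_mult[of _ _ p] unfolding pair_algebra_mult
      by (simp add: sum_keys_sum poly_mapping_bit_add_self)
    finally show "(p \<otimes>\<^bsub>?P\<^esub> q) \<otimes>\<^bsub>?P\<^esub> r = p \<otimes>\<^bsub>?P\<^esub> (q \<otimes>\<^bsub>?P\<^esub> r)" .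
  next
    fix p q assume pq: "p \<in> carrier ?P" "q \<in> carrier ?P"
    show "p \<otimes>\<^bsub>?P\<^esub> q \<in> carrier ?P" using pq by (rule mult_closed)
    show "p \<otimes>\<^bsub>?P\<^esub> q = q \<otimes>\<^bsub>?P\<^esub> p"
      unfolding pair_algebra_mult
      by (subst sum.swap) (simp add: in_carrier[OF pq(1)] in_carrier[OF pq(2)] A.m_comm B.m_comm cong: sum.cong)
  next
    fix p assume p: "p \<in> carrier ?P"
    have "\<one>\<^bsub>?P\<^esub> \<otimes>\<^bsub>?P\<^esub> p = (\<Sum>s\<in>Poly_Mapping.keys p. Poly_Mapping.single s 1)"
      unfolding pair_algebra_mult pair_algebra_simps using p by (simp add: in_carrier)
    then show "\<one>\<^bsub>?P\<^esub> \<otimes>\<^bsub>?P\<^esub> p = p" by (simp add: sum_single_keys)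
  qed (auto simp: pair_algebra_simps)
  have "cring ?P"
  proof (rule cringI[OF add mult])
    fix p q r
    show "(p \<oplus>\<^bsub>?P\<^esub> q) \<otimes>\<^bsub>?P\<^esub> r = p \<otimes>\<^bsub>?P\<^esub> r \<oplus>\<^bsub>?P\<^esub> q \<otimes>\<^bsub>?P\<^esub> r"
      unfolding pair_algebra_mult pair_algebra_simps
      by (rule sum_keys_add) (rule poly_mapping_bit_add_self)
  qed
  then show ?thesis
    by (simp add: f2_algebra_def f2_algebra_axioms_def pair_algebra_simps poly_mapping_bit_add_self)
qed

sublocale pair: f2_algebra "pair_algebra A B" by (rule pair_algebra_f2_algebra)

lemma tensor_relations_carrier: "tensor_relations A B \<subseteq> carrier (pair_algebra A B)"
proof
  have "Poly_Mapping.keys (Poly_Mapping.single x 1 - (Poly_Mapping.single y 1 + Poly_Mapping.single z (1 :: bit)))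
      \<subseteq> {x, y, z}" for x y z :: "'a \<times> 'b"
    by (auto simp: in_keys_iff lookup_minus lookup_add lookup_single when_def split: if_splits)
  then have "Poly_Mapping.keys (Poly_Mapping.single x 1 - (Poly_Mapping.single y 1 + Poly_Mapping.single z (1 :: bit)))
      \<subseteq> K" if "x \<in> K" "y \<in> K" "z \<in> K" for x y z :: "'a \<times> 'b" and K
    using that by blast
  note * = this[unfolded subset_iff, rule_format]
  fix r assume "r \<in> tensor_relations A B"
  then show "r \<in> carrier (pair_algebra A B)"
    by (auto simp: tensor_relations_def pair_algebra_simps
        dest: *[of _ "carrier A \<times> carrier B", rotated -1])
qed

lemma tensor_ideal: "ideal (tensor_ideal A B) (pair_algebra A B)"
  unfolding tensor_ideal_def by (rule pair.genideal_ideal[OF tensor_relations_carrier])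

sublocale ideal "tensor_ideal A B" "pair_algebra A B" by (rule tensor_ideal)

abbreviation tensor_class where
  "tensor_class p \<equiv> tensor_ideal A B +>\<^bsub>pair_algebra A B\<^esub> p"

lemma tensor_class_hom: "tensor_class \<in> ring_hom (pair_algebra A B) (tensor A B)"
  unfolding tensor_def by (rule rcos_ring_hom)

lemma carrier_tensor: "carrier (tensor A B) = tensor_class ` carrier (pair_algebra A B)"
  by (auto simp: tensor_def FactRing_def A_RCOSETS_def' a_r_coset_def')

lemma tensor_f2_algebra: "f2_algebra (tensor A B)"
proof -
  interpret T: cring "tensor A B"
    unfolding tensor_def by (rule quotient_is_cring[OF pair.cring_axioms])
  interpret h: ring_hom_cring "pair_algebra A B" "tensor A B" tensor_class
    by unfold_locales (rule tensor_class_hom)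
  have "\<one>\<^bsub>tensor A B\<^esub> \<oplus>\<^bsub>tensor A B\<^esub> \<one>\<^bsub>tensor A B\<^esub> = \<zero>\<^bsub>tensor A B\<^esub>"
    using h.hom_add[OF pair.one_closed pair.one_closed] pair.char_two by simp
  then show ?thesis by unfold_locales
qed

sublocale tensor: f2_algebra "tensor A B" by (rule tensor_f2_algebra)

lemma pure_tensor_closed:
  "a \<in> carrier A \<Longrightarrow> b \<in> carrier B \<Longrightarrow> pure_tensor A B a b \<in> carrier (tensor A B)"
  by (auto simp: pure_tensor_def carrier_tensor pair_algebra_simps)

lemma pure_tensor_mult:
  assumes "a \<in> carrier A" "b \<in> carrier B" "a' \<in> carrier A" "b' \<in> carrier B"
  shows "pure_tensor A B a b \<otimes>\<^bsub>tensor A B\<^esub> pure_tensor A B a' b' = pure_tensor A B (a \<otimes>\<^bsub>A\<^esub> a') (b \<otimes>\<^bsub>B\<^esub> b')"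
  unfolding pure_tensor_def
  by (subst ring_hom_mult[OF tensor_class_hom, symmetric])
    (use assms in \<open>auto simp: pair_algebra_simps pair_algebra_single_mult\<close>)

lemma pure_tensor_one: "pure_tensor A B \<one>\<^bsub>A\<^esub> \<one>\<^bsub>B\<^esub> = \<one>\<^bsub>tensor A B\<^esub>"
  using ring_hom_one[OF tensor_class_hom] by (simp add: pure_tensor_def pair_algebra_simps)

lemma tensor_class_eqI:
  assumes "p \<in> carrier (pair_algebra A B)" "q \<in> carrier (pair_algebra A B)" "p - q \<in> tensor_relations A B"
  shows "tensor_class p = tensor_class q"
proof -
  have "p - q \<in> tensor_ideal A B"
    using assms(3) pair.genideal_self[OF tensor_relations_carrier] by (auto simp: tensor_ideal_def)
  moreover have "p = (p - q) \<oplus>\<^bsub>pair_algebra A B\<^esub> q" by (simp add: pair_algebra_simps)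
  ultimately have "p \<in> tensor_class q" by (auto simp: a_r_coset_def' )
  then show ?thesis using a_repr_independence' assms(2) by metis
qed

lemma pure_tensor_add_left:
  assumes "a \<in> carrier A" "a' \<in> carrier A" "b \<in> carrier B"
  shows "pure_tensor A B (a \<oplus>\<^bsub>A\<^esub> a') b = pure_tensor A B a b \<oplus>\<^bsub>tensor A B\<^esub> pure_tensor A B a' b"
  unfolding pure_tensor_def
  by (subst ring_hom_add[OF tensor_class_hom, symmetric], use assms in \<open>simp_all add: pair_algebra_simps\<close>)
    (rule tensor_class_eqI, use assms keys_add[of "Poly_Mapping.single (a, b) (1 :: bit)" "Poly_Mapping.single (a', b) 1"]
      in \<open>auto simp: pair_algebra_simps tensor_relations_def\<close>)

lemma pure_tensor_add_right:
  assumes "a \<in> carrier A" "b \<in> carrier B" "b' \<in> carrier B"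
  shows "pure_tensor A B a (b \<oplus>\<^bsub>B\<^esub> b') = pure_tensor A B a b \<oplus>\<^bsub>tensor A B\<^esub> pure_tensor A B a b'"
  unfolding pure_tensor_def
  by (subst ring_hom_add[OF tensor_class_hom, symmetric], use assms in \<open>simp_all add: pair_algebra_simps\<close>)
    (rule tensor_class_eqI, use assms keys_add[of "Poly_Mapping.single (a, b) (1 :: bit)" "Poly_Mapping.single (a, b') 1"]
      in \<open>auto simp: pair_algebra_simps tensor_relations_def\<close>)

lemma pure_tensor_left_hom: "(\<lambda>a. pure_tensor A B a \<one>\<^bsub>B\<^esub>) \<in> ring_hom A (tensor A B)"
  by (rule ring_hom_memI)
    (auto simp: pure_tensor_closed pure_tensor_mult pure_tensor_add_left pure_tensor_one)

lemma pure_tensor_right_hom: "pure_tensor A B \<one>\<^bsub>A\<^esub> \<in> ring_hom B (tensor A B)"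
  by (rule ring_hom_memI)
    (auto simp: pure_tensor_closed pure_tensor_mult pure_tensor_add_right pure_tensor_one)

end

locale f2_algebra_lift = f2_algebra_pair A B + C: f2_algebra C +
  f: ring_hom_cring A C f + g: ring_hom_cring B C g
  for A :: "('a, 'm) ring_scheme" and B :: "('b, 'n) ring_scheme" and C :: "('c, 'k) ring_scheme" and f g
begin

text \<open>The sum inside \<open>tensor_lift\<close>, on representatives rather than on
  classes.\<close>

definition val :: "('a \<times> 'b \<Rightarrow>\<^sub>0 bit) \<Rightarrow> 'c" where
  "val p = (\<Oplus>\<^bsub>C\<^esub>s\<in>Poly_Mapping.keys p. f (fst s) \<otimes>\<^bsub>C\<^esub> g (snd s))"

lemma val_single: "a \<in> carrier A \<Longrightarrow> b \<in> carrier B \<Longrightarrow>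
    val (Poly_Mapping.single (a, b) 1) = f a \<otimes>\<^bsub>C\<^esub> g b"
  by (simp add: val_def)

lemma val_add:
  "p \<in> carrier (pair_algebra A B) \<Longrightarrow> q \<in> carrier (pair_algebra A B) \<Longrightarrow> val (p + q) = val p \<oplus>\<^bsub>C\<^esub> val q"
  unfolding val_def by (rule C.finsum_keys_add) (auto simp: pair_algebra_simps)

lemma val_hom: "val \<in> ring_hom (pair_algebra A B) C"
proof (rule ring_hom_memI)
  fix p q assume pq: "p \<in> carrier (pair_algebra A B)" "q \<in> carrier (pair_algebra A B)"
  have cl: "f (fst s) \<in> carrier C" "g (snd s) \<in> carrier C" "fst s \<in> carrier A" "snd s \<in> carrier B"
    if "r \<in> carrier (pair_algebra A B)" "s \<in> Poly_Mapping.keys r" for s r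
    using that by (auto simp: pair_algebra_simps)
  show "val p \<in> carrier C" using cl[OF pq(1)] by (auto simp: val_def intro!: C.finsum_closed)
  show "val (p \<oplus>\<^bsub>pair_algebra A B\<^esub> q) = val p \<oplus>\<^bsub>C\<^esub> val q"
    using pq by (simp add: val_add pair_algebra_simps)
  show "val (p \<otimes>\<^bsub>pair_algebra A B\<^esub> q) = val p \<otimes>\<^bsub>C\<^esub> val q"
    unfolding pair_algebra_mult val_def
    by (rule C.finsum_keys_product) (auto simp: cl[OF pq(1)] cl[OF pq(2)] C.m_ac)
qed (simp add: pair_algebra_simps val_single)

sublocale val: ring_hom_cring "pair_algebra A B" C val by unfold_locales (rule val_hom)

text \<open>The kernel of \<open>val\<close> is an ideal, so it suffices that it contains the
  generating relations. By distributivity a relation has a value of the form \<open>x + x\<close>,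
  which is zero.\<close>

lemma val_tensor_ideal: "r \<in> tensor_ideal A B \<Longrightarrow> val r = \<zero>\<^bsub>C\<^esub>"
proof -
  \<comment> \<open>With coefficients modulo two a difference is a sum, so \<open>val_add\<close>
    applies to the relations.\<close>
  have minus: "p - q = p + q" for p q :: "'a \<times> 'b \<Rightarrow>\<^sub>0 bit"
    by (simp only: diff_eq_eq add.assoc poly_mapping_bit_add_self add_0_right)
  have *: "val (Poly_Mapping.single (a, b) 1 - (Poly_Mapping.single (a', b') 1 + Poly_Mapping.single (a'', b'') 1))
      = f a \<otimes>\<^bsub>C\<^esub> g b \<oplus>\<^bsub>C\<^esub> (f a' \<otimes>\<^bsub>C\<^esub> g b' \<oplus>\<^bsub>C\<^esub> f a'' \<otimes>\<^bsub>C\<^esub> g b'')"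
    if "a \<in> carrier A" "a' \<in> carrier A" "a'' \<in> carrier A" "b \<in> carrier B" "b' \<in> carrier B" "b'' \<in> carrier B"
    for a a' a'' b b' b''
  proof -
    have cl: "Poly_Mapping.single (x, y) 1 \<in> carrier (pair_algebra A B)"
      if "x \<in> carrier A" "y \<in> carrier B" for x y
      using that by (simp add: pair_algebra_simps)
    have sum: "Poly_Mapping.single (a', b') 1 + Poly_Mapping.single (a'', b'') 1 \<in> carrier (pair_algebra A B)"
      using pair.a_closed[OF cl[OF that(2,5)] cl[OF that(3,6)]] by (simp only: pair_algebra_simps)
    show ?thesis
      unfolding minus val_add[OF cl[OF that(1,4)] sum] val_add[OF cl[OF that(2,5)] cl[OF that(3,6)]]
        val_single[OF that(1,4)] val_single[OF that(2,5)] val_single[OF that(3,6)] ..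
  qed
  have "tensor_relations A B \<subseteq> a_kernel (pair_algebra A B) C val"
  proof
    fix r assume r: "r \<in> tensor_relations A B"
    then have "val r = \<zero>\<^bsub>C\<^esub>"
      unfolding tensor_relations_def
    proof (elim UnE CollectE exE conjE)
      fix a a' b
      assume cl: "a \<in> carrier A" "a' \<in> carrier A" "b \<in> carrier B"
        and "r = Poly_Mapping.single (a \<oplus>\<^bsub>A\<^esub> a', b) 1 - (Poly_Mapping.single (a, b) 1 + Poly_Mapping.single (a', b) 1)"
      then show "val r = \<zero>\<^bsub>C\<^esub>" using * by (simp add: C.l_distr C.add_self)
    next
      fix a b b'
      assume cl: "a \<in> carrier A" "b \<in> carrier B" "b' \<in> carrier B"
        and "r = Poly_Mapping.single (a, b \<oplus>\<^bsub>B\<^esub> b') 1 - (Poly_Mapping.single (a, b) 1 + Poly_Mapping.single (a, b') 1)"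
      then show "val r = \<zero>\<^bsub>C\<^esub>" using * by (simp add: C.r_distr C.add_self)
    qed
    then show "r \<in> a_kernel (pair_algebra A B) C val"
      using r tensor_relations_carrier unfolding a_kernel_def' by blast
  qed
  then have "tensor_ideal A B \<subseteq> a_kernel (pair_algebra A B) C val"
    unfolding tensor_ideal_def by (rule pair.genideal_minimal[OF ring_hom_ring.kernel_is_ideal[OF ring_hom_ringI2[OF pair.ring_axioms C.ring_axioms val_hom]]])
  then show "r \<in> tensor_ideal A B \<Longrightarrow> val r = \<zero>\<^bsub>C\<^esub>" unfolding a_kernel_def' by blast
qed

text \<open>Representatives of a class differ by an element of the ideal, on which
  \<open>val\<close> is zero; the set to which \<open>the_elem\<close> is applied is therefore a
  singleton.\<close>

lemma tensor_lift_class: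
  assumes "p \<in> carrier (pair_algebra A B)"
  shows "tensor_lift A B C f g (tensor_class p) = val p"
proof -
  have "val q = val p" if "q \<in> tensor_class p" for q
  proof -
    from that obtain r where r: "r \<in> tensor_ideal A B" "q = r \<oplus>\<^bsub>pair_algebra A B\<^esub> p"
      unfolding a_r_coset_def' by blast
    then show ?thesis using assms a_Hcarr[OF r(1)] val_tensor_ideal[OF r(1)] by simp
  qed
  moreover have "p \<in> tensor_class p" using assms by (rule a_rcos_self)
  ultimately have "val ` tensor_class p = {val p}" by blast
  moreover have "tensor_class p \<in> carrier (tensor A B)" using assms unfolding carrier_tensor by blast
  moreover have "val = (\<lambda>p. \<Oplus>\<^bsub>C\<^esub>s\<in>Poly_Mapping.keys p. f (fst s) \<otimes>\<^bsub>C\<^esub> g (snd s))"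
    by (simp add: fun_eq_iff val_def)
  ultimately show ?thesis by (simp add: tensor_lift_def)
qed

lemma tensor_lift_pure:
  "a \<in> carrier A \<Longrightarrow> b \<in> carrier B \<Longrightarrow> tensor_lift A B C f g (pure_tensor A B a b) = f a \<otimes>\<^bsub>C\<^esub> g b"
  unfolding pure_tensor_def by (subst tensor_lift_class) (auto simp: pair_algebra_simps val_single)

lemma tensor_lift_hom: "tensor_lift A B C f g \<in> alg_hom (tensor A B) C"
proof -
  have "tensor_lift A B C f g \<in> ring_hom (tensor A B) C"
  proof (rule ring_hom_memI)
    show "tensor_lift A B C f g \<one>\<^bsub>tensor A B\<^esub> = \<one>\<^bsub>C\<^esub>"
      using ring_hom_one[OF tensor_class_hom, symmetric] by (simp add: tensor_lift_class)
  qed (auto simp: carrier_tensor tensor_lift_class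
      simp flip: ring_hom_mult[OF tensor_class_hom] ring_hom_add[OF tensor_class_hom])
  then show ?thesis by (simp add: alg_hom_def tensor_lift_def)
qed

end

lemma f2_algebra_liftI:
  assumes "f2_algebra A" "f2_algebra B" "f2_algebra C" "f \<in> ring_hom A C" "g \<in> ring_hom B C"
  shows "f2_algebra_lift A B C f g"
  using assms by (simp add: f2_algebra_lift_def f2_algebra_pair_def ring_hom_cring_def ring_hom_cring_axioms_def f2_algebra.axioms(1))

lemma F2_f2_algebra: "f2_algebra F2"
proof -
  have "cring F2"
  proof (intro cringI abelian_groupI comm_monoidI)
    fix x assume "x \<in> carrier F2"
    show "\<exists>y\<in>carrier F2. y \<oplus>\<^bsub>F2\<^esub> x = \<zero>\<^bsub>F2\<^esub>"
      by (cases x) (auto simp: F2_def)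
  qed (auto simp: F2_def algebra_simps)
  then show ?thesis by (simp add: f2_algebra_def f2_algebra_axioms_def) (simp add: F2_def)
qed

subsection \<open>Polynomial rings\<close>

lemma f2_poly_ring_simps:
  "carrier (f2_poly_ring I) = {p. \<forall>m \<in> Poly_Mapping.keys p. Poly_Mapping.keys m \<subseteq> I}"
  "p \<otimes>\<^bsub>f2_poly_ring I\<^esub> q = p * q" "\<one>\<^bsub>f2_poly_ring I\<^esub> = 1"
  "p \<oplus>\<^bsub>f2_poly_ring I\<^esub> q = p + q" "\<zero>\<^bsub>f2_poly_ring I\<^esub> = 0"
  by (simp_all add: f2_poly_ring_def)

lemma f2_poly_ring_f2_algebra: "f2_algebra (f2_poly_ring I)"
proof -
  let ?P = "f2_poly_ring I"
  have add: "abelian_group ?P"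
  proof (rule abelian_groupI)
    fix p assume "p \<in> carrier ?P"
    then show "\<exists>q\<in>carrier ?P. q \<oplus>\<^bsub>?P\<^esub> p = \<zero>\<^bsub>?P\<^esub>"
      by (intro bexI[of _ p]) (simp_all add: f2_poly_ring_simps(4,5) poly_mapping_bit_add_self)
  next
    fix p q assume "p \<in> carrier ?P" "q \<in> carrier ?P"
    then show "p \<oplus>\<^bsub>?P\<^esub> q \<in> carrier ?P"
      using keys_add[of p q] unfolding f2_poly_ring_simps by blast
  qed (auto simp: f2_poly_ring_simps algebra_simps)
  have "cring ?P"
  proof (rule cringI[OF add comm_monoidI])
    fix p q assume pq: "p \<in> carrier ?P" "q \<in> carrier ?P"
    have "Poly_Mapping.keys m \<subseteq> I" if m: "m \<in> Poly_Mapping.keys (p * q)" for m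
    proof -
      obtain a b where "m = a + b" "a \<in> Poly_Mapping.keys p" "b \<in> Poly_Mapping.keys q"
        using subsetD[OF keys_mult m] by blast
      then show ?thesis using pq keys_add[of a b] unfolding f2_poly_ring_simps by blast
    qed
    then show "p \<otimes>\<^bsub>?P\<^esub> q \<in> carrier ?P" by (simp add: f2_poly_ring_simps)
  qed (auto simp: f2_poly_ring_simps algebra_simps)
  then show ?thesis
    by (simp add: f2_algebra_def f2_algebra_axioms_def f2_poly_ring_simps poly_mapping_bit_add_self)
qed

lemma f2_poly_ring_pow: "x [^]\<^bsub>f2_poly_ring I\<^esub> (n :: nat) = x ^ n"
  by (induction n) (simp_all add: nat_pow_def f2_poly_ring_simps mult.commute)

lemma poly_times_eq_sum:
  fixes p q :: f2_mpoly
  shows "p * q = (\<Sum>s\<in>Poly_Mapping.keys p. \<Sum>t\<in>Poly_Mapping.keys q. Poly_Mapping.single (s + t) 1)"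
proof -
  have "p * q = (\<Sum>s\<in>Poly_Mapping.keys p. Poly_Mapping.single s 1) * (\<Sum>t\<in>Poly_Mapping.keys q. Poly_Mapping.single t 1)"
    by (simp only: sum_single_keys)
  then show ?thesis by (simp add: sum_product mult_single)
qed

text \<open>Exponents are natural numbers, so nothing cancels, in contrast to
  \<open>keys_add_bit\<close>.\<close>

lemma keys_add_nat: "Poly_Mapping.keys (m + m') = Poly_Mapping.keys m \<union> Poly_Mapping.keys m'"
  for m m' :: "nat \<Rightarrow>\<^sub>0 nat"
  by (auto simp: in_keys_iff lookup_add)

context f2_algebra
begin

definition monomial_val :: "(nat \<Rightarrow> 'a) \<Rightarrow> (nat \<Rightarrow>\<^sub>0 nat) \<Rightarrow> 'a" where
  "monomial_val v m = (\<Otimes>i\<in>Poly_Mapping.keys m. v i [^] Poly_Mapping.lookup m i)"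

lemma monomial_val_closed:
  "(\<And>i. i \<in> Poly_Mapping.keys m \<Longrightarrow> v i \<in> carrier A) \<Longrightarrow> monomial_val v m \<in> carrier A"
  unfolding monomial_val_def by (rule finprod_closed) auto

text \<open>Variables with exponent zero contribute a factor one. The enlarged index set lets two
  monomials be multiplied over a common set of variables.\<close>

lemma monomial_val_superset:
  assumes "finite U" "Poly_Mapping.keys m \<subseteq> U" "\<And>i. i \<in> U \<Longrightarrow> v i \<in> carrier A"
  shows "monomial_val v m = (\<Otimes>i\<in>U. v i [^] Poly_Mapping.lookup m i)"
  unfolding monomial_val_def
  by (rule finprod_mono_neutral_cong_left) (use assms in \<open>auto simp: in_keys_iff\<close>)

lemma monomial_val_add:
  assumes "\<And>i. i \<in> Poly_Mapping.keys m \<union> Poly_Mapping.keys m' \<Longrightarrow> v i \<in> carrier A"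
  shows "monomial_val v (m + m') = monomial_val v m \<otimes> monomial_val v m'"
proof -
  let ?U = "Poly_Mapping.keys m \<union> Poly_Mapping.keys m'"
  have v: "\<And>i. i \<in> ?U \<Longrightarrow> v i \<in> carrier A" by (rule assms)
  have "monomial_val v (m + m') = (\<Otimes>i\<in>?U. v i [^] Poly_Mapping.lookup m i \<otimes> v i [^] Poly_Mapping.lookup m' i)"
    by (subst monomial_val_superset[of ?U])
      (use v in \<open>auto simp: keys_add_nat lookup_add nat_pow_mult simp del: finprod_multf intro!: finprod_cong'\<close>)
  also have "\<dots> = monomial_val v m \<otimes> monomial_val v m'"
    using v monomial_val_superset[of ?U m v] monomial_val_superset[of ?U m' v]
    by (subst finprod_multf) auto
  finally show ?thesis .
qed

lemma f2_poly_hom_eq: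
  "p \<in> carrier (f2_poly_ring I) \<Longrightarrow> f2_poly_hom I A v p = finsum A (monomial_val v) (Poly_Mapping.keys p)"
  unfolding f2_poly_hom_def monomial_val_def by simp

text \<open>A polynomial is determined by its support, and \<open>monomial_val v\<close> takes sums
  of exponents to products; \<open>finsum_keys_add\<close> and \<open>finsum_keys_product\<close> do
  the rest.\<close>

lemma f2_poly_hom_hom:
  assumes v: "\<And>i. i \<in> I \<Longrightarrow> v i \<in> carrier A"
  shows "f2_poly_hom I A v \<in> alg_hom (f2_poly_ring I) A"
proof -
  interpret P: f2_algebra "f2_poly_ring I" by (rule f2_poly_ring_f2_algebra)
  have in_I: "v i \<in> carrier A"
    if "p \<in> carrier (f2_poly_ring I)" "m \<in> Poly_Mapping.keys p" "i \<in> Poly_Mapping.keys m" for p m i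
    using that v by (auto simp: f2_poly_ring_simps)
  have cl: "monomial_val v m \<in> carrier A"
    if "p \<in> carrier (f2_poly_ring I)" "m \<in> Poly_Mapping.keys p" for p m
    using in_I[OF that] by (rule monomial_val_closed)
  have "f2_poly_hom I A v \<in> ring_hom (f2_poly_ring I) A"
  proof (rule ring_hom_memI)
    fix p q assume pq: "p \<in> carrier (f2_poly_ring I)" "q \<in> carrier (f2_poly_ring I)"
    show "f2_poly_hom I A v p \<in> carrier A"
      using cl[OF pq(1)] by (auto simp: f2_poly_hom_eq pq intro!: finsum_closed)
    have "finsum A (monomial_val v) (Poly_Mapping.keys (p + q)) =
        finsum A (monomial_val v) (Poly_Mapping.keys p) \<oplus> finsum A (monomial_val v) (Poly_Mapping.keys q)"
      by (rule finsum_keys_add) (use cl pq in blast)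
    then show "f2_poly_hom I A v (p \<oplus>\<^bsub>f2_poly_ring I\<^esub> q) = f2_poly_hom I A v p \<oplus> f2_poly_hom I A v q"
      using pq P.a_closed[OF pq] by (simp add: f2_poly_hom_eq f2_poly_ring_simps(4))
    have "finsum A (monomial_val v) (Poly_Mapping.keys (p * q)) =
        finsum A (monomial_val v) (Poly_Mapping.keys p) \<otimes> finsum A (monomial_val v) (Poly_Mapping.keys q)"
      unfolding poly_times_eq_sum
      by (rule finsum_keys_product) (use cl pq in_I in \<open>blast intro!: monomial_val_add\<close>)+
    then show "f2_poly_hom I A v (p \<otimes>\<^bsub>f2_poly_ring I\<^esub> q) = f2_poly_hom I A v p \<otimes> f2_poly_hom I A v q"
      using pq P.m_closed[OF pq] by (simp add: f2_poly_hom_eq f2_poly_ring_simps(2))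
  next
    show "f2_poly_hom I A v \<one>\<^bsub>f2_poly_ring I\<^esub> = \<one>"
      using P.one_closed by (simp add: f2_poly_hom_eq f2_poly_ring_simps(3) monomial_val_def)
  qed
  then show ?thesis by (simp add: alg_hom_def f2_poly_hom_def)
qed

text \<open>The index \<open>0\<close> is excluded because \<open>gen 0\<close> is the unit and not
  a variable.\<close>

lemma f2_poly_hom_gen:
  assumes "i \<in> I" "0 \<notin> I" "v i \<in> carrier A"
  shows "f2_poly_hom I A v (gen i) = v i"
proof -
  have "i \<noteq> 0" using assms by metis
  then have "gen i = Poly_Mapping.single (Poly_Mapping.single i 1) 1" by (simp add: gen_def)
  then show ?thesis using assms by (simp add: f2_poly_hom_eq f2_poly_ring_simps monomial_val_def)
qed

end

lemma single_add_eq_mult: "Poly_Mapping.single (a + b) (1 :: bit) = Poly_Mapping.single a 1 * Poly_Mapping.single b 1"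
  for a b :: "nat \<Rightarrow>\<^sub>0 nat"
  by (simp add: mult_single)

lemma single_single_pow:
  "Poly_Mapping.single (Poly_Mapping.single i k) 1 = Poly_Mapping.single (Poly_Mapping.single i 1) (1 :: bit) ^ k"
  for i k :: nat
  proof (induction k)
  case (Suc k)
  have "Poly_Mapping.single i (Suc k) = Poly_Mapping.single i 1 + Poly_Mapping.single i k"
    by (simp flip: single_add)
  then show ?case by (simp only: single_add_eq_mult Suc power_Suc)
qed simp

lemma single_sum_monomial:
  "finite F \<Longrightarrow> Poly_Mapping.single (\<Sum>i\<in>F. m i) (1 :: bit) = (\<Prod>i\<in>F. Poly_Mapping.single (m i) 1)"
  for m :: "nat \<Rightarrow> nat \<Rightarrow>\<^sub>0 nat"
  by (induction F rule: finite_induct) (simp_all add: single_add_eq_mult)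

lemma sum_single_lookup: "(\<Sum>i\<in>Poly_Mapping.keys m. Poly_Mapping.single i (Poly_Mapping.lookup m i)) = m"
  for m :: "nat \<Rightarrow>\<^sub>0 nat"
proof (rule poly_mapping_eqI)
  fix j
  have "(\<Sum>i\<in>Poly_Mapping.keys m. if j = i then Poly_Mapping.lookup m i else 0) = Poly_Mapping.lookup m j"
    by (subst sum.delta') (auto simp: in_keys_iff)
  then show "Poly_Mapping.lookup (\<Sum>i\<in>Poly_Mapping.keys m. Poly_Mapping.single i (Poly_Mapping.lookup m i)) j = Poly_Mapping.lookup m j"
    by (simp add: lookup_sum lookup_single when_def eq_commute)
qed

text \<open>The set \<open>E\<close> on which the two morphisms agree is closed under sums and
  products and contains the variables. Every polynomial is the sum of the monomials in its support,
  and each monomial is a product of powers of variables.\<close>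

lemma f2_poly_ring_hom_eqI:
  assumes R: "cring R" and h: "h \<in> ring_hom (f2_poly_ring I) R" "k \<in> ring_hom (f2_poly_ring I) R"
    and gen: "\<And>i. i \<in> I \<Longrightarrow> h (gen i) = k (gen i)" and "0 \<notin> I" and p: "p \<in> carrier (f2_poly_ring I)"
  shows "h p = k p"
proof -
  interpret P: f2_algebra "f2_poly_ring I" by (rule f2_poly_ring_f2_algebra)
  interpret R: cring R by fact
  interpret h: ring_hom_cring "f2_poly_ring I" R h by unfold_locales (rule h)
  interpret k: ring_hom_cring "f2_poly_ring I" R k by unfold_locales (rule h)
  define E where "E = {x \<in> carrier (f2_poly_ring I). h x = k x}"
  note f2_poly_ring_simps(2-)[simp]
  have mult: "x * y \<in> E" if "x \<in> E" "y \<in> E" for x y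
    using that P.m_closed[of x y] h.hom_mult[of x y] k.hom_mult[of x y] by (simp add: E_def)
  have add: "x + y \<in> E" if "x \<in> E" "y \<in> E" for x y
    using that P.a_closed[of x y] h.hom_add[of x y] k.hom_add[of x y] by (simp add: E_def)
  have one: "1 \<in> E" using P.one_closed h.hom_one k.hom_one by (simp add: E_def)
  have zero: "0 \<in> E" using P.zero_closed h.hom_zero k.hom_zero by (simp add: E_def)
  have var: "Poly_Mapping.single (Poly_Mapping.single i 1) 1 \<in> E" if "i \<in> I" for i
  proof -
    have "i \<noteq> 0" using that \<open>0 \<notin> I\<close> by metis
    then show ?thesis using gen[OF that] that by (simp add: E_def gen_def f2_poly_ring_simps)
  qed
  have pow: "x ^ n \<in> E" if "x \<in> E" for x n
    using that by (induction n) (simp_all add: one mult)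
  have prod: "(\<Prod>i\<in>F. f i) \<in> E" if "\<And>i. i \<in> F \<Longrightarrow> f i \<in> E" for F and f :: "nat \<Rightarrow> f2_mpoly"
    using that by (induction F rule: infinite_finite_induct) (simp_all add: one mult)
  have "Poly_Mapping.single m 1 \<in> E" if "Poly_Mapping.keys m \<subseteq> I" for m
  proof -
    have "Poly_Mapping.single m 1 =
        (\<Prod>i\<in>Poly_Mapping.keys m. Poly_Mapping.single (Poly_Mapping.single i 1) (1 :: bit) ^ Poly_Mapping.lookup m i)"
      by (simp only: single_single_pow[symmetric] single_sum_monomial[symmetric] finite_keys sum_single_lookup)
    also have "\<dots> \<in> E"
      by (intro prod pow var) (use that in blast)
    finally show ?thesis .
  qed
  moreover have "(\<Sum>m\<in>F. Poly_Mapping.single m 1) \<in> E" if "\<And>m. m \<in> F \<Longrightarrow> Poly_Mapping.single m 1 \<in> E"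
    for F :: "(nat \<Rightarrow>\<^sub>0 nat) set"
    using that by (induction F rule: infinite_finite_induct) (simp_all add: zero add)
  ultimately have "(\<Sum>m\<in>Poly_Mapping.keys p. Poly_Mapping.single m 1) \<in> E"
    using p by (auto simp: f2_poly_ring_simps(1))
  then have "p \<in> E" by (simp only: sum_single_keys)
  then show ?thesis by (simp add: E_def)
qed

section \<open>Morphisms of tensor products and their values on pure tensors\<close>

lemma tensor_f2_algebraI: "f2_algebra A \<Longrightarrow> f2_algebra B \<Longrightarrow> f2_algebra (tensor A B)"
  by (simp add: f2_algebra_pair.tensor_f2_algebra f2_algebra_pair_def)

lemma tensor_inclusions_hom:
  assumes "f2_algebra A" "f2_algebra B"
  shows "(\<lambda>a. pure_tensor A B a \<one>\<^bsub>B\<^esub>) \<in> ring_hom A (tensor A B)"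
    and "pure_tensor A B \<one>\<^bsub>A\<^esub> \<in> ring_hom B (tensor A B)"
  using assms by (simp_all add: f2_algebra_pair.pure_tensor_left_hom f2_algebra_pair.pure_tensor_right_hom f2_algebra_pair_def)

lemma pure_tensor_one_one:
  "f2_algebra A \<Longrightarrow> f2_algebra B \<Longrightarrow> pure_tensor A B \<one>\<^bsub>A\<^esub> \<one>\<^bsub>B\<^esub> = \<one>\<^bsub>tensor A B\<^esub>"
  by (simp add: f2_algebra_pair.pure_tensor_one f2_algebra_pair_def)

lemma alg_hom_ring_hom: "h \<in> alg_hom A B \<Longrightarrow> h \<in> ring_hom A B"
  by (simp add: alg_hom_def)

lemma alg_hom_compose:
  "ring A \<Longrightarrow> h \<in> ring_hom A B \<Longrightarrow> k \<in> ring_hom B C \<Longrightarrow> compose (carrier A) k h \<in> alg_hom A C"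
  by (auto simp: alg_hom_def compose_def ring.ring_simprules ring_hom_closed ring_hom_mult ring_hom_add
      ring_hom_one intro!: ring_hom_memI)

lemma ring_hom_comp: "h \<in> ring_hom A B \<Longrightarrow> k \<in> ring_hom B C \<Longrightarrow> (\<lambda>x. k (h x)) \<in> ring_hom A C"
  using ring_hom_trans[of h A B k C] by (simp add: comp_def)

lemma ring_hom_identity: "(\<lambda>x. x) \<in> ring_hom A A"
  by (auto simp: ring_hom_def)

lemma tensor_lift_alg_hom:
  assumes "f2_algebra A" "f2_algebra B" "f2_algebra C" "f \<in> ring_hom A C" "g \<in> ring_hom B C"
  shows "tensor_lift A B C f g \<in> alg_hom (tensor A B) C"
  by (rule f2_algebra_lift.tensor_lift_hom[OF f2_algebra_liftI[OF assms]])

lemma tensor_lift_pure_tensor: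
  assumes "f2_algebra A" "f2_algebra B" "f2_algebra C" "f \<in> ring_hom A C" "g \<in> ring_hom B C"
    and "a \<in> carrier A" "b \<in> carrier B"
  shows "tensor_lift A B C f g (pure_tensor A B a b) = f a \<otimes>\<^bsub>C\<^esub> g b"
  by (rule f2_algebra_lift.tensor_lift_pure[OF f2_algebra_liftI[OF assms(1-5)] assms(6-)])

lemma pure_tensor_mult':
  assumes "f2_algebra A" "f2_algebra B"
  assumes "a \<in> carrier A" "b \<in> carrier B" "a' \<in> carrier A" "b' \<in> carrier B"
  shows "pure_tensor A B a b \<otimes>\<^bsub>tensor A B\<^esub> pure_tensor A B a' b' = pure_tensor A B (a \<otimes>\<^bsub>A\<^esub> a') (b \<otimes>\<^bsub>B\<^esub> b')"
  using assms by (simp add: f2_algebra_pair.pure_tensor_mult f2_algebra_pair_def)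

lemma tensor_map_alg_hom:
  assumes "f2_algebra A" "f2_algebra B" "f2_algebra C" "f2_algebra D" "f \<in> ring_hom A C" "g \<in> ring_hom B D"
  shows "tensor_map A B C D f g \<in> alg_hom (tensor A B) (tensor C D)"
  unfolding tensor_map_def
  by (intro tensor_lift_alg_hom tensor_f2_algebraI ring_hom_comp[OF _ tensor_inclusions_hom(1)]
      ring_hom_comp[OF _ tensor_inclusions_hom(2)] assms)

lemma tensor_map_pure_tensor:
  assumes alg: "f2_algebra A" "f2_algebra B" "f2_algebra C" "f2_algebra D" and hom: "f \<in> ring_hom A C" "g \<in> ring_hom B D"
    and ab: "a \<in> carrier A" "b \<in> carrier B"
  shows "tensor_map A B C D f g (pure_tensor A B a b) = pure_tensor C D (f a) (g b)"
proof -
  interpret C: f2_algebra C by fact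
  interpret D: f2_algebra D by fact
  show ?thesis
    unfolding tensor_map_def
    by (subst tensor_lift_pure_tensor)
      (use alg hom ab in \<open>auto intro!: tensor_f2_algebraI ring_hom_comp[OF _ tensor_inclusions_hom(1)]
        ring_hom_comp[OF _ tensor_inclusions_hom(2)] simp: pure_tensor_mult' ring_hom_closed\<close>)
qed

lemma tensor_assoc_alg_hom:
  assumes alg: "f2_algebra A" "f2_algebra B" "f2_algebra C"
  shows "tensor_assoc A B C \<in> alg_hom (tensor (tensor A B) C) (tensor A (tensor B C))"
  unfolding tensor_assoc_def
  by (intro tensor_lift_alg_hom alg_hom_ring_hom[OF tensor_lift_alg_hom] tensor_f2_algebraI assms
      tensor_inclusions_hom ring_hom_comp[OF _ tensor_inclusions_hom(2)])

text \<open>By definition the value is the product of \<open>a \<otimes> 1\<close>,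
  \<open>1 \<otimes> (b \<otimes> 1)\<close> and \<open>1 \<otimes> (1 \<otimes> c)\<close>, which
  is multiplied out factor by factor.\<close>

lemma tensor_assoc_pure_tensor:
  assumes alg: "f2_algebra A" "f2_algebra B" "f2_algebra C"
    and abc: "a \<in> carrier A" "b \<in> carrier B" "c \<in> carrier C"
  shows "tensor_assoc A B C (pure_tensor (tensor A B) C (pure_tensor A B a b) c) =
    pure_tensor A (tensor B C) a (pure_tensor B C b c)"
proof -
  interpret A: f2_algebra A by fact
  interpret B: f2_algebra B by fact
  interpret C: f2_algebra C by fact
  interpret BC: f2_algebra_pair B C by unfold_locales
  interpret AB: f2_algebra_pair A B by unfold_locales
  interpret ABC: f2_algebra_pair A "tensor B C" by unfold_locales
  have *: "tensor_lift A B (tensor A (tensor B C))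
       (\<lambda>a. pure_tensor A (tensor B C) a \<one>\<^bsub>tensor B C\<^esub>)
       (\<lambda>b. pure_tensor A (tensor B C) \<one>\<^bsub>A\<^esub> (pure_tensor B C b \<one>\<^bsub>C\<^esub>)) (pure_tensor A B a b) =
      pure_tensor A (tensor B C) a \<one>\<^bsub>tensor B C\<^esub> \<otimes>\<^bsub>tensor A (tensor B C)\<^esub>
      pure_tensor A (tensor B C) \<one>\<^bsub>A\<^esub> (pure_tensor B C b \<one>\<^bsub>C\<^esub>)"
    by (rule tensor_lift_pure_tensor)
      (intro tensor_f2_algebraI alg abc tensor_inclusions_hom ring_hom_comp[OF _ tensor_inclusions_hom(2)])+
  have "tensor_assoc A B C (pure_tensor (tensor A B) C (pure_tensor A B a b) c) =
      (pure_tensor A (tensor B C) a \<one>\<^bsub>tensor B C\<^esub> \<otimes>\<^bsub>tensor A (tensor B C)\<^esub>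
      pure_tensor A (tensor B C) \<one>\<^bsub>A\<^esub> (pure_tensor B C b \<one>\<^bsub>C\<^esub>)) \<otimes>\<^bsub>tensor A (tensor B C)\<^esub>
      pure_tensor A (tensor B C) \<one>\<^bsub>A\<^esub> (pure_tensor B C \<one>\<^bsub>B\<^esub> c)"
    unfolding tensor_assoc_def *[symmetric]
    by (rule tensor_lift_pure_tensor)
      (intro tensor_lift_alg_hom[THEN alg_hom_ring_hom] tensor_f2_algebraI alg abc AB.pure_tensor_closed
        tensor_inclusions_hom ring_hom_comp[OF _ tensor_inclusions_hom(2)])+
  then show ?thesis
    by (simp add: abc ABC.pure_tensor_mult BC.pure_tensor_mult BC.pure_tensor_closed)
qed


subsection \<open>Truncations of the dual Steenrod algebra\<close>

text \<open>The bound \<open>\<infinity>\<close> gives the dual Steenrod algebra and the bound \<open>n\<close> the degree \<open>n\<close> part of \<^const>\<open>Bplus\<close>.\<close>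

definition truncated_gens :: "enat \<Rightarrow> nat set" where
  "truncated_gens e = {k. 1 \<le> k \<and> enat k \<le> e}"

definition truncated_Steenrod :: "enat \<Rightarrow> f2_mpoly ring" where
  "truncated_Steenrod e = f2_poly_ring (truncated_gens e)"

text \<open>The universal coefficient sequence of bound \<open>e\<close>: index \<open>0\<close>
  gives the unit, and beyond the bound the value is zero, so the sequence is defined on all
  indices.\<close>

definition truncated_gen :: "enat \<Rightarrow> nat \<Rightarrow> f2_mpoly" where
  "truncated_gen e k = (if enat k \<le> e then gen k else 0)"

definition truncated_comult_gen :: "enat \<Rightarrow> enat \<Rightarrow> nat \<Rightarrow> ((f2_mpoly \<times> f2_mpoly) \<Rightarrow>\<^sub>0 bit) set" where
  "truncated_comult_gen e f =
    frob_conv (tensor (truncated_Steenrod e) (truncated_Steenrod f))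
      (\<lambda>s. pure_tensor (truncated_Steenrod e) (truncated_Steenrod f) (truncated_gen e s) \<one>\<^bsub>truncated_Steenrod f\<^esub>)
      (\<lambda>t. pure_tensor (truncated_Steenrod e) (truncated_Steenrod f) \<one>\<^bsub>truncated_Steenrod e\<^esub> (truncated_gen f t))"

definition truncated_comult :: "enat \<Rightarrow> enat \<Rightarrow> f2_mpoly \<Rightarrow> ((f2_mpoly \<times> f2_mpoly) \<Rightarrow>\<^sub>0 bit) set" where
  "truncated_comult e f = f2_poly_hom (truncated_gens (e + f))
    (tensor (truncated_Steenrod e) (truncated_Steenrod f)) (truncated_comult_gen e f)"

definition truncated_counit :: "enat \<Rightarrow> f2_mpoly \<Rightarrow> bit" where
  "truncated_counit e = f2_poly_hom (truncated_gens e) F2 (\<lambda>_. 0)"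

text \<open>Coefficient sequences of additive polynomials of degree at most \<open>2 ^ n\<close> for
  \<open>e = n\<close>, and of arbitrary additive series for \<open>e = \<infinity>\<close>.\<close>

definition truncated_seqs :: "enat \<Rightarrow> ('a, 'm) ring_scheme \<Rightarrow> (nat \<Rightarrow> 'a) set" where
  "truncated_seqs e A =
    {a. (\<forall>k. a k \<in> carrier A) \<and> a 0 = \<one>\<^bsub>A\<^esub> \<and> (\<forall>k. \<not> enat k \<le> e \<longrightarrow> a k = \<zero>\<^bsub>A\<^esub>)}"

lemma truncated_seqs_closed: "a \<in> truncated_seqs e A \<Longrightarrow> a k \<in> carrier A"
  by (simp add: truncated_seqs_def)

lemma truncated_gens_nat: "truncated_gens (enat n) = {1..n}"
  by (auto simp: truncated_gens_def)

lemma truncated_gens_infinity: "truncated_gens \<infinity> = {1..}"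
  by (auto simp: truncated_gens_def)

lemma truncated_Steenrod_nat: "truncated_Steenrod (enat n) = Bplus_alg n"
  by (simp add: truncated_Steenrod_def Bplus_alg_def truncated_gens_nat)

lemma truncated_Steenrod_infinity: "truncated_Steenrod \<infinity> = Steenrod_alg"
  by (simp add: truncated_Steenrod_def Steenrod_alg_def truncated_gens_infinity)

lemma truncated_Steenrod_f2_algebra: "f2_algebra (truncated_Steenrod e)"
  unfolding truncated_Steenrod_def by (rule f2_poly_ring_f2_algebra)

lemma truncated_gen_seq: "truncated_gen e \<in> truncated_seqs e (truncated_Steenrod e)"
  by (auto simp: truncated_seqs_def truncated_gen_def truncated_Steenrod_def f2_poly_ring_simps gen_def
      truncated_gens_def zero_enat_def[symmetric])

lemmas truncated_gen_closed = truncated_seqs_closed[OF truncated_gen_seq]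

lemma hom_truncated_seqs:
  assumes "cring A" "cring B" "h \<in> ring_hom A B" "a \<in> truncated_seqs e A"
  shows "(\<lambda>k. h (a k)) \<in> truncated_seqs e B"
proof -
  interpret ring_hom_cring A B h using assms by (simp add: ring_hom_cring_def ring_hom_cring_axioms_def)
  show ?thesis using assms(4) by (auto simp: truncated_seqs_def)
qed

lemma unit_seq_truncated: "f2_algebra A \<Longrightarrow> unit_seq A \<in> truncated_seqs e A"
proof -
  assume "f2_algebra A" then interpret f2_algebra A .
  show ?thesis by (auto simp: truncated_seqs_def unit_seq_def zero_enat_def[symmetric])
qed

text \<open>If \<open>s + t\<close> exceeds \<open>e + f\<close>, then \<open>s\<close> exceeds
  \<open>e\<close> or \<open>t\<close> exceeds \<open>f\<close>, so every term of the convolution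
  vanishes. At index zero the single term is a product of ones.\<close>

lemma frob_conv_truncated_seqs:
  assumes "f2_algebra A" "b \<in> truncated_seqs e A" "a \<in> truncated_seqs f A"
  shows "frob_conv A b a \<in> truncated_seqs (e + f) A"
proof -
  interpret f2_algebra A by fact
  have cl: "b k \<in> carrier A" "a k \<in> carrier A" for k
    using assms by (simp_all add: truncated_seqs_def)
  have "frob_conv A b a 0 = b 0 [^]\<^bsub>A\<^esub> (2 ^ 0 :: nat) \<otimes>\<^bsub>A\<^esub> a 0"
    by (rule frob_conv_single) (auto simp: cl)
  moreover have "frob_conv A b a k = \<zero>\<^bsub>A\<^esub>" if k: "\<not> enat k \<le> e + f" for k
  proof (rule frob_conv_zero[OF cl])
    fix s t assume "s + t = k"
    then have "\<not> enat s \<le> e \<or> \<not> enat t \<le> f"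
      using k add_mono[of "enat s" e "enat t" f] by (metis plus_enat_simps(1))
    then show "b s = \<zero>\<^bsub>A\<^esub> \<or> a t = \<zero>\<^bsub>A\<^esub>" using assms by (auto simp: truncated_seqs_def)
  qed
  ultimately show ?thesis
    using assms frob_conv_closed[OF cl] by (simp add: truncated_seqs_def)
qed

lemma truncated_Steenrod_hom:
  assumes "f2_algebra A" and a: "\<And>k. k \<in> truncated_gens e \<Longrightarrow> a k \<in> carrier A"
  shows "f2_poly_hom (truncated_gens e) A a \<in> alg_hom (truncated_Steenrod e) A"
  unfolding truncated_Steenrod_def by (rule f2_algebra.f2_poly_hom_hom[OF assms])

text \<open>The assignment \<open>v\<close> has to match \<open>a\<close> on variables only: at
  index zero and beyond the bound the values are forced, as a morphism preserves one and zero. Thus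
  the constant assignment \<open>0\<close> defining the counit yields
  \<open>unit_seq F2\<close>.\<close>

lemma truncated_Steenrod_hom_gen:
  assumes "f2_algebra A" and a: "a \<in> truncated_seqs e A" and v: "\<And>k. k \<in> truncated_gens e \<Longrightarrow> v k = a k"
  shows "f2_poly_hom (truncated_gens e) A v (truncated_gen e k) = a k"
proof -
  interpret f2_algebra A by fact
  interpret S: f2_algebra "truncated_Steenrod e" by (rule truncated_Steenrod_f2_algebra)
  have cl: "a k \<in> carrier A" for k using a by (rule truncated_seqs_closed)
  interpret h: ring_hom_cring "truncated_Steenrod e" A "f2_poly_hom (truncated_gens e) A v"
    by unfold_locales (intro alg_hom_ring_hom[OF truncated_Steenrod_hom], use assms cl in auto)
  consider "k = 0" | "\<not> enat k \<le> e" | "k \<in> truncated_gens e"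
    by (cases "k = 0") (auto simp: truncated_gens_def Suc_le_eq)
  then show ?thesis
  proof cases
    case 1
    then show ?thesis using h.hom_one a
      by (simp add: truncated_gen_def gen_def truncated_seqs_def truncated_Steenrod_def f2_poly_ring_simps zero_enat_def[symmetric])
  next
    case 2
    then show ?thesis using h.hom_zero a
      by (simp add: truncated_gen_def truncated_seqs_def truncated_Steenrod_def f2_poly_ring_simps)
  next
    case 3
    then show ?thesis using v cl
      by (simp add: truncated_gen_def f2_poly_hom_gen truncated_gens_def)
  qed
qed

lemma truncated_Steenrod_hom_eqI:
  assumes "cring R" "h \<in> ring_hom (truncated_Steenrod e) R" "k \<in> ring_hom (truncated_Steenrod e) R"
    and "\<And>i. h (truncated_gen e i) = k (truncated_gen e i)" and "x \<in> carrier (truncated_Steenrod e)"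
  shows "h x = k x"
proof (rule f2_poly_ring_hom_eqI[where I = "truncated_gens e"])
  fix i assume "i \<in> truncated_gens e"
  then show "h (gen i) = k (gen i)" using assms(4)[of i] by (simp add: truncated_gen_def truncated_gens_def)
qed (use assms in \<open>simp_all add: truncated_Steenrod_def truncated_gens_def\<close>)

lemma truncated_comult_gen_seq:
  "truncated_comult_gen e f \<in> truncated_seqs (e + f) (tensor (truncated_Steenrod e) (truncated_Steenrod f))"
  unfolding truncated_comult_gen_def
  by (intro frob_conv_truncated_seqs tensor_f2_algebraI truncated_Steenrod_f2_algebra
      hom_truncated_seqs[OF _ _ tensor_inclusions_hom(1)]
      hom_truncated_seqs[OF _ _ tensor_inclusions_hom(2)] truncated_gen_seq
      f2_algebra.axioms(1))

lemma truncated_comult_hom: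
  "truncated_comult e f \<in> alg_hom (truncated_Steenrod (e + f)) (tensor (truncated_Steenrod e) (truncated_Steenrod f))"
  unfolding truncated_comult_def
  by (intro truncated_Steenrod_hom tensor_f2_algebraI truncated_Steenrod_f2_algebra
      truncated_seqs_closed[OF truncated_comult_gen_seq])

lemma truncated_comult_truncated_gen:
  "truncated_comult e f (truncated_gen (e + f) k) = truncated_comult_gen e f k"
  unfolding truncated_comult_def
  by (intro truncated_Steenrod_hom_gen tensor_f2_algebraI truncated_Steenrod_f2_algebra truncated_comult_gen_seq refl)

lemma truncated_counit_hom: "truncated_counit e \<in> alg_hom (truncated_Steenrod e) F2"
  unfolding truncated_counit_def
  by (rule truncated_Steenrod_hom[OF F2_f2_algebra]) (simp add: F2_def)

lemma truncated_counit_truncated_gen: "truncated_counit e (truncated_gen e k) = unit_seq F2 k"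
  unfolding truncated_counit_def
  by (rule truncated_Steenrod_hom_gen[OF F2_f2_algebra unit_seq_truncated[OF F2_f2_algebra]])
    (auto simp: truncated_gens_def unit_seq_def F2_def)

text \<open>Naturality of \<open>frob_conv\<close>. A morphism out of the tensor product enters only
  through the images \<open>b\<close> and \<open>a\<close> of the two generic sequences;
  coassociativity, the counit laws, compatibility with \<open>theta\<close> and the product of
  represented functors are all computed this way.\<close>

lemma hom_truncated_comult_gen:
  assumes "f2_algebra T" "h \<in> ring_hom (tensor (truncated_Steenrod e) (truncated_Steenrod f)) T"
    and "\<And>s. h (pure_tensor (truncated_Steenrod e) (truncated_Steenrod f) (truncated_gen e s) \<one>\<^bsub>truncated_Steenrod f\<^esub>) = b s"
    and "\<And>t. h (pure_tensor (truncated_Steenrod e) (truncated_Steenrod f) \<one>\<^bsub>truncated_Steenrod e\<^esub> (truncated_gen f t)) = a t"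
  shows "h (truncated_comult_gen e f k) = frob_conv T b a k"
  unfolding truncated_comult_gen_def
  by (subst hom_frob_conv[OF _ assms(1,2)])
    (auto simp: assms(3,4) comp_def
      intro!: tensor_f2_algebraI truncated_Steenrod_f2_algebra truncated_gen_closed
        ring_hom_closed[OF tensor_inclusions_hom(1)] ring_hom_closed[OF tensor_inclusions_hom(2)])

text \<open>On generators the two sides are the two bracketings of a convolution of three sequences
  in the triple tensor product, equal by \<open>frob_conv_assoc\<close>. Morphisms that agree on
  generators are equal.\<close>

lemma truncated_comult_coassoc:
  fixes e f h :: enat
  defines "S \<equiv> truncated_Steenrod"
  assumes x: "x \<in> carrier (S (e + f + h))"
  shows "tensor_assoc (S e) (S f) (S h)
      (tensor_map (S (e + f)) (S h) (tensor (S e) (S f)) (S h) (truncated_comult e f) (\<lambda>y. y)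
        (truncated_comult (e + f) h x)) =
    tensor_map (S e) (S (f + h)) (S e) (tensor (S f) (S h)) (\<lambda>y. y) (truncated_comult f h)
      (truncated_comult e (f + h) x)" (is "?l x = ?r x")
proof -
  have S: "f2_algebra (S e)" for e unfolding S_def by (rule truncated_Steenrod_f2_algebra)
  note T = tensor_f2_algebraI[OF S S]
  have T3: "f2_algebra (tensor (S e) (tensor (S f) (S h)))" by (rule tensor_f2_algebraI[OF S T])
  interpret T3: f2_algebra "tensor (S e) (tensor (S f) (S h))" by (rule T3)
  interpret Sh: f2_algebra "S h" by (rule S)
  interpret Se: f2_algebra "S e" by (rule S)
  interpret Sf: f2_algebra "S f" by (rule S)
  have one_cl: "\<one>\<^bsub>S e\<^esub> \<in> carrier (S e)" for e
  proof -
    interpret S: f2_algebra "S e" by (rule S)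
    show ?thesis by simp
  qed
  note gen_cl = truncated_gen_closed[folded S_def]
  let ?assoc = "tensor_assoc (S e) (S f) (S h)"
  let ?m1 = "tensor_map (S (e + f)) (S h) (tensor (S e) (S f)) (S h) (truncated_comult e f) (\<lambda>y. y)"
  let ?m2 = "tensor_map (S e) (S (f + h)) (S e) (tensor (S f) (S h)) (\<lambda>y. y) (truncated_comult f h)"
  let ?p = "pure_tensor (S e) (tensor (S f) (S h))" and ?q = "pure_tensor (S f) (S h)"
  \<comment> \<open>The generic sequences of the three factors inside the triple tensor product;
    \<open>?c\<close> belongs to the innermost series and \<open>?a\<close> to the
    outermost.\<close>
  let ?c = "\<lambda>k. ?p (truncated_gen e k) \<one>\<^bsub>tensor (S f) (S h)\<^esub>"
  let ?b = "\<lambda>k. ?p \<one>\<^bsub>S e\<^esub> (?q (truncated_gen f k) \<one>\<^bsub>S h\<^esub>)"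
  let ?a = "\<lambda>k. ?p \<one>\<^bsub>S e\<^esub> (?q \<one>\<^bsub>S f\<^esub> (truncated_gen h k))"
  have comult: "truncated_comult e f \<in> ring_hom (S (e + f)) (tensor (S e) (S f))" for e f
    unfolding S_def by (rule alg_hom_ring_hom[OF truncated_comult_hom])
  have assoc: "?assoc \<in> ring_hom (tensor (tensor (S e) (S f)) (S h)) (tensor (S e) (tensor (S f) (S h)))"
    by (rule alg_hom_ring_hom[OF tensor_assoc_alg_hom[OF S S S]])
  have m1: "?m1 \<in> ring_hom (tensor (S (e + f)) (S h)) (tensor (tensor (S e) (S f)) (S h))"
    by (rule alg_hom_ring_hom[OF tensor_map_alg_hom[OF S S T S comult ring_hom_identity]])
  have m2: "?m2 \<in> ring_hom (tensor (S e) (S (f + h))) (tensor (S e) (tensor (S f) (S h)))"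
    by (rule alg_hom_ring_hom[OF tensor_map_alg_hom[OF S S S T ring_hom_identity comult]])
  have comult_gen_cl: "truncated_comult_gen e f k \<in> carrier (tensor (S e) (S f))" for e f k
    unfolding S_def by (rule truncated_seqs_closed[OF truncated_comult_gen_seq])
  have c: "?assoc (pure_tensor (tensor (S e) (S f)) (S h) (pure_tensor (S e) (S f) (truncated_gen e k) \<one>\<^bsub>S f\<^esub>) \<one>\<^bsub>S h\<^esub>) = ?c k" for k
    by (simp add: tensor_assoc_pure_tensor S gen_cl pure_tensor_one_one)
  have b: "?assoc (pure_tensor (tensor (S e) (S f)) (S h) (pure_tensor (S e) (S f) \<one>\<^bsub>S e\<^esub> (truncated_gen f k)) \<one>\<^bsub>S h\<^esub>) = ?b k" for k
    by (simp add: tensor_assoc_pure_tensor S gen_cl)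
  have a: "?assoc (pure_tensor (tensor (S e) (S f)) (S h) \<one>\<^bsub>tensor (S e) (S f)\<^esub> (truncated_gen h k)) = ?a k" for k
    by (simp add: tensor_assoc_pure_tensor S gen_cl flip: pure_tensor_one_one)
  have c_cl: "?c k \<in> carrier (tensor (S e) (tensor (S f) (S h)))" for k
    by (rule ring_hom_closed[OF tensor_inclusions_hom(1)[OF S T] gen_cl])
  have b_cl: "?b k \<in> carrier (tensor (S e) (tensor (S f) (S h)))" for k
    by (rule ring_hom_closed[OF tensor_inclusions_hom(2)[OF S T] ring_hom_closed[OF tensor_inclusions_hom(1)[OF S S] gen_cl]])
  have a_cl: "?a k \<in> carrier (tensor (S e) (tensor (S f) (S h)))" for k
    by (rule ring_hom_closed[OF tensor_inclusions_hom(2)[OF S T] ring_hom_closed[OF tensor_inclusions_hom(2)[OF S S] gen_cl]])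
  \<comment> \<open>The morphism \<open>x \<mapsto> ?assoc (x \<otimes> 1)\<close> carries the
    generic sequences of the first two factors to \<open>?c\<close> and \<open>?b\<close>.\<close>
  have cb: "?assoc (pure_tensor (tensor (S e) (S f)) (S h) (truncated_comult_gen e f k) \<one>\<^bsub>S h\<^esub>) =
      frob_conv (tensor (S e) (tensor (S f) (S h))) ?c ?b k" for k
    by (rule hom_truncated_comult_gen[folded S_def, OF T3 ring_hom_comp[OF tensor_inclusions_hom(1)[OF T S] assoc]])
      (rule c b)+
  have ba: "?p \<one>\<^bsub>S e\<^esub> (truncated_comult_gen f h k) = frob_conv (tensor (S e) (tensor (S f) (S h))) ?b ?a k" for k
    by (rule hom_truncated_comult_gen[folded S_def, OF T3 tensor_inclusions_hom(2)[OF S T]]) (rule refl)+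
  have "?l (truncated_gen (e + f + h) k) = frob_conv (tensor (S e) (tensor (S f) (S h)))
      (frob_conv (tensor (S e) (tensor (S f) (S h))) ?c ?b) ?a k" for k
    unfolding truncated_comult_truncated_gen
    by (rule hom_truncated_comult_gen[folded S_def, OF T3 ring_hom_comp[OF m1 assoc]])
      (simp_all add: tensor_map_pure_tensor S T comult ring_hom_identity gen_cl truncated_comult_truncated_gen
        one_cl ring_hom_one[OF comult] cb a)
  moreover have "?r (truncated_gen (e + (f + h)) k) = frob_conv (tensor (S e) (tensor (S f) (S h))) ?c
      (frob_conv (tensor (S e) (tensor (S f) (S h))) ?b ?a) k" for k
    unfolding truncated_comult_truncated_gen
    by (rule hom_truncated_comult_gen[folded S_def, OF T3 m2])
      (simp_all add: tensor_map_pure_tensor S T comult ring_hom_identity gen_cl truncated_comult_truncated_gen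
        one_cl ring_hom_one[OF comult] ba)
  ultimately have gens: "?l (truncated_gen (e + f + h) k) = ?r (truncated_gen (e + f + h) k)" for k
    \<comment> \<open>\<open>add.assoc\<close> identifies the bounds \<open>e + f + h\<close> and
      \<open>e + (f + h)\<close>, for which the two sides were computed.\<close>
    by (simp add: T3.frob_conv_assoc c_cl b_cl a_cl add.assoc)
  have l: "?l \<in> ring_hom (S (e + f + h)) (tensor (S e) (tensor (S f) (S h)))"
    by (rule ring_hom_comp[OF comult ring_hom_comp[OF m1 assoc]])
  have r: "?r \<in> ring_hom (S (e + f + h)) (tensor (S e) (tensor (S f) (S h)))"
    unfolding add.assoc by (rule ring_hom_comp[OF comult m2])
  show ?thesis
    by (rule truncated_Steenrod_hom_eqI[where h = ?l and k = ?r, folded S_def, OF T3.is_cring l r gens x])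
qed

text \<open>The counit turns the generic sequence of the first factor into \<open>unit_seq\<close>,
  which is a left unit for \<open>frob_conv\<close>. The hypothesis \<open>e + f = f\<close> covers
  both the bound \<open>0\<close> and the case where both bounds are \<open>\<infinity>\<close>,
  hence degree zero of either graded bialgebra.\<close>

lemma truncated_comult_counit_left:
  assumes ef: "e + f = f" and x: "x \<in> carrier (truncated_Steenrod f)"
  shows "tensor_lift F2 (truncated_Steenrod f) (truncated_Steenrod f) (f2_unit (truncated_Steenrod f)) (\<lambda>y. y)
    (tensor_map (truncated_Steenrod e) (truncated_Steenrod f) F2 (truncated_Steenrod f) (truncated_counit e) (\<lambda>y. y)
      (truncated_comult e f x)) = x"
proof -
  let ?S = truncated_Steenrod
  let ?l = "tensor_lift F2 (?S f) (?S f) (f2_unit (?S f)) (\<lambda>y. y)"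
  let ?m = "tensor_map (?S e) (?S f) F2 (?S f) (truncated_counit e) (\<lambda>y. y)"
  note S = truncated_Steenrod_f2_algebra
  interpret Sf: f2_algebra "?S f" by (rule S)
  interpret Se: f2_algebra "?S e" by (rule S)
  interpret F2: f2_algebra F2 by (rule F2_f2_algebra)
  note counit = alg_hom_ring_hom[OF truncated_counit_hom]
  have lift: "?l \<in> ring_hom (tensor F2 (?S f)) (?S f)"
    by (rule alg_hom_ring_hom[OF tensor_lift_alg_hom[OF F2_f2_algebra S S Sf.f2_unit_hom ring_hom_identity]])
  have map: "?m \<in> ring_hom (tensor (?S e) (?S f)) (tensor F2 (?S f))"
    by (rule alg_hom_ring_hom[OF tensor_map_alg_hom[OF S S F2_f2_algebra S counit ring_hom_identity]])
  have comult: "truncated_comult e f \<in> ring_hom (?S f) (tensor (?S e) (?S f))"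
    using alg_hom_ring_hom[OF truncated_comult_hom[of e f]] by (simp only: ef)
  have unit: "unit_seq F2 s \<in> carrier F2" "f2_unit (?S f) (unit_seq F2 s) = unit_seq (?S f) s"
    "f2_unit (?S f) \<one>\<^bsub>F2\<^esub> = \<one>\<^bsub>?S f\<^esub>" for s
    by (simp_all add: unit_seq_def f2_unit_def) (simp_all add: F2_def)
  have "?l (?m (truncated_comult e f (truncated_gen (e + f) k))) =
      frob_conv (?S f) (unit_seq (?S f)) (truncated_gen f) k" for k
    unfolding truncated_comult_truncated_gen
    by (rule hom_truncated_comult_gen[OF S ring_hom_comp[OF map lift]])
      (simp_all add: tensor_map_pure_tensor tensor_lift_pure_tensor F2_f2_algebra S counit ring_hom_identity
        truncated_gen_closed truncated_counit_truncated_gen unit Sf.f2_unit_hom ring_hom_one[OF counit] Sf.unit_seq_closed)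
  then have "?l (?m (truncated_comult e f (truncated_gen f k))) = truncated_gen f k" for k
    by (simp add: ef Sf.frob_conv_unit_left truncated_gen_closed)
  then show ?thesis
    by (rule truncated_Steenrod_hom_eqI[where h = "\<lambda>x. ?l (?m (truncated_comult e f x))" and k = "\<lambda>x. x",
          OF Sf.is_cring ring_hom_comp[OF comult ring_hom_comp[OF map lift]] ring_hom_identity _ x])
qed

text \<open>The mirror image, with \<open>unit_seq\<close> as the outer sequence and the right unit
  law.\<close>

lemma truncated_comult_counit_right:
  assumes ef: "e + f = e" and x: "x \<in> carrier (truncated_Steenrod e)"
  shows "tensor_lift (truncated_Steenrod e) F2 (truncated_Steenrod e) (\<lambda>y. y) (f2_unit (truncated_Steenrod e))
    (tensor_map (truncated_Steenrod e) (truncated_Steenrod f) (truncated_Steenrod e) F2 (\<lambda>y. y) (truncated_counit f)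
      (truncated_comult e f x)) = x"
proof -
  let ?S = truncated_Steenrod
  let ?l = "tensor_lift (?S e) F2 (?S e) (\<lambda>y. y) (f2_unit (?S e))"
  let ?m = "tensor_map (?S e) (?S f) (?S e) F2 (\<lambda>y. y) (truncated_counit f)"
  note S = truncated_Steenrod_f2_algebra
  interpret Sf: f2_algebra "?S f" by (rule S)
  interpret Se: f2_algebra "?S e" by (rule S)
  interpret F2: f2_algebra F2 by (rule F2_f2_algebra)
  note counit = alg_hom_ring_hom[OF truncated_counit_hom]
  have lift: "?l \<in> ring_hom (tensor (?S e) F2) (?S e)"
    by (rule alg_hom_ring_hom[OF tensor_lift_alg_hom[OF S F2_f2_algebra S ring_hom_identity Se.f2_unit_hom]])
  have map: "?m \<in> ring_hom (tensor (?S e) (?S f)) (tensor (?S e) F2)"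
    by (rule alg_hom_ring_hom[OF tensor_map_alg_hom[OF S S S F2_f2_algebra ring_hom_identity counit]])
  have comult: "truncated_comult e f \<in> ring_hom (?S e) (tensor (?S e) (?S f))"
    using alg_hom_ring_hom[OF truncated_comult_hom[of e f]] by (simp only: ef)
  have unit: "unit_seq F2 s \<in> carrier F2" "f2_unit (?S e) (unit_seq F2 s) = unit_seq (?S e) s"
    "f2_unit (?S e) \<one>\<^bsub>F2\<^esub> = \<one>\<^bsub>?S e\<^esub>" for s
    by (simp_all add: unit_seq_def f2_unit_def) (simp_all add: F2_def)
  have "?l (?m (truncated_comult e f (truncated_gen (e + f) k))) =
      frob_conv (?S e) (truncated_gen e) (unit_seq (?S e)) k" for k
    unfolding truncated_comult_truncated_gen
    by (rule hom_truncated_comult_gen[OF S ring_hom_comp[OF map lift]])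
      (simp_all add: tensor_map_pure_tensor tensor_lift_pure_tensor F2_f2_algebra S counit ring_hom_identity
        truncated_gen_closed truncated_counit_truncated_gen unit Se.f2_unit_hom ring_hom_one[OF counit] Se.unit_seq_closed)
  then have "?l (?m (truncated_comult e f (truncated_gen e k))) = truncated_gen e k" for k
    by (simp add: ef Se.frob_conv_unit_right truncated_gen_closed)
  then show ?thesis
    by (rule truncated_Steenrod_hom_eqI[where h = "\<lambda>x. ?l (?m (truncated_comult e f x))" and k = "\<lambda>x. x",
          OF Se.is_cring ring_hom_comp[OF comult ring_hom_comp[OF map lift]] ring_hom_identity _ x])
qed

section \<open>The two graded bialgebras as instances of one family\<close>

definition truncated_bialgebra :: "(nat \<Rightarrow> enat) \<Rightarrow> f2_mpoly graded_bialgebra" where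
  "truncated_bialgebra e =
    \<lparr>galg = (\<lambda>n. truncated_Steenrod (e n)), gcomult = (\<lambda>i j. truncated_comult (e i) (e j)),
     gcounit = truncated_counit (e 0)\<rparr>"

lemma truncated_bialgebra_simps:
  "galg (truncated_bialgebra e) n = truncated_Steenrod (e n)"
  "gcomult (truncated_bialgebra e) i j = truncated_comult (e i) (e j)"
  "gcounit (truncated_bialgebra e) = truncated_counit (e 0)"
  by (simp_all add: truncated_bialgebra_def)

text \<open>Additivity of \<open>e\<close> gives the components of the coproduct the correct source,
  and in degree zero it supplies the hypotheses of the counit laws. Both \<open>enat\<close> and the
  constant \<open>\<infinity>\<close> are additive.\<close>

lemma graded_bialgebra_truncated:
  assumes e: "\<And>i j. e (i + j) = e i + e j"
  shows "graded_bialgebra (truncated_bialgebra e)"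
proof (rule graded_bialgebra.intro)
  fix x n
  have e0: "e 0 + e n = e n" "e n + e 0 = e n" using e[of 0 n] e[of n 0] by simp_all
  assume "x \<in> carrier (galg (truncated_bialgebra e) n)"
  note x = this[unfolded truncated_bialgebra_simps]
  show "tensor_lift F2 (galg (truncated_bialgebra e) n) (galg (truncated_bialgebra e) n)
      (f2_unit (galg (truncated_bialgebra e) n)) (\<lambda>y. y)
      (tensor_map (galg (truncated_bialgebra e) 0) (galg (truncated_bialgebra e) n) F2 (galg (truncated_bialgebra e) n)
        (gcounit (truncated_bialgebra e)) (\<lambda>y. y) (gcomult (truncated_bialgebra e) 0 n x)) = x"
    unfolding truncated_bialgebra_simps by (rule truncated_comult_counit_left[OF e0(1) x])
  show "tensor_lift (galg (truncated_bialgebra e) n) F2 (galg (truncated_bialgebra e) n)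
      (\<lambda>y. y) (f2_unit (galg (truncated_bialgebra e) n))
      (tensor_map (galg (truncated_bialgebra e) n) (galg (truncated_bialgebra e) 0) (galg (truncated_bialgebra e) n) F2
        (\<lambda>y. y) (gcounit (truncated_bialgebra e)) (gcomult (truncated_bialgebra e) n 0 x)) = x"
    unfolding truncated_bialgebra_simps by (rule truncated_comult_counit_right[OF e0(2) x])
qed (simp_all add: truncated_bialgebra_simps e truncated_Steenrod_f2_algebra truncated_comult_hom
    truncated_counit_hom truncated_comult_coassoc)

text \<open>This links the convolution to the explicit coproduct formula. In range,
  \<open>(gen s \<otimes> 1) ^ 2 ^ t\<close> times \<open>1 \<otimes> gen t\<close> is the stated
  pure tensor; out of range one of the truncated generators is zero, and so is its term.\<close>

lemma truncated_comult_gen_eq: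
  "truncated_comult_gen e f k = finsum (tensor (truncated_Steenrod e) (truncated_Steenrod f))
     (\<lambda>(s, t). pure_tensor (truncated_Steenrod e) (truncated_Steenrod f) (gen s ^ (2 ^ t)) (gen t))
     {(s, t). s + t = k \<and> enat s \<le> e \<and> enat t \<le> f}"
proof -
  let ?A = "truncated_Steenrod e" and ?B = "truncated_Steenrod f"
  interpret f2_algebra_pair ?A ?B
    by (simp add: f2_algebra_pair_def truncated_Steenrod_f2_algebra)
  let ?T = "tensor ?A ?B"
  interpret l: ring_hom_cring ?A ?T "\<lambda>a. pure_tensor ?A ?B a \<one>\<^bsub>?B\<^esub>"
    by unfold_locales (rule pure_tensor_left_hom)
  interpret r: ring_hom_cring ?B ?T "pure_tensor ?A ?B \<one>\<^bsub>?A\<^esub>"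
    by unfold_locales (rule pure_tensor_right_hom)
  have cl: "gen s \<in> carrier ?A" if "enat s \<le> e" for s
    using truncated_gen_closed[of e s] that by (simp add: truncated_gen_def)
  have cl': "gen s \<in> carrier ?B" if "enat s \<le> f" for s
    using truncated_gen_closed[of f s] that by (simp add: truncated_gen_def)
  have pow: "x [^]\<^bsub>?A\<^esub> (n :: nat) = x ^ n" for x n
    by (simp add: truncated_Steenrod_def f2_poly_ring_pow)
  have gen: "truncated_gen e s = (if enat s \<le> e then gen s else \<zero>\<^bsub>?A\<^esub>)"
    "truncated_gen f s = (if enat s \<le> f then gen s else \<zero>\<^bsub>?B\<^esub>)" for s
    by (simp_all add: truncated_gen_def truncated_Steenrod_def f2_poly_ring_simps)
  have cl_pow: "gen s ^ (2 ^ t) \<in> carrier ?A" if "enat s \<le> e" for s t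
    using A.nat_pow_closed[OF cl[OF that], of "2 ^ t"] by (simp only: pow)
  have summand: "pure_tensor ?A ?B (truncated_gen e s) \<one>\<^bsub>?B\<^esub> [^]\<^bsub>?T\<^esub> (2 ^ t :: nat) \<otimes>\<^bsub>?T\<^esub>
      pure_tensor ?A ?B \<one>\<^bsub>?A\<^esub> (truncated_gen f t) =
      (if enat s \<le> e \<and> enat t \<le> f then pure_tensor ?A ?B (gen s ^ (2 ^ t)) (gen t) else \<zero>\<^bsub>?T\<^esub>)" for s t
  proof (cases "enat s \<le> e \<and> enat t \<le> f")
    case True
    then have "pure_tensor ?A ?B (gen s) \<one>\<^bsub>?B\<^esub> [^]\<^bsub>?T\<^esub> (2 ^ t :: nat) = pure_tensor ?A ?B (gen s ^ (2 ^ t)) \<one>\<^bsub>?B\<^esub>"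
      using l.hom_pow[OF cl, of s "2 ^ t"] by (simp only: pow)
    then show ?thesis using True by (simp add: truncated_gen_def pure_tensor_mult cl' cl_pow)
  next
    case False
    then show ?thesis
      by (cases "enat s \<le> e") (auto simp: gen tensor.frobenius_zero cl cl' simp del: tensor.nat_pow_zero)
  qed
  show ?thesis
    unfolding truncated_comult_gen_def frob_conv_def
    by (intro tensor.add.finprod_mono_neutral_cong_right) (auto simp: summand pure_tensor_closed cl' cl_pow split: if_splits)
qed

lemma Bplus_eq_truncated: "Bplus = truncated_bialgebra enat"
proof -
  have "f2_poly_hom {1..i + j} (tensor (Bplus_alg i) (Bplus_alg j))
      (\<lambda>k. finsum (tensor (Bplus_alg i) (Bplus_alg j))
        (\<lambda>(s, t). pure_tensor (Bplus_alg i) (Bplus_alg j) (gen s ^ (2 ^ t)) (gen t))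
        {(s, t). s + t = k \<and> s \<le> i \<and> t \<le> j}) = truncated_comult (enat i) (enat j)" for i j
    unfolding truncated_comult_def truncated_comult_gen_eq[abs_def]
    by (simp add: truncated_Steenrod_nat truncated_gens_nat)
  then show ?thesis
    by (simp add: Bplus_def truncated_bialgebra_def truncated_counit_def truncated_Steenrod_nat truncated_gens_nat)
qed

lemma gamma_dual_Steenrod_eq_truncated: "gamma_bialgebra dual_Steenrod = truncated_bialgebra (\<lambda>_. \<infinity>)"
  unfolding gamma_bialgebra_def dual_Steenrod_def truncated_bialgebra_def truncated_comult_def truncated_counit_def
    truncated_comult_gen_eq[abs_def]
  by (simp add: truncated_Steenrod_infinity truncated_gens_infinity)

section \<open>The morphism \<open>theta\<close> of graded bialgebras\<close>

lemma theta_hom: "theta n \<in> alg_hom (truncated_Steenrod \<infinity>) (truncated_Steenrod (enat n))"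
  and theta_truncated_gen: "theta n (truncated_gen \<infinity> k) = truncated_gen (enat n) k"
proof -
  have theta: "theta n = f2_poly_hom (truncated_gens \<infinity>) (truncated_Steenrod (enat n)) (truncated_gen (enat n))"
    by (simp add: theta_def truncated_gens_infinity truncated_Steenrod_nat truncated_gen_def[abs_def])
  \<comment> \<open>A sequence vanishing beyond \<open>n\<close> is in particular one of bound
    \<open>\<infinity>\<close>, hence it is the image of the generic sequence under a morphism from
    the algebra with all generators.\<close>
  have seq: "truncated_gen (enat n) \<in> truncated_seqs \<infinity> (truncated_Steenrod (enat n))"
    using truncated_gen_seq[of "enat n"] by (simp add: truncated_seqs_def)
  show "theta n \<in> alg_hom (truncated_Steenrod \<infinity>) (truncated_Steenrod (enat n))"
    unfolding theta by (rule truncated_Steenrod_hom[OF truncated_Steenrod_f2_algebra truncated_gen_closed])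
  show "theta n (truncated_gen \<infinity> k) = truncated_gen (enat n) k"
    unfolding theta by (rule truncated_Steenrod_hom_gen[OF truncated_Steenrod_f2_algebra seq refl])
qed

text \<open>\<open>theta n\<close> carries the generic sequence of bound \<open>\<infinity>\<close>
  to that of bound \<open>n\<close>. On generators both sides of the coproduct identity are
  therefore the convolution of the generic sequences of bounds \<open>i\<close> and
  \<open>j\<close>.\<close>

lemma theta_bialgebra_morphism: "graded_bialgebra_morphism (gamma_bialgebra dual_Steenrod) Bplus theta"
  unfolding graded_bialgebra_morphism_def gamma_dual_Steenrod_eq_truncated Bplus_eq_truncated truncated_bialgebra_simps
proof (intro conjI allI ballI)
  let ?S = truncated_Steenrod
  note S = truncated_Steenrod_f2_algebra
  note comult = alg_hom_ring_hom[OF truncated_comult_hom]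
  note theta = alg_hom_ring_hom[OF theta_hom]
  show "graded_bialgebra (truncated_bialgebra (\<lambda>_. \<infinity>))" "graded_bialgebra (truncated_bialgebra enat)"
    by (rule graded_bialgebra_truncated; simp)+
  show "theta n \<in> alg_hom (?S \<infinity>) (?S (enat n))" for n by (rule theta_hom)
  {
    fix i j x assume x: "x \<in> carrier (?S \<infinity>)"
    let ?m = "tensor_map (?S \<infinity>) (?S \<infinity>) (?S (enat i)) (?S (enat j)) (theta i) (theta j)"
    have m: "?m \<in> ring_hom (tensor (?S \<infinity>) (?S \<infinity>)) (tensor (?S (enat i)) (?S (enat j)))"
      by (rule alg_hom_ring_hom[OF tensor_map_alg_hom[OF S S S S theta theta]])
    interpret T: f2_algebra "tensor (?S (enat i)) (?S (enat j))" by (rule tensor_f2_algebraI[OF S S])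
    interpret SI: f2_algebra "?S \<infinity>" by (rule S)
    have "?m (truncated_comult \<infinity> \<infinity> (truncated_gen (\<infinity> + \<infinity>) k)) = truncated_comult_gen (enat i) (enat j) k" for k
      unfolding truncated_comult_truncated_gen truncated_comult_gen_def[of "enat i"]
      by (rule hom_truncated_comult_gen[OF T.f2_algebra_axioms m])
        (simp_all add: tensor_map_pure_tensor S theta truncated_gen_closed theta_truncated_gen ring_hom_one[OF theta])
    then have "truncated_comult (enat i) (enat j) (theta (i + j) (truncated_gen \<infinity> k)) =
        ?m (truncated_comult \<infinity> \<infinity> (truncated_gen \<infinity> k))" for k
      using truncated_comult_truncated_gen[of "enat i" "enat j" k] by (simp add: theta_truncated_gen)
    moreover have "theta (i + j) \<in> ring_hom (?S \<infinity>) (?S (enat i + enat j))"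
      using theta[of "i + j"] by simp
    moreover have "truncated_comult \<infinity> \<infinity> \<in> ring_hom (?S \<infinity>) (tensor (?S \<infinity>) (?S \<infinity>))"
      using comult[of \<infinity> \<infinity>] by simp
    ultimately show "truncated_comult (enat i) (enat j) (theta (i + j) x) = ?m (truncated_comult \<infinity> \<infinity> x)"
      by (intro truncated_Steenrod_hom_eqI[where h = "\<lambda>x. truncated_comult (enat i) (enat j) (theta (i + j) x)"
            and k = "\<lambda>x. ?m (truncated_comult \<infinity> \<infinity> x)", OF T.is_cring ring_hom_comp[OF _ comult] ring_hom_comp[OF _ m] _ x])
  }
  fix x assume x: "x \<in> carrier (?S \<infinity>)"
  interpret F2: f2_algebra F2 by (rule F2_f2_algebra)
  show "truncated_counit (enat 0) (theta 0 x) = truncated_counit \<infinity> x"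
    by (rule truncated_Steenrod_hom_eqI[where h = "\<lambda>x. truncated_counit (enat 0) (theta 0 x)", OF F2.is_cring _ _ _ x])
      (simp_all add: ring_hom_comp[OF theta] alg_hom_ring_hom[OF truncated_counit_hom]
        truncated_counit_truncated_gen theta_truncated_gen)
qed

lemma theta_gen: "1 \<le> i \<Longrightarrow> theta n (gen i) = (if i \<le> n then gen i else 0)"
  using theta_truncated_gen[of n i] by (simp add: truncated_gen_def)

subsection \<open>Composition of additive series\<close>

text \<open>Makes the Frobenius identity available for powers of the inner polynomial.\<close>

lemma UP_f2_algebra: "f2_algebra A \<Longrightarrow> f2_algebra (UP A)"
proof -
  assume "f2_algebra A"
  then interpret f2_algebra A .
  interpret UP_cring A "UP A" by unfold_locales simp
  have "\<one>\<^bsub>UP A\<^esub> \<oplus>\<^bsub>UP A\<^esub> \<one>\<^bsub>UP A\<^esub> = \<zero>\<^bsub>UP A\<^esub>"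
    by (rule up_eqI) (auto simp: char_two)
  then show "f2_algebra (UP A)"
    by (simp add: f2_algebra_def f2_algebra_axioms_def UP_cring)
qed

lemma hom_additive_series:
  assumes "cring A" "cring B" "h \<in> ring_hom A B" "\<And>k. a k \<in> carrier A"
  shows "h (additive_series A a m) = additive_series B (\<lambda>k. h (a k)) m"
proof -
  interpret ring_hom_cring A B h using assms by (simp add: ring_hom_cring_def ring_hom_cring_axioms_def)
  show ?thesis unfolding additive_series_def
    by (subst hom_finsum) (use assms(4) in \<open>auto simp: comp_def\<close>)
qed

text \<open>\<open>additive_series\<close> and the two compositions are defined for plain
  \<open>'a ring\<close> records, so the record type is fixed here.\<close>

locale f2_algebra_ring = f2_algebra A for A :: "'a ring" (structure)
begin

lemma additive_series_power: "a k \<in> carrier A \<Longrightarrow> additive_series A a (2 ^ k) = a k"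
proof -
  have "{i. 2 ^ i = (2 ^ k :: nat)} = {k}" by auto
  then show "a k \<in> carrier A \<Longrightarrow> ?thesis" by (simp add: additive_series_def)
qed

lemma additive_series_nonpower: "m \<notin> range (\<lambda>k. 2 ^ k) \<Longrightarrow> additive_series A a m = \<zero>"
proof -
  assume "m \<notin> range (\<lambda>k. 2 ^ k)"
  then have "{i. 2 ^ i = m} = {}" by auto
  then show ?thesis by (simp add: additive_series_def)
qed

lemma additive_series_eqI:
  assumes "\<And>k. f (2 ^ k) = a k" "\<And>k. a k \<in> carrier A" "\<And>m. m \<notin> range (\<lambda>k. 2 ^ k) \<Longrightarrow> f m = \<zero>"
  shows "f = additive_series A a"
proof
  fix m show "f m = additive_series A a m"
    using assms by (cases "m \<in> range (\<lambda>k. 2 ^ k :: nat)") (auto simp: additive_series_power additive_series_nonpower)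
qed

lemma additive_series_closed: "(\<And>k. a k \<in> carrier A) \<Longrightarrow> additive_series A a m \<in> carrier A"
  by (auto simp: additive_series_def intro!: finsum_closed)

lemma additive_series_inj:
  assumes "additive_series A a = additive_series A b" "\<And>k. a k \<in> carrier A" "\<And>k. b k \<in> carrier A"
  shows "a = b"
proof
  fix k show "a k = b k"
    using fun_cong[OF assms(1), of "2 ^ k"] assms(2,3) by (simp add: additive_series_power)
qed

lemma additive_series_unit: "additive_series A (unit_seq A) = (\<lambda>m. if m = 1 then \<one> else \<zero>)"
proof (rule additive_series_eqI[symmetric])
  fix m :: nat assume "m \<notin> range (\<lambda>k. 2 ^ k)"
  then have "m \<noteq> 2 ^ 0" by blast
  then show "(if m = 1 then \<one> else \<zero>) = \<zero>" by simp
qed (auto simp: unit_seq_def)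

text \<open>The coefficients of the power \<open>2 ^ t\<close> of the additive series of
  \<open>b\<close>: the term \<open>b s x^(2^s)\<close> becomes
  \<open>b s ^ 2 ^ t x^(2^(s+t))\<close>.\<close>

definition frob_shift :: "nat \<Rightarrow> (nat \<Rightarrow> 'a) \<Rightarrow> nat \<Rightarrow> 'a" where
  "frob_shift t b k = (if t \<le> k then b (k - t) [^] (2 ^ t :: nat) else \<zero>)"

lemma frob_shift_closed: "(\<And>k. b k \<in> carrier A) \<Longrightarrow> frob_shift t b k \<in> carrier A"
  by (simp add: frob_shift_def)

text \<open>The computation shared by polynomials and power series. \<open>G i\<close> stands for
  the coefficient at \<open>x^m\<close> of the \<open>i\<close>-th power of the inner series, and
  only the indices \<open>i = 2 ^ t\<close> contribute. \<open>N\<close> is the end of the sum: the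
  degree of the outer polynomial in one case and \<open>m\<close> in the other.\<close>

lemma sum_comp_additive:
  assumes a: "\<And>k. a k \<in> carrier A" and b: "\<And>k. b k \<in> carrier A" and G: "\<And>i. G i \<in> carrier A"
    and pow: "\<And>t. G (2 ^ t) = additive_series A (frob_shift t b) m"
    and N: "\<And>t. 2 ^ t \<le> m \<Longrightarrow> N < 2 ^ t \<Longrightarrow> a t = \<zero>"
  shows "(\<Oplus>i\<in>{..N}. additive_series A a i \<otimes> G i) = additive_series A (frob_conv A b a) m"
proof (cases "m \<in> range (\<lambda>k. 2 ^ k :: nat)")
  case False
  have "additive_series A a i \<otimes> G i = \<zero>" for i
    using False G a b
    by (cases "i \<in> range (\<lambda>k. 2 ^ k :: nat)")
      (auto simp: pow additive_series_power additive_series_nonpower)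
  then show ?thesis using False by (simp add: additive_series_nonpower)
next
  case True
  then obtain k where k: "m = 2 ^ k" by auto
  \<comment> \<open>The pair \<open>(s, t)\<close> corresponds to the summation index
    \<open>2 ^ t\<close>; since \<open>s = k - t\<close>, this assignment is injective.\<close>
  let ?D = "{(s, t). s + t = k}" and ?h = "\<lambda>(s :: nat, t :: nat). 2 ^ t :: nat"
  have inj: "inj_on ?h ?D" by (auto simp: inj_on_def)
  have cl: "additive_series A a i \<otimes> G i \<in> carrier A" for i
    using a G by (simp add: additive_series_closed)
  have pow_k: "G (2 ^ t) = frob_shift t b k" for t
    unfolding pow k by (rule additive_series_power) (rule frob_shift_closed[OF b])
  have "frob_conv A b a k = (\<Oplus>z\<in>?D. additive_series A a (?h z) \<otimes> G (?h z))"
    unfolding frob_conv_def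
    by (rule finsum_cong') (auto simp: additive_series_power a b pow_k frob_shift_def m_comm)
  also have "\<dots> = (\<Oplus>i\<in>?h ` ?D. additive_series A a i \<otimes> G i)"
    by (rule finsum_reindex[symmetric]) (use inj cl in auto)
  also have "\<dots> = (\<Oplus>i\<in>{..N}. additive_series A a i \<otimes> G i)"
  \<comment> \<open>Neither index set need contain the other. An index up to \<open>N\<close>
    outside the image of \<open>?D\<close> is no power of two, or is \<open>2 ^ t\<close> with
    \<open>t > k\<close>, where \<open>frob_shift\<close> is zero; an index beyond \<open>N\<close>
    is covered by the assumption on \<open>N\<close>.\<close>
  proof (rule add.finprod_mono_neutral_cong)
    fix i assume i: "i \<in> {..N} - ?h ` ?D"
    show "additive_series A a i \<otimes> G i = \<zero>"
    proof (cases "i \<in> range (\<lambda>k. 2 ^ k :: nat)")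
      case True
      then obtain t where t: "i = 2 ^ t" by auto
      have "\<not> t \<le> k"
      proof
        assume "t \<le> k"
        then have "(k - t, t) \<in> ?D" by simp
        then have "i \<in> ?h ` ?D" using t by force
        then show False using i by simp
      qed
      then show ?thesis using a by (simp add: t pow_k frob_shift_def additive_series_power)
    qed (use G in \<open>simp add: additive_series_nonpower\<close>)
  next
    fix i assume "i \<in> ?h ` ?D - {..N}"
    then show "additive_series A a i \<otimes> G i = \<zero>"
      using N G by (auto simp: k additive_series_power a)
  qed (use cl in auto)
  finally show ?thesis using frob_conv_closed[of b a k, OF b a] by (simp add: k additive_series_power)
qed

section \<open>Composition of additive polynomials\<close>

sublocale UP: UP_cring A "UP A" by unfold_locales simp
sublocale UP_f2: f2_algebra "UP A" by (rule UP_f2_algebra) unfold_locales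

text \<open>Polynomials are coefficient functions, so \<open>coeff\<close> is the identity on the
  carrier. This is why a polynomial can be equated with an \<open>additive_series\<close>.\<close>

lemma coeff_UP: "p \<in> carrier (UP A) \<Longrightarrow> coeff (UP A) p = p"
  by (simp add: UP_def)

lemma additive_poly_closed: "(\<And>k. k \<le> n \<Longrightarrow> a k \<in> carrier A) \<Longrightarrow> additive_poly A n a \<in> carrier (UP A)"
  unfolding additive_poly_def by (rule UP.P.finsum_closed) auto

lemma additive_poly_eq:
  assumes a: "\<And>k. k \<le> n \<Longrightarrow> a k \<in> carrier A"
  shows "additive_poly A n a = additive_series A (\<lambda>k. if k \<le> n then a k else \<zero>)"
proof -
  have coeff: "additive_poly A n a m = (\<Oplus>i\<in>{0..n}. if 2 ^ i = m then a i else \<zero>)" for m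
  proof -
    have "additive_poly A n a m = coeff (UP A) (additive_poly A n a) m"
      by (simp add: coeff_UP additive_poly_closed a)
    also have "\<dots> = (\<Oplus>i\<in>{0..n}. if 2 ^ i = m then a i else \<zero>)"
      unfolding additive_poly_def
      by (subst UP.coeff_finsum) (auto simp: a intro!: finsum_cong')
    finally show ?thesis .
  qed
  show ?thesis
  proof (rule additive_series_eqI)
    fix k
    show "additive_poly A n a (2 ^ k) = (if k \<le> n then a k else \<zero>)"
    proof (cases "k \<le> n")
      case True
      then have "(\<Oplus>i\<in>{0..n}. if i = k then a i else \<zero>) = a k"
        by (intro add.finprod_singleton_swap) (auto simp: a)
      then show ?thesis using True by (simp add: coeff)
    next
      case False
      then have "(\<Oplus>i\<in>{0..n}. if 2 ^ i = (2 ^ k :: nat) then a i else \<zero>) = (\<Oplus>i\<in>{0..n}. \<zero>)"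
        by (intro finsum_cong') auto
      then show ?thesis using False by (simp add: coeff)
    qed
  next
    fix m :: nat assume "m \<notin> range (\<lambda>k. 2 ^ k)"
    then have "2 ^ i \<noteq> m" for i by auto
    then show "additive_poly A n a m = \<zero>"
      by (simp add: coeff)
  qed (use a in auto)
qed

lemma monom_pow: "c \<in> carrier A \<Longrightarrow> monom (UP A) c n [^]\<^bsub>UP A\<^esub> (k :: nat) = monom (UP A) (c [^] k) (n * k)"
  by (induction k) (simp_all add: add.commute flip: UP.monom_mult)

text \<open>The Frobenius identity in \<open>UP A\<close> raises the polynomial to the power term by
  term, and the exponent \<open>2 ^ i\<close> becomes \<open>2 ^ (i + t)\<close>.\<close>

lemma additive_poly_frobenius:
  assumes b: "\<And>k. b k \<in> carrier A"
  shows "additive_poly A n b [^]\<^bsub>UP A\<^esub> (2 ^ t :: nat) =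
    additive_series A (frob_shift t (\<lambda>k. if k \<le> n then b k else \<zero>))"
proof -
  have "additive_poly A n b [^]\<^bsub>UP A\<^esub> (2 ^ t :: nat) =
      (\<Oplus>\<^bsub>UP A\<^esub>i\<in>{0..n}. monom (UP A) (b i) (2 ^ i) [^]\<^bsub>UP A\<^esub> (2 ^ t :: nat))"
    unfolding additive_poly_def by (rule UP_f2.frobenius_finsum) (auto simp: b)
  also have "\<dots> = (\<Oplus>\<^bsub>UP A\<^esub>i\<in>{0..n}. monom (UP A) (b i [^] (2 ^ t :: nat)) (2 ^ (i + t)))"
    by (rule UP.P.finsum_cong') (auto simp: b monom_pow power_add)
  also have "\<dots> = (\<Oplus>\<^bsub>UP A\<^esub>j\<in>(\<lambda>i. i + t) ` {0..n}. monom (UP A) (frob_shift t b j) (2 ^ j))"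
    by (subst UP.P.finsum_reindex) (auto simp: b frob_shift_def)
  also have "\<dots> = additive_poly A (n + t) (frob_shift t (\<lambda>k. if k \<le> n then b k else \<zero>))"
    unfolding additive_poly_def
  proof (rule UP.P.add.finprod_mono_neutral_cong)
    fix j assume "j \<in> {0..n + t} - (\<lambda>i. i + t) ` {0..n}"
    \<comment> \<open>The shifted indices fill the range from \<open>t\<close> to
      \<open>n + t\<close>; what remains lies below \<open>t\<close>, where
      \<open>frob_shift\<close> is zero by definition.\<close>
    then have "j < t" by (cases "j < t") (auto simp: image_iff dest!: bspec[of _ _ "j - t"])
    then show "monom (UP A) (frob_shift t (\<lambda>k. if k \<le> n then b k else \<zero>) j) (2 ^ j) = \<zero>\<^bsub>UP A\<^esub>"
      by (simp add: frob_shift_def)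
  qed (auto simp: frob_shift_def b)
  also have "\<dots> = additive_series A (\<lambda>k. if k \<le> n + t then frob_shift t (\<lambda>k. if k \<le> n then b k else \<zero>) k else \<zero>)"
    by (rule additive_poly_eq) (simp add: frob_shift_closed b)
  \<comment> \<open>Beyond \<open>n + t\<close> the shifted sequence reads \<open>b\<close> beyond
    its cut at \<open>n\<close>, and a positive power of zero is zero.\<close>
  also have "(\<lambda>k. if k \<le> n + t then frob_shift t (\<lambda>k. if k \<le> n then b k else \<zero>) k else \<zero>) =
      frob_shift t (\<lambda>k. if k \<le> n then b k else \<zero>)"
    by (auto simp: frob_shift_def fun_eq_iff frobenius_zero simp del: nat_pow_zero)
  finally show ?thesis .
qed

text \<open>Evaluation at the inner polynomial is a sum of its powers, weighted by the coefficients
  of the outer one; taking the coefficient at \<open>x^m\<close> yields the sum in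
  \<open>sum_comp_additive\<close>.\<close>

lemma poly_comp_additive:
  assumes "a \<in> truncated_seqs (enat i) A" "b \<in> truncated_seqs (enat j) A"
  shows "poly_comp A (additive_series A a) (additive_series A b) = additive_series A (frob_conv A b a)"
proof -
  have cl: "a k \<in> carrier A" "b k \<in> carrier A" for k
    using assms by (simp_all add: truncated_seqs_def)
  have trunc: "(\<lambda>k. if k \<le> i then a k else \<zero>) = a" "(\<lambda>k. if k \<le> j then b k else \<zero>) = b"
    using assms by (auto simp: truncated_seqs_def)
  have a: "additive_series A a = additive_poly A i a" and b: "additive_series A b = additive_poly A j b"
    by (simp_all add: additive_poly_eq cl trunc)
  let ?p = "additive_poly A i a" and ?q = "additive_poly A j b"
  have p: "?p \<in> carrier (UP A)" and q: "?q \<in> carrier (UP A)"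
    by (simp_all add: additive_poly_closed cl)
  have summand: "monom (UP A) (coeff (UP A) ?p l) 0 \<otimes>\<^bsub>UP A\<^esub> ?q [^]\<^bsub>UP A\<^esub> l \<in> carrier (UP A)" for l
    using p q by simp
  have eval: "poly_comp A ?p ?q = (\<Oplus>\<^bsub>UP A\<^esub>l\<in>{..deg A ?p}. monom (UP A) (coeff (UP A) ?p l) 0 \<otimes>\<^bsub>UP A\<^esub> ?q [^]\<^bsub>UP A\<^esub> l)"
    using p by (simp add: poly_comp_def eval_def)
  have "poly_comp A ?p ?q m = additive_series A (frob_conv A b a) m" for m
  proof -
    have "poly_comp A ?p ?q m = coeff (UP A) (poly_comp A ?p ?q) m"
      unfolding eval by (subst coeff_UP) (use summand in \<open>auto intro!: UP.P.finsum_closed\<close>)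
    also have "\<dots> = (\<Oplus>l\<in>{..deg A ?p}. coeff (UP A) ?p l \<otimes> coeff (UP A) (?q [^]\<^bsub>UP A\<^esub> l) m)"
      unfolding eval
      by (subst UP.coeff_finsum) (use summand p q in \<open>auto simp: UP.monom_mult_is_smult intro!: finsum_cong'\<close>)
    also have "\<dots> = (\<Oplus>l\<in>{..deg A ?p}. additive_series A a l \<otimes> coeff (UP A) (?q [^]\<^bsub>UP A\<^esub> l) m)"
      unfolding coeff_UP[OF p] a ..
    also have "\<dots> = additive_series A (frob_conv A b a) m"
    proof (rule sum_comp_additive)
      fix t
      show "coeff (UP A) (?q [^]\<^bsub>UP A\<^esub> (2 ^ t :: nat)) m = additive_series A (frob_shift t b) m"
        using additive_poly_frobenius[of b j t] coeff_UP[OF UP.P.nat_pow_closed[OF q, of "2 ^ t"]] by (simp add: cl trunc)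
      \<comment> \<open>The sum in \<open>eval\<close> ends at the actual degree, which may be
        smaller than \<open>2 ^ i\<close>; the coefficient of \<open>?p\<close> at
        \<open>2 ^ t\<close> is \<open>a t\<close>.\<close>
      show "a t = \<zero>" if "deg A ?p < 2 ^ t"
        using UP.deg_aboveD[OF that p] unfolding coeff_UP[OF p] by (simp add: additive_series_power cl flip: a)
    qed (use q cl in auto)
    finally show ?thesis .
  qed
  then show ?thesis unfolding a b by blast
qed

section \<open>Composition of additive power series\<close>

text \<open>Coefficients up to \<open>N\<close> of a power depend only on coefficients up to
  \<open>N\<close>. Powers in \<open>fps_ring A\<close> thus become powers of a polynomial, to which
  the Frobenius identity in \<open>UP A\<close> applies.\<close>

lemma fps_pow_eq_UP_pow:
  assumes "\<And>m. m \<le> N \<Longrightarrow> coeff (UP A) p m = g m" "p \<in> carrier (UP A)" "m \<le> N"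
  shows "(g [^]\<^bsub>fps_ring A\<^esub> (i :: nat)) m = coeff (UP A) (p [^]\<^bsub>UP A\<^esub> i) m"
  using assms(3)
proof (induction i arbitrary: m)
  case 0
  then show ?case by (simp add: nat_pow_def fps_ring_def)
next
  case (Suc i)
  have g: "g l = coeff (UP A) p l" if "l \<le> N" for l
    using assms(1)[OF that] by simp
  have "(g [^]\<^bsub>fps_ring A\<^esub> Suc i) m = (\<Oplus>l\<in>{..m}. (g [^]\<^bsub>fps_ring A\<^esub> i) l \<otimes> g (m - l))"
    by (simp add: nat_pow_def fps_ring_def)
  also have "\<dots> = (\<Oplus>l\<in>{..m}. coeff (UP A) (p [^]\<^bsub>UP A\<^esub> i) l \<otimes> coeff (UP A) p (m - l))"
    by (rule finsum_cong') (use Suc assms(2) in \<open>auto simp: g\<close>)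
  finally show ?case using assms(2) by simp
qed

text \<open>For the coefficient at \<open>x^m\<close> the inner series is replaced by the polynomial
  with coefficients \<open>b 0\<close> to \<open>b m\<close>. These suffice, because
  \<open>2 ^ k \<le> m\<close> implies \<open>k \<le> m\<close>.\<close>

lemma series_comp_additive:
  assumes a: "\<And>k. a k \<in> carrier A" and b: "\<And>k. b k \<in> carrier A"
  shows "series_comp A (additive_series A a) (additive_series A b) = additive_series A (frob_conv A b a)"
proof
  fix m
  let ?p = "additive_poly A m b" and ?g = "additive_series A b"
  have p: "?p \<in> carrier (UP A)" by (simp add: additive_poly_closed b)
  have g: "coeff (UP A) ?p l = ?g l" if "l \<le> m" for l
  proof (cases "l \<in> range (\<lambda>k. 2 ^ k :: nat)")
    case True
    then obtain k where k: "l = 2 ^ k" by auto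
    then have "k \<le> m" using that less_exp[of k] by linarith
    then show ?thesis unfolding coeff_UP[OF p] by (simp add: additive_poly_eq additive_series_power k b)
  qed (simp only: coeff_UP[OF p], simp add: additive_poly_eq b additive_series_nonpower)
  note pow = fps_pow_eq_UP_pow[where N = m, OF g p order_refl]
  have "series_comp A (additive_series A a) ?g m = (\<Oplus>i\<in>{..m}. additive_series A a i \<otimes> (?g [^]\<^bsub>fps_ring A\<^esub> i) m)"
    by (simp add: series_comp_def atLeast0AtMost)
  also have "\<dots> = additive_series A (frob_conv A b a) m"
  proof (rule sum_comp_additive)
    fix t
    \<comment> \<open>Cutting \<open>b\<close> after \<open>m\<close> does not change this
      coefficient: if \<open>m = 2 ^ k\<close>, it involves \<open>b\<close> at most at the index
      \<open>k - t\<close>, which is at most \<open>m\<close>; otherwise it is zero.\<close>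
    have "additive_series A (frob_shift t (\<lambda>k. if k \<le> m then b k else \<zero>)) m = additive_series A (frob_shift t b) m"
    proof (cases "m \<in> range (\<lambda>k. 2 ^ k :: nat)")
      case True
      then obtain k where k: "m = 2 ^ k" by auto
      then have "k - t \<le> m" using less_exp[of k] by linarith
      then show ?thesis
        using b by (simp add: k additive_series_power frob_shift_closed) (simp add: frob_shift_def)
    qed (simp add: additive_series_nonpower)
    then show "(?g [^]\<^bsub>fps_ring A\<^esub> (2 ^ t :: nat)) m = additive_series A (frob_shift t b) m"
      using pow[of "2 ^ t"] additive_poly_frobenius[of b m t, OF b] coeff_UP[OF UP.P.nat_pow_closed[OF p, of "2 ^ t"]] by simp
  qed (use p a b pow in auto)
  finally show "series_comp A (additive_series A a) ?g m = additive_series A (frob_conv A b a) m" .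
qed

end

subsection \<open>Functors of additive series\<close>

lemma O_functor_monoid_functor:
  fixes F :: "('a, 'x) graded_monoid_functor"
  assumes "graded_monoid_functor F"
  shows "monoid_functor (O_functor F)"
proof -
  interpret F: graded_monoid_functor F by fact
  show ?thesis
  proof (rule monoid_functor.intro)
    fix A :: "'a ring" assume "f2_algebra A"
    then interpret graded_monoid "gobj F A" by (rule F.obj)
    show "monoid (mobj (O_functor F) A)"
      by (rule monoidI)
        (auto simp: O_functor_def O_monoid_def gone_closed gmult_closed gmult_assoc gone_left gone_right add.assoc)
  next
    fix A B :: "'a ring" and h assume "f2_algebra A" "f2_algebra B" "h \<in> alg_hom A B"
    then have "gmap F A B h \<in> graded_hom (gobj F A) (gobj F B)" by (rule F.map)
    then show "mmap (O_functor F) A B h \<in> unital_hom (mobj (O_functor F) A) (mobj (O_functor F) B)"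
      by (auto simp: graded_hom_def unital_hom_def hom_def O_functor_def O_monoid_def)
  qed (auto simp: O_functor_def O_monoid_def F.map_id F.map_comp)
qed

text \<open>Each degree of \<open>gamma_functor G\<close> is a copy of \<open>G\<close>, so the
  graded laws specialise. The functor laws of \<open>Minf\<close> are obtained in this way.\<close>

lemma monoid_functor_of_gamma:
  fixes G :: "('a, 'x) monoid_functor"
  assumes "graded_monoid_functor (gamma_functor G)"
  shows "monoid_functor G"
proof -
  interpret G: graded_monoid_functor "gamma_functor G" by fact
  show ?thesis
  proof (rule monoid_functor.intro)
    fix A :: "'a ring" assume "f2_algebra A"
    then interpret graded_monoid "gamma_monoid (mobj G A)"
      using G.obj[of A] by (simp add: gamma_functor_def)
    show "monoid (mobj G A)"
      using gone_closed gmult_closed gmult_assoc gone_left gone_right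
      by (intro monoidI) (auto simp: gamma_monoid_def)
  next
    fix A B :: "'a ring" and h assume "f2_algebra A" "f2_algebra B" "h \<in> alg_hom A B"
    then have "gmap (gamma_functor G) A B h \<in> graded_hom (gobj (gamma_functor G) A) (gobj (gamma_functor G) B)"
      by (rule G.map)
    then show "mmap G A B h \<in> unital_hom (mobj G A) (mobj G B)"
      by (auto simp: graded_hom_def unital_hom_def hom_def gamma_functor_def gamma_monoid_def)
  next
    fix A :: "'a ring" and x assume "f2_algebra A" "x \<in> carrier (mobj G A)"
    then show "mmap G A A (\<lambda>a \<in> carrier A. a) x = x"
      using G.map_id[of A x 0] by (simp add: gamma_functor_def gamma_monoid_def)
  next
    fix A B C :: "'a ring" and h k x
    assume "f2_algebra A" "f2_algebra B" "f2_algebra C" "h \<in> alg_hom A B" "k \<in> alg_hom B C"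
      "x \<in> carrier (mobj G A)"
    then show "mmap G A C (compose (carrier A) k h) x = mmap G B C k (mmap G A B h x)"
      using G.map_comp[of A B C h k x 0] by (simp add: gamma_functor_def gamma_monoid_def)
  qed
qed

text \<open>Objectwise this is \<open>O_gamma_adjunction\<close>, and naturality is checked degree
  by degree. It reduces the ungraded claim of the theorem to the graded one.\<close>

lemma monoid_functor_morphism_adjoint:
  assumes "graded_monoid_functor_morphism F (gamma_functor G) (adjoint_morphism \<tau>)"
  shows "monoid_functor_morphism (O_functor F) G \<tau>"
  unfolding monoid_functor_morphism_def
proof (intro conjI allI impI ballI)
  note * = assms[unfolded graded_monoid_functor_morphism_def]
  show "monoid_functor (O_functor F)" using * O_functor_monoid_functor by blast
  show "monoid_functor G" using * monoid_functor_of_gamma by blast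
  show "\<tau> A \<in> unital_hom (mobj (O_functor F) A) (mobj G A)" if "f2_algebra A" for A
    using * that O_gamma_adjunction[of "\<tau> A" "gobj F A" "mobj G A"]
    by (simp add: adjoint_morphism_def gamma_functor_def O_functor_def)
  show "\<tau> B (mmap (O_functor F) A B h x) = mmap G A B h (\<tau> A x)"
    if "f2_algebra A" "f2_algebra B" "h \<in> alg_hom A B" "x \<in> carrier (mobj (O_functor F) A)" for A B h x
    using * that by (auto simp: adjoint_morphism_def gamma_functor_def O_functor_def O_monoid_def)
qed

text \<open>Both sides of each law in \<open>H\<close> have the same image under the injective
  \<open>\<rho>\<close>, where the law holds in \<open>F\<close>. With \<open>H\<close> a
  represented functor, its laws come from composition of series.\<close>

lemma graded_monoid_functor_transport:
  fixes F :: "('a, 'x) graded_monoid_functor" and H :: "('a, 'y) graded_monoid_functor"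
  assumes F: "graded_monoid_functor F"
    and closed: "\<And>A n x. f2_algebra A \<Longrightarrow> x \<in> gcarrier (gobj H A) n \<Longrightarrow> \<rho> A n x \<in> gcarrier (gobj F A) n"
    and inj: "\<And>A n. f2_algebra A \<Longrightarrow> inj_on (\<rho> A n) (gcarrier (gobj H A) n)"
    and one_closed: "\<And>A. f2_algebra A \<Longrightarrow> gone (gobj H A) \<in> gcarrier (gobj H A) 0"
    and one: "\<And>A. f2_algebra A \<Longrightarrow> \<rho> A 0 (gone (gobj H A)) = gone (gobj F A)"
    and mult_closed: "\<And>A i j x y. f2_algebra A \<Longrightarrow> x \<in> gcarrier (gobj H A) i \<Longrightarrow> y \<in> gcarrier (gobj H A) j \<Longrightarrow>
      gmult (gobj H A) i j x y \<in> gcarrier (gobj H A) (i + j)"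
    and mult: "\<And>A i j x y. f2_algebra A \<Longrightarrow> x \<in> gcarrier (gobj H A) i \<Longrightarrow> y \<in> gcarrier (gobj H A) j \<Longrightarrow>
      \<rho> A (i + j) (gmult (gobj H A) i j x y) = gmult (gobj F A) i j (\<rho> A i x) (\<rho> A j y)"
    and map_closed: "\<And>A B h n x. f2_algebra A \<Longrightarrow> f2_algebra B \<Longrightarrow> h \<in> alg_hom A B \<Longrightarrow>
      x \<in> gcarrier (gobj H A) n \<Longrightarrow> gmap H A B h n x \<in> gcarrier (gobj H B) n"
    and natural: "\<And>A B h n x. f2_algebra A \<Longrightarrow> f2_algebra B \<Longrightarrow> h \<in> alg_hom A B \<Longrightarrow>
      x \<in> gcarrier (gobj H A) n \<Longrightarrow> \<rho> B n (gmap H A B h n x) = gmap F A B h n (\<rho> A n x)"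
  shows "graded_monoid_functor_morphism H F \<rho>"
proof -
  interpret F: graded_monoid_functor F by fact
  have eqI: "x = y" if "f2_algebra A" "x \<in> gcarrier (gobj H A) n" "y \<in> gcarrier (gobj H A) n" "\<rho> A n x = \<rho> A n y"
    for A n x y
    using inj_onD[OF inj[OF that(1)] that(4,2,3)] .
  have id: "(\<lambda>a \<in> carrier A. a) \<in> alg_hom A A" if "f2_algebra A" for A
  proof -
    interpret f2_algebra A by fact
    show ?thesis by (auto simp: alg_hom_def intro!: ring_hom_memI)
  qed
  have comp: "compose (carrier A) k h \<in> alg_hom A C"
    if "f2_algebra A" "h \<in> alg_hom A B" "k \<in> alg_hom B C" for A B C h k
    using that by (intro alg_hom_compose) (auto simp: alg_hom_def f2_algebra_def cring_def)
  have map: "gmap F A B h \<in> graded_hom (gobj F A) (gobj F B)" if "f2_algebra A" "f2_algebra B" "h \<in> alg_hom A B" for A B h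
    using that by (rule F.map)
  have "graded_monoid_functor H"
  proof (rule graded_monoid_functor.intro)
    fix A :: "'a ring" assume A: "f2_algebra A"
    then interpret graded_monoid "gobj F A" by (rule F.obj)
    show "graded_monoid (gobj H A)"
    proof (rule graded_monoid.intro)
      fix x y z i j k
      assume xyz: "x \<in> gcarrier (gobj H A) i" "y \<in> gcarrier (gobj H A) j" "z \<in> gcarrier (gobj H A) k"
      show "gmult (gobj H A) (i + j) k (gmult (gobj H A) i j x y) z =
          gmult (gobj H A) i (j + k) x (gmult (gobj H A) j k y z)"
        \<comment> \<open>The two bracketings lie in degrees \<open>i + j + k\<close> and
          \<open>i + (j + k)\<close>; folding \<open>add.assoc\<close> puts both in the degree in
          which injectivity is applied.\<close>
        using mult_closed[OF A mult_closed[OF A xyz(1,2)] xyz(3)]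
          mult_closed[OF A xyz(1) mult_closed[OF A xyz(2,3)], folded add.assoc]
          mult[OF A mult_closed[OF A xyz(1,2)] xyz(3)]
          mult[OF A xyz(1) mult_closed[OF A xyz(2,3)], folded add.assoc]
        by (intro eqI[OF A, of _ "i + j + k"]) (simp_all add: mult A xyz gmult_assoc closed)
    next
      fix x i assume x: "x \<in> gcarrier (gobj H A) i"
      show "gmult (gobj H A) 0 i (gone (gobj H A)) x = x"
        using mult_closed[OF A one_closed[OF A] x] mult[OF A one_closed[OF A] x] x
        by (intro eqI[OF A, of _ i]) (simp_all add: one closed gone_left A)
      show "gmult (gobj H A) i 0 x (gone (gobj H A)) = x"
        using mult_closed[OF A x one_closed[OF A]] mult[OF A x one_closed[OF A]] x
        by (intro eqI[OF A, of _ i]) (simp_all add: one closed gone_right A)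
    qed (simp_all add: one_closed mult_closed A)
  next
    fix A B :: "'a ring" and h assume AB: "f2_algebra A" "f2_algebra B" "h \<in> alg_hom A B"
    note m = map[OF AB, unfolded graded_hom_def]
    show "gmap H A B h \<in> graded_hom (gobj H A) (gobj H B)"
      unfolding graded_hom_def
    proof (intro CollectI conjI allI ballI)
      fix i j x y assume xy: "x \<in> gcarrier (gobj H A) i" "y \<in> gcarrier (gobj H A) j"
      show "gmap H A B h (i + j) (gmult (gobj H A) i j x y) = gmult (gobj H B) i j (gmap H A B h i x) (gmap H A B h j y)"
        using m xy AB by (intro eqI[OF AB(2), of _ "i + j"]) (simp_all add: natural mult mult_closed map_closed closed)
    next
      show "gmap H A B h 0 (gone (gobj H A)) = gone (gobj H B)"
        using m AB by (intro eqI[OF AB(2), of _ 0]) (simp_all add: natural one one_closed map_closed closed)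
    qed (simp add: map_closed AB)
  next
    fix A :: "'a ring" and x n assume A: "f2_algebra A" and x: "x \<in> gcarrier (gobj H A) n"
    show "gmap H A A (\<lambda>a \<in> carrier A. a) n x = x"
      using A x id[OF A] by (intro eqI[OF A _ x]) (simp_all add: natural map_closed closed F.map_id)
  next
    fix A B C :: "'a ring" and h k x n
    assume *: "f2_algebra A" "f2_algebra B" "f2_algebra C" "h \<in> alg_hom A B" "k \<in> alg_hom B C"
      and x: "x \<in> gcarrier (gobj H A) n"
    show "gmap H A C (compose (carrier A) k h) n x = gmap H B C k n (gmap H A B h n x)"
      using * x comp[OF *(1,4,5)]
      by (intro eqI[OF *(3), of _ n]) (simp_all add: natural map_closed closed F.map_comp[OF *])
  qed
  then show ?thesis
    unfolding graded_monoid_functor_morphism_def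
    using F closed one mult natural by (auto simp: graded_hom_def)
qed

text \<open>The common description of \<^const>\<open>Mplus\<close> (with \<open>e n = n\<close>) and of \<open>gamma_functor Minf\<close> (with \<open>e n = \<infinity>\<close>).\<close>

locale additive_series_functor =
  fixes F :: "('a, nat \<Rightarrow> 'a) graded_monoid_functor" and e :: "nat \<Rightarrow> enat"
  assumes e_add: "e (i + j) = e i + e j"
    and carrier_eq: "f2_algebra A \<Longrightarrow> gcarrier (gobj F A) n = additive_series A ` truncated_seqs (e n) A"
    and mult_eq: "f2_algebra A \<Longrightarrow> a \<in> truncated_seqs (e i) A \<Longrightarrow> b \<in> truncated_seqs (e j) A \<Longrightarrow>
      gmult (gobj F A) i j (additive_series A a) (additive_series A b) = additive_series A (frob_conv A b a)"
    and one_eq: "f2_algebra A \<Longrightarrow> gone (gobj F A) = additive_series A (unit_seq A)"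
    and map_eq: "f2_algebra A \<Longrightarrow> f2_algebra B \<Longrightarrow> h \<in> alg_hom A B \<Longrightarrow> a \<in> truncated_seqs (e n) A \<Longrightarrow>
      gmap F A B h n (additive_series A a) = additive_series B (\<lambda>k. h (a k))"
begin

text \<open>The outer series comes first in \<open>gmult\<close> and second in
  \<open>frob_conv\<close>; commutativity of addition reconciles the degrees.\<close>

lemma frob_conv_seq:
  "f2_algebra A \<Longrightarrow> a \<in> truncated_seqs (e i) A \<Longrightarrow> b \<in> truncated_seqs (e j) A \<Longrightarrow>
    frob_conv A b a \<in> truncated_seqs (e (i + j)) A"
  using frob_conv_truncated_seqs[of A b "e j" a "e i"] by (simp add: e_add add.commute)

lemma hom_seq:
  "f2_algebra A \<Longrightarrow> f2_algebra B \<Longrightarrow> h \<in> alg_hom A B \<Longrightarrow> a \<in> truncated_seqs (e n) A \<Longrightarrow>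
    (\<lambda>k. h (a k)) \<in> truncated_seqs (e n) B"
  by (rule hom_truncated_seqs[where A = A]) (auto simp: alg_hom_def f2_algebra_def)

text \<open>Every element is the series of a truncated sequence, so the monoid laws become
  \<open>frob_conv_assoc\<close> and the unit laws, and compatibility with morphisms becomes
  \<open>hom_frob_conv\<close>.\<close>

lemma is_graded_monoid_functor: "graded_monoid_functor F"
proof (rule graded_monoid_functor.intro)
  fix A :: "'a ring" assume A: "f2_algebra A"
  interpret f2_algebra_ring A using A by (simp add: f2_algebra_ring_def)
  have cl: "\<And>k. a k \<in> carrier A" if "a \<in> truncated_seqs (e i) A" for a i
    using that by (simp add: truncated_seqs_def)
  show "graded_monoid (gobj F A)"
  proof (rule graded_monoid.intro)
    fix x y z i j k
    assume "x \<in> gcarrier (gobj F A) i" "y \<in> gcarrier (gobj F A) j" "z \<in> gcarrier (gobj F A) k"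
    then show "gmult (gobj F A) (i + j) k (gmult (gobj F A) i j x y) z =
        gmult (gobj F A) i (j + k) x (gmult (gobj F A) j k y z)"
      using A by (auto simp: carrier_eq mult_eq frob_conv_seq frob_conv_assoc cl)
  qed (use A in \<open>auto simp: carrier_eq mult_eq one_eq unit_seq_truncated frob_conv_seq frob_conv_unit_left
      frob_conv_unit_right cl\<close>)
next
  fix A B :: "'a ring" and h
  assume *: "f2_algebra A" "f2_algebra B" "h \<in> alg_hom A B"
  interpret ring_hom_cring A B h
    using * by (simp add: ring_hom_cring_def ring_hom_cring_axioms_def f2_algebra_def alg_hom_def)
  have unit: "(\<lambda>k. h (unit_seq A k)) = unit_seq B" by (auto simp: unit_seq_def)
  have conv: "(\<lambda>k. h (frob_conv A b a k)) = frob_conv B (\<lambda>k. h (b k)) (\<lambda>k. h (a k))"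
    if "a \<in> truncated_seqs (e i) A" "b \<in> truncated_seqs (e j) A" for a b i j
    using hom_frob_conv[OF *(1,2) homh, of b a] that by (auto simp: truncated_seqs_def comp_def)
  show "gmap F A B h \<in> graded_hom (gobj F A) (gobj F B)"
    using * by (auto simp: graded_hom_def carrier_eq mult_eq one_eq map_eq frob_conv_seq hom_seq unit conv
        unit_seq_truncated)
next
  fix A :: "'a ring" and x n assume A: "f2_algebra A" and x: "x \<in> gcarrier (gobj F A) n"
  interpret f2_algebra_ring A using A by (simp add: f2_algebra_ring_def)
  have id: "(\<lambda>a \<in> carrier A. a) \<in> alg_hom A A"
    by (auto simp: alg_hom_def intro!: ring_hom_memI)
  obtain a where a: "a \<in> truncated_seqs (e n) A" "x = additive_series A a"
    using x A by (auto simp: carrier_eq)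
  then show "gmap F A A (\<lambda>a \<in> carrier A. a) n x = x"
    using A id by (simp add: map_eq truncated_seqs_def)
next
  fix A B C :: "'a ring" and h k x n
  assume *: "f2_algebra A" "f2_algebra B" "f2_algebra C" "h \<in> alg_hom A B" "k \<in> alg_hom B C"
    and x: "x \<in> gcarrier (gobj F A) n"
  obtain a where a: "a \<in> truncated_seqs (e n) A" "x = additive_series A a"
    using x * by (auto simp: carrier_eq)
  have "compose (carrier A) k h \<in> alg_hom A C"
    using * by (intro alg_hom_compose) (auto simp: alg_hom_def f2_algebra_def cring_def)
  then show "gmap F A C (compose (carrier A) k h) n x = gmap F B C k n (gmap F A B h n x)"
    using * a hom_seq[OF *(1,2,4) a(1)] by (simp add: map_eq compose_def truncated_seqs_def)
qed

text \<open>Values on generators determine a morphism, and \<open>f2_poly_hom\<close> realises every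
  truncated sequence; products match by \<open>hom_truncated_comult_gen\<close>.
  \<open>\<rho>\<close> is prescribed on morphisms only, which allows both
  \<open>Bplus_universal\<close> and \<open>Steenrod_universal\<close>.\<close>

lemma Hom_functor_iso:
  assumes \<rho>: "\<And>A n \<phi>. f2_algebra A \<Longrightarrow> \<phi> \<in> alg_hom (truncated_Steenrod (e n)) A \<Longrightarrow>
    \<rho> A n \<phi> = additive_series A (\<lambda>k. \<phi> (truncated_gen (e n) k))"
  shows "graded_monoid_functor_iso (Hom_functor (truncated_bialgebra e)) F \<rho>"
proof -
  let ?H = "Hom_functor (truncated_bialgebra e) :: ('a, f2_mpoly \<Rightarrow> 'a) graded_monoid_functor"
  note S = truncated_Steenrod_f2_algebra
  have H: "gcarrier (gobj ?H A) n = alg_hom (truncated_Steenrod (e n)) A"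
    "gmult (gobj ?H A) i j \<phi> \<psi> = compose (carrier (truncated_Steenrod (e (j + i))))
      (tensor_lift (truncated_Steenrod (e j)) (truncated_Steenrod (e i)) A \<psi> \<phi>) (truncated_comult (e j) (e i))"
    "gone (gobj ?H A) = compose (carrier (truncated_Steenrod (e 0))) (f2_unit A) (truncated_counit (e 0))"
    "gmap ?H A B h n \<phi> = compose (carrier (truncated_Steenrod (e n))) h \<phi>" for A B h n i j \<phi> \<psi>
    by (simp_all add: Hom_functor_def truncated_bialgebra_simps)
  have S_ring: "ring (truncated_Steenrod n)" for n
    using S by (simp add: f2_algebra_def cring_def)
  have seq: "(\<lambda>k. \<phi> (truncated_gen (e n) k)) \<in> truncated_seqs (e n) A"
    if "f2_algebra A" "\<phi> \<in> alg_hom (truncated_Steenrod (e n)) A" for A :: "'a ring" and n \<phi>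
    by (rule hom_truncated_seqs[OF _ _ alg_hom_ring_hom[OF that(2)] truncated_gen_seq])
      (use that S in \<open>auto simp: f2_algebra_def\<close>)
  have eqI: "\<phi> = \<psi>"
    if A: "f2_algebra A" and hom: "\<phi> \<in> alg_hom (truncated_Steenrod (e n)) A" "\<psi> \<in> alg_hom (truncated_Steenrod (e n)) A"
      and eq: "\<rho> A n \<phi> = \<rho> A n \<psi>" for A n \<phi> \<psi>
  \<comment> \<open>Elements of \<open>alg_hom\<close> are extensional, which turns agreement on the
    carrier into equality of functions.\<close>
  proof (rule extensionalityI[where A = "carrier (truncated_Steenrod (e n))"])
    interpret f2_algebra_ring A using A by (simp add: f2_algebra_ring_def)
    have "(\<lambda>k. \<phi> (truncated_gen (e n) k)) = (\<lambda>k. \<psi> (truncated_gen (e n) k))"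
      using eq unfolding \<rho>[OF A hom(1)] \<rho>[OF A hom(2)]
      by (rule additive_series_inj) (rule truncated_seqs_closed[OF seq[OF A]], rule hom)+
    then show "\<phi> x = \<psi> x" if "x \<in> carrier (truncated_Steenrod (e n))" for x
      by (intro truncated_Steenrod_hom_eqI[OF is_cring alg_hom_ring_hom[OF hom(1)] alg_hom_ring_hom[OF hom(2)] _ that])
        (rule fun_cong)
  qed (use hom in \<open>simp_all add: alg_hom_def\<close>)
  have surj: "\<exists>\<phi>\<in>alg_hom (truncated_Steenrod (e n)) A. \<rho> A n \<phi> = x"
    if A: "f2_algebra A" and x: "x \<in> gcarrier (gobj F A) n" for A n x
  proof -
    obtain a where a: "a \<in> truncated_seqs (e n) A" "x = additive_series A a"
      using x A by (auto simp: carrier_eq)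
    let ?\<phi> = "f2_poly_hom (truncated_gens (e n)) A a"
    have "?\<phi> \<in> alg_hom (truncated_Steenrod (e n)) A"
      by (rule truncated_Steenrod_hom[OF A truncated_seqs_closed[OF a(1)]])
    moreover from this have "\<rho> A n ?\<phi> = x"
      using A a by (simp add: \<rho> truncated_Steenrod_hom_gen)
    ultimately show ?thesis by blast
  qed
  have morphism: "graded_monoid_functor_morphism ?H F \<rho>"
  proof (rule graded_monoid_functor_transport[OF is_graded_monoid_functor], unfold H)
    fix A :: "'a ring" assume A: "f2_algebra A"
    interpret f2_algebra A by fact
    show "\<rho> A n \<phi> \<in> gcarrier (gobj F A) n" if "\<phi> \<in> alg_hom (truncated_Steenrod (e n)) A" for n \<phi>
      using seq[OF A that] A that by (simp add: carrier_eq \<rho>)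
    show "inj_on (\<rho> A n) (alg_hom (truncated_Steenrod (e n)) A)" for n
      by (rule inj_onI) (rule eqI[OF A])
    show one: "compose (carrier (truncated_Steenrod (e 0))) (f2_unit A) (truncated_counit (e 0))
        \<in> alg_hom (truncated_Steenrod (e 0)) A"
      by (rule alg_hom_compose[OF S_ring alg_hom_ring_hom[OF truncated_counit_hom] f2_unit_hom])
    have "f2_unit A (unit_seq F2 k) = unit_seq A k" for k
      by (simp add: unit_seq_def f2_unit_def) (simp add: F2_def)
    then show "\<rho> A 0 (compose (carrier (truncated_Steenrod (e 0))) (f2_unit A) (truncated_counit (e 0))) = gone (gobj F A)"
      using A by (simp add: \<rho>[OF A one] one_eq compose_eq truncated_gen_closed truncated_counit_truncated_gen)
    fix i j \<phi> \<psi>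
    assume hom: "\<phi> \<in> alg_hom (truncated_Steenrod (e i)) A" "\<psi> \<in> alg_hom (truncated_Steenrod (e j)) A"
    let ?l = "tensor_lift (truncated_Steenrod (e j)) (truncated_Steenrod (e i)) A \<psi> \<phi>"
    have lift: "?l \<in> ring_hom (tensor (truncated_Steenrod (e j)) (truncated_Steenrod (e i))) A"
      by (rule alg_hom_ring_hom[OF tensor_lift_alg_hom[OF S S A alg_hom_ring_hom[OF hom(2)] alg_hom_ring_hom[OF hom(1)]]])
    have comult: "truncated_comult (e j) (e i) \<in> ring_hom (truncated_Steenrod (e (i + j)))
        (tensor (truncated_Steenrod (e j)) (truncated_Steenrod (e i)))"
      using alg_hom_ring_hom[OF truncated_comult_hom[of "e j" "e i"]] by (simp add: e_add add.commute)
    show prod: "compose (carrier (truncated_Steenrod (e (j + i)))) ?l (truncated_comult (e j) (e i))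
        \<in> alg_hom (truncated_Steenrod (e (i + j))) A"
      using alg_hom_compose[OF S_ring comult lift] by (simp add: add.commute)
    \<comment> \<open>\<open>\<psi>\<close> acts on the first tensor factor and so supplies the
      inner sequence, matching the second argument of \<open>gmult\<close>.\<close>
    have "?l (truncated_comult (e j) (e i) (truncated_gen (e (i + j)) k)) =
        frob_conv A (\<lambda>k. \<psi> (truncated_gen (e j) k)) (\<lambda>k. \<phi> (truncated_gen (e i) k)) k" for k
    proof -
      have "?l (truncated_comult_gen (e j) (e i) k) =
          frob_conv A (\<lambda>k. \<psi> (truncated_gen (e j) k)) (\<lambda>k. \<phi> (truncated_gen (e i) k)) k"
        by (rule hom_truncated_comult_gen[OF A lift])
          (use hom one_closed in \<open>simp_all add: tensor_lift_pure_tensor S A alg_hom_ring_hom truncated_gen_closed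
            S_ring[THEN ring.ring_simprules(6)] ring_hom_one[OF alg_hom_ring_hom[OF hom(1)]]
            ring_hom_one[OF alg_hom_ring_hom[OF hom(2)]] ring_hom_closed[OF alg_hom_ring_hom[OF hom(1)]]
            ring_hom_closed[OF alg_hom_ring_hom[OF hom(2)]]\<close>)
      then show ?thesis
        using truncated_comult_truncated_gen[of "e j" "e i" k] by (simp add: e_add add.commute)
    qed
    then show "\<rho> A (i + j) (compose (carrier (truncated_Steenrod (e (j + i)))) ?l (truncated_comult (e j) (e i))) =
        gmult (gobj F A) i j (\<rho> A i \<phi>) (\<rho> A j \<psi>)"
      unfolding \<rho>[OF A prod] using hom
      by (simp add: \<rho>[OF A] mult_eq[OF A] seq[OF A] compose_eq truncated_gen_closed add.commute[of j i])
  next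
    fix A B :: "'a ring" and h n \<phi>
    assume *: "f2_algebra A" "f2_algebra B" "h \<in> alg_hom A B" and hom: "\<phi> \<in> alg_hom (truncated_Steenrod (e n)) A"
    show comp: "compose (carrier (truncated_Steenrod (e n))) h \<phi> \<in> alg_hom (truncated_Steenrod (e n)) B"
      by (rule alg_hom_compose[OF S_ring alg_hom_ring_hom[OF hom] alg_hom_ring_hom[OF *(3)]])
    show "\<rho> B n (compose (carrier (truncated_Steenrod (e n))) h \<phi>) = gmap F A B h n (\<rho> A n \<phi>)"
      using * hom by (simp add: \<rho>[OF *(2) comp] \<rho>[OF *(1)] map_eq seq compose_eq truncated_gen_closed)
  qed
  then show ?thesis
    unfolding graded_monoid_functor_iso_def
  proof (intro conjI allI impI)
    fix A :: "'a ring" and n assume A: "f2_algebra A"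
    have "\<rho> A n ` gcarrier (gobj ?H A) n \<subseteq> gcarrier (gobj F A) n"
      using morphism A by (auto simp: graded_monoid_functor_morphism_def graded_hom_def)
    moreover have "gcarrier (gobj F A) n \<subseteq> \<rho> A n ` gcarrier (gobj ?H A) n"
      unfolding H using surj[OF A] by blast
    moreover have "inj_on (\<rho> A n) (gcarrier (gobj ?H A) n)"
      unfolding H by (rule inj_onI) (rule eqI[OF A])
    ultimately show "bij_betw (\<rho> A n) (gcarrier (gobj ?H A) n) (gcarrier (gobj F A) n)"
      by (simp add: bij_betw_def)
  qed
qed

end

section \<open>Additive polynomials and additive series as instances, and their comparison\<close>

lemma Mplus_additive: "additive_series_functor (Mplus :: ('a, nat \<Rightarrow> 'a) graded_monoid_functor) enat"
proof
  fix A :: "'a ring" assume A: "f2_algebra A"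
  interpret f2_algebra_ring A using A by (simp add: f2_algebra_ring_def)
  show "gcarrier (gobj Mplus A) n = additive_series A ` truncated_seqs (enat n) A" for n
  proof (rule Set.set_eqI)
    fix f
    show "f \<in> gcarrier (gobj Mplus A) n \<longleftrightarrow> f \<in> additive_series A ` truncated_seqs (enat n) A"
    proof
      assume "f \<in> gcarrier (gobj Mplus A) n"
      then obtain a where "f = additive_poly A n a" "a \<in> {0..n} \<rightarrow> carrier A" "a 0 = \<one>\<^bsub>A\<^esub>"
        by (auto simp: Mplus_def)
      then show "f \<in> additive_series A ` truncated_seqs (enat n) A"
        \<comment> \<open>The definition of \<open>Mplus\<close> controls \<open>a\<close> on
          \<open>{0..n}\<close> only; the witness extends it by zero.\<close>
        by (intro image_eqI[where x = "\<lambda>k. if k \<le> n then a k else \<zero>\<^bsub>A\<^esub>"])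
          (auto simp: additive_poly_eq Pi_iff truncated_seqs_def)
    next
      assume "f \<in> additive_series A ` truncated_seqs (enat n) A"
      then obtain a where a: "f = additive_series A a" "a \<in> truncated_seqs (enat n) A" by blast
      have "(\<lambda>k. if k \<le> n then a k else \<zero>\<^bsub>A\<^esub>) = a" using a(2) by (auto simp: truncated_seqs_def)
      then have "f = additive_poly A n a" using a by (simp add: additive_poly_eq truncated_seqs_def)
      then show "f \<in> gcarrier (gobj Mplus A) n" using a(2) by (auto simp: Mplus_def truncated_seqs_def)
    qed
  qed
  show "gmult (gobj Mplus A) i j (additive_series A a) (additive_series A b) = additive_series A (frob_conv A b a)"
    if "a \<in> truncated_seqs (enat i) A" "b \<in> truncated_seqs (enat j) A" for a b i j
    using poly_comp_additive[OF that] by (simp add: Mplus_def)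
  show "gone (gobj Mplus A) = additive_series A (unit_seq A)"
    by (simp add: Mplus_def additive_series_unit UP_def)
next
  fix A B :: "'a ring" and h a n
  assume *: "f2_algebra A" "f2_algebra B" "h \<in> alg_hom A B" "a \<in> truncated_seqs (enat n) A"
  interpret f2_algebra_ring A using * by (simp add: f2_algebra_ring_def)
  have cl: "a k \<in> carrier A" for k using *(4) by (rule truncated_seqs_closed)
  have "(\<lambda>k. if k \<le> n then a k else \<zero>\<^bsub>A\<^esub>) = a" using *(4) by (auto simp: truncated_seqs_def)
  \<comment> \<open>\<open>gmap Mplus\<close> reads coefficients through \<open>coeff\<close>, which
    returns its argument unchanged only once this argument is known to be a polynomial.\<close>
  then have "coeff (UP A) (additive_series A a) = additive_series A a"
    using coeff_UP[OF additive_poly_closed[of n a]] by (simp add: additive_poly_eq cl)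
  then show "gmap Mplus A B h n (additive_series A a) = additive_series B (\<lambda>k. h (a k))"
    using hom_additive_series[of A B h a] * cl
    by (simp add: Mplus_def alg_hom_def f2_algebra_def fun_eq_iff)
qed simp

lemma gamma_Minf_additive:
  "additive_series_functor (gamma_functor (Minf :: ('a, nat \<Rightarrow> 'a) monoid_functor)) (\<lambda>_. \<infinity>)"
proof
  fix A :: "'a ring" assume A: "f2_algebra A"
  interpret f2_algebra_ring A using A by (simp add: f2_algebra_ring_def)
  show "gcarrier (gobj (gamma_functor Minf) A) n = additive_series A ` truncated_seqs \<infinity> A" for n
    by (auto simp: gamma_functor_def gamma_monoid_def Minf_def truncated_seqs_def Pi_iff)
  show "gmult (gobj (gamma_functor Minf) A) i j (additive_series A a) (additive_series A b) =
      additive_series A (frob_conv A b a)"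
    if "a \<in> truncated_seqs \<infinity> A" "b \<in> truncated_seqs \<infinity> A" for a b i j
    using that series_comp_additive[of a b]
    by (simp add: gamma_functor_def gamma_monoid_def Minf_def truncated_seqs_def)
  show "gone (gobj (gamma_functor Minf) A) = additive_series A (unit_seq A)"
    by (simp add: gamma_functor_def gamma_monoid_def Minf_def additive_series_unit)
next
  fix A B :: "'a ring" and h a n
  assume "f2_algebra A" "f2_algebra B" "h \<in> alg_hom A B" "a \<in> truncated_seqs \<infinity> A"
  then show "gmap (gamma_functor Minf) A B h n (additive_series A a) = additive_series B (\<lambda>k. h (a k))"
    using hom_additive_series[of A B h a]
    by (simp add: gamma_functor_def Minf_def alg_hom_def f2_algebra_def fun_eq_iff truncated_seqs_def)
qed simp

lemma adjoint_poly_to_series: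
  assumes "f2_algebra A" "x \<in> gcarrier (gobj Mplus A) n"
  shows "adjoint_morphism poly_to_series A n x = x"
proof -
  interpret f2_algebra_ring A using assms by (simp add: f2_algebra_ring_def)
  have "x \<in> carrier (UP A)"
    using assms(2) by (auto simp: Mplus_def intro!: additive_poly_closed)
  then show ?thesis by (simp add: adjoint_morphism_def poly_to_series_def coeff_UP)
qed

text \<open>The map is the identity on carriers. Products, units and functorial maps on both sides
  are given by the same formulas in coefficient sequences, so they agree on polynomials.\<close>

lemma poly_to_series_graded_morphism:
  "graded_monoid_functor_morphism (Mplus :: ('a, nat \<Rightarrow> 'a) graded_monoid_functor)
    (gamma_functor Minf) (adjoint_morphism poly_to_series)"
proof -
  let ?M = "Mplus :: ('a, nat \<Rightarrow> 'a) graded_monoid_functor"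
  let ?N = "gamma_functor (Minf :: ('a, nat \<Rightarrow> 'a) monoid_functor)"
  interpret M: additive_series_functor ?M enat by (rule Mplus_additive)
  interpret N: additive_series_functor ?N "\<lambda>_. \<infinity>" by (rule gamma_Minf_additive)
  interpret MF: graded_monoid_functor ?M by (rule M.is_graded_monoid_functor)
  have trunc: "a \<in> truncated_seqs \<infinity> A" if "a \<in> truncated_seqs (enat n) A" for a A n
    using that by (simp add: truncated_seqs_def)
  have eq: "gmult (gobj ?M A) i j x y = gmult (gobj ?N A) i j x y" "x \<in> gcarrier (gobj ?N A) i"
    if "f2_algebra A" "x \<in> gcarrier (gobj ?M A) i" "y \<in> gcarrier (gobj ?M A) j" for A i j x y
    using that by (auto simp: M.carrier_eq N.carrier_eq M.mult_eq N.mult_eq trunc)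
  have map: "gmap ?M A B h n x = gmap ?N A B h n x"
    if "f2_algebra A" "f2_algebra B" "h \<in> alg_hom A B" "x \<in> gcarrier (gobj ?M A) n" for A B h n x
    using that by (auto simp: M.carrier_eq M.map_eq N.map_eq trunc)
  have one: "gone (gobj ?M A) = gone (gobj ?N A)" if "f2_algebra A" for A
    using that by (simp add: M.one_eq N.one_eq)
  show ?thesis
    unfolding graded_monoid_functor_morphism_def
  proof (intro conjI allI impI ballI)
    fix A :: "'a ring" assume A: "f2_algebra A"
    interpret graded_monoid "gobj ?M A" by (rule MF.obj[OF A])
    show "adjoint_morphism poly_to_series A \<in> graded_hom (gobj ?M A) (gobj ?N A)"
      unfolding graded_hom_def
      using eq(2)[OF A] by (auto simp: adjoint_poly_to_series[OF A] gmult_closed gone_closed simp flip: eq(1)[OF A] one[OF A])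
  next
    fix A B :: "'a ring" and h n x
    assume *: "f2_algebra A" "f2_algebra B" "h \<in> alg_hom A B" and x: "x \<in> gcarrier (gobj ?M A) n"
    have "gmap ?M A B h n x \<in> gcarrier (gobj ?M B) n"
      using MF.map[OF *] x by (auto simp: graded_hom_def)
    then show "adjoint_morphism poly_to_series B n (gmap ?M A B h n x) =
        gmap ?N A B h n (adjoint_morphism poly_to_series A n x)"
      using * x by (simp add: adjoint_poly_to_series map)
  qed (rule M.is_graded_monoid_functor N.is_graded_monoid_functor)+
qed

text \<open>\<open>\<phi>\<close> is applied at every exponent, also where the universal polynomial
  has coefficient zero; being a morphism, it commutes with forming the series. This is the form
  required by \<open>Hom_functor_iso\<close>.\<close>

lemma Bplus_universal_eq:
  assumes A: "f2_algebra A" and \<phi>: "\<phi> \<in> alg_hom (truncated_Steenrod (enat n)) A"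
  shows "Bplus_universal A n \<phi> = additive_series A (\<lambda>k. \<phi> (truncated_gen (enat n) k))"
proof -
  let ?S = "truncated_Steenrod (enat n)"
  interpret S: f2_algebra_ring ?S by (simp add: f2_algebra_ring_def truncated_Steenrod_f2_algebra)
  have gen: "gen k \<in> carrier ?S" if "k \<le> n" for k
    using truncated_gen_closed[of "enat n" k] that by (simp add: truncated_gen_def)
  have "(\<lambda>k. if k \<le> n then gen k else \<zero>\<^bsub>?S\<^esub>) = truncated_gen (enat n)"
    by (auto simp: truncated_gen_def truncated_Steenrod_def f2_poly_ring_simps)
  then have "coeff (UP ?S) (additive_poly ?S n gen) = additive_series ?S (truncated_gen (enat n))"
    using S.coeff_UP[OF S.additive_poly_closed[of n gen, OF gen]] gen by (simp add: S.additive_poly_eq)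
  then show ?thesis
    unfolding Bplus_universal_def truncated_Steenrod_nat[symmetric]
    using hom_additive_series[OF S.is_cring _ alg_hom_ring_hom[OF \<phi>] truncated_gen_closed] A
    by (simp add: f2_algebra_def)
qed

lemma Steenrod_universal_eq:
  assumes A: "f2_algebra A" and \<phi>: "\<phi> \<in> alg_hom (truncated_Steenrod \<infinity>) A"
  shows "Steenrod_universal A n \<phi> = additive_series A (\<lambda>k. \<phi> (truncated_gen \<infinity> k))"
proof -
  let ?S = "truncated_Steenrod \<infinity>"
  interpret S: f2_algebra_ring ?S by (simp add: f2_algebra_ring_def truncated_Steenrod_f2_algebra)
  have "truncated_gen \<infinity> = gen" by (simp add: truncated_gen_def[abs_def])
  then show ?thesis
    unfolding Steenrod_universal_def truncated_Steenrod_infinity[symmetric]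
    using hom_additive_series[OF S.is_cring _ alg_hom_ring_hom[OF \<phi>] truncated_gen_closed] A
    by (simp add: f2_algebra_def)
qed

theorem proposition4p3p6:
  shows
    "monoid_functor_morphism (O_functor Mplus) (Minf :: ('a, nat \<Rightarrow> 'a) monoid_functor) poly_to_series \<and>
     graded_monoid_functor_morphism Mplus (gamma_functor (Minf :: ('a, nat \<Rightarrow> 'a) monoid_functor))
       (adjoint_morphism poly_to_series) \<and>
     graded_bialgebra_morphism (gamma_bialgebra dual_Steenrod) Bplus theta \<and>
     (\<forall>n i. 1 \<le> i \<longrightarrow> theta n (gen i) = (if i \<le> n then gen i else 0)) \<and>
     induced_by Bplus (gamma_bialgebra dual_Steenrod)
       Mplus (gamma_functor (Minf :: ('a, nat \<Rightarrow> 'a) monoid_functor))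
       Bplus_universal Steenrod_universal (adjoint_morphism poly_to_series) theta"
proof (intro conjI allI impI)
  let ?M = "Mplus :: ('a, nat \<Rightarrow> 'a) graded_monoid_functor"
  let ?N = "gamma_functor (Minf :: ('a, nat \<Rightarrow> 'a) monoid_functor)"
  interpret M: additive_series_functor ?M enat by (rule Mplus_additive)
  interpret N: additive_series_functor ?N "\<lambda>_. \<infinity>" by (rule gamma_Minf_additive)
  show morphism: "graded_monoid_functor_morphism ?M ?N (adjoint_morphism poly_to_series)"
    by (rule poly_to_series_graded_morphism)
  then show "monoid_functor_morphism (O_functor Mplus) (Minf :: ('a, nat \<Rightarrow> 'a) monoid_functor) poly_to_series"
    by (rule monoid_functor_morphism_adjoint)
  show "graded_bialgebra_morphism (gamma_bialgebra dual_Steenrod) Bplus theta"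
    by (rule theta_bialgebra_morphism)
  show "theta n (gen i) = (if i \<le> n then gen i else 0)" if "1 \<le> i" for n i
    using that by (rule theta_gen)
  have \<rho>: "graded_monoid_functor_iso (Hom_functor Bplus) ?M Bplus_universal"
    unfolding Bplus_eq_truncated by (rule M.Hom_functor_iso[OF Bplus_universal_eq])
  have \<sigma>: "graded_monoid_functor_iso (Hom_functor (gamma_bialgebra dual_Steenrod)) ?N Steenrod_universal"
    unfolding gamma_dual_Steenrod_eq_truncated by (rule N.Hom_functor_iso[OF Steenrod_universal_eq])
  have "adjoint_morphism poly_to_series A n (Bplus_universal A n \<phi>) =
      Steenrod_universal A n (compose (carrier (galg (gamma_bialgebra dual_Steenrod) n)) \<phi> (theta n))"
    if A: "f2_algebra A" and \<phi>: "\<phi> \<in> alg_hom (galg Bplus n) A" for A :: "'a ring" and n \<phi>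
  proof -
    have \<phi>': "\<phi> \<in> alg_hom (truncated_Steenrod (enat n)) A"
      using \<phi> by (simp add: Bplus_eq_truncated truncated_bialgebra_simps)
    have comp: "compose (carrier (truncated_Steenrod \<infinity>)) \<phi> (theta n) \<in> alg_hom (truncated_Steenrod \<infinity>) A"
      by (rule alg_hom_compose[OF _ alg_hom_ring_hom[OF theta_hom] alg_hom_ring_hom[OF \<phi>']])
        (use truncated_Steenrod_f2_algebra[of \<infinity>] in \<open>simp add: f2_algebra_def cring_def\<close>)
    have "Bplus_universal A n \<phi> \<in> gcarrier (gobj ?M A) n"
      using \<rho> A \<phi> by (auto simp: graded_monoid_functor_iso_def bij_betw_def Hom_functor_def)
    then have "adjoint_morphism poly_to_series A n (Bplus_universal A n \<phi>) = Bplus_universal A n \<phi>"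
      by (rule adjoint_poly_to_series[OF A])
    \<comment> \<open>Both are series with coefficients
      \<open>\<phi> (truncated_gen (enat n) k)\<close>: on the right, \<open>theta n\<close> turns
      the generic sequence of bound \<open>\<infinity>\<close> into that of bound \<open>n\<close>,
      with zeros beyond \<open>n\<close>.\<close>
    also have "\<dots> = Steenrod_universal A n (compose (carrier (truncated_Steenrod \<infinity>)) \<phi> (theta n))"
      by (simp add: Bplus_universal_eq[OF A \<phi>'] Steenrod_universal_eq[OF A comp] compose_eq truncated_gen_closed
          theta_truncated_gen)
    finally show ?thesis by (simp add: gamma_dual_Steenrod_eq_truncated truncated_bialgebra_simps)
  qed
  then show "induced_by Bplus (gamma_bialgebra dual_Steenrod) Mplus ?N
      Bplus_universal Steenrod_universal (adjoint_morphism poly_to_series) theta"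
    unfolding induced_by_def using \<rho> \<sigma> theta_bialgebra_morphism by blast
qed

end
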